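(* Let $\mathcal{L}=\mathfrak{n}/\mathfrak{m}$ and $L$ be as in the context, and let $s=|S|$ be the number of symbols $\otimes$ in the diagram $\mathcal{D}_{\mathcal{L}}$, with $S=\{\xi_1,\ldots,\xi_s\}$, where $\xi_i$ is the place receiving $\otimes$ at step $i$. Then there exist $z_1,\ldots,z_s\in K[\mathcal{L}^*]^L$ such that: (1) for every $i$, $z_i=y_{\xi_i}Q_i+P_{>i}$, where $Q_i$ is some product of powers of $z_1,\ldots,z_{i-1}$ and $P_{>i}$ is a polynomial in the variables $y_\eta$ with $\eta\succ\xi_i$; (2) if $\mathcal{Z}$ denotes the multiplicative (denominator) subset generated by $z_1,\ldots,z_s$, then the localization $K[\mathcal{L}^*]_{\mathcal{Z}}$ is isomorphic as a Poisson algebra to the tensor product $K[z_1^{\pm1},\ldots,z_s^{\pm1}]\otimes\mathbb{A}_m$ for some $m\ge 0$.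
   Context: $K$ is a field of characteristic zero, $n\ge 2$. $\mathfrak{n}=\mathfrak{ut}(n,K)$ is the Lie algebra of strictly lower triangular $n\times n$ matrices, $N=\mathrm{UT}(n,K)$ the group of lower unitriangular matrices. $A=\{(i,j): n\ge i>j\ge 1\}$, and $y_{ij}$ ($(i,j)\in A$) denotes the matrix unit $E_{ij}$, so $[y_{ab},y_{cd}]=\delta_{bc}y_{ad}-\delta_{da}y_{cb}$; we also write $y_\xi$ for $y_{ij}$ with $\xi=(i,j)$. Let $M\subset A$ be a subset such that $\mathfrak{m}=\mathrm{span}_K\{y_\xi:\xi\in M\}$ is an ideal of $\mathfrak{n}$; $\mathcal{L}=\mathfrak{n}/\mathfrak{m}$ and $L=N/\exp(\mathfrak{m})$. $K[\mathcal{L}^*]$ is identified with the symmetric algebra $S(\mathcal{L})$, i.e. the polynomial algebra in $y_\xi$, $\xi\in A\setminus M$ (with $y_\xi=0$ for $\xi\in M$), with Poisson bracket determined by $\{x,y\}=[x,y]$ for $x,y\in\mathcal{L}$; $K[\mathcal{L}^*]^L$ is the algebra of invariants of the coadjoint action of $L$. $\mathbb{A}_m$ is the Poisson algebra $K[p_1,\ldots,p_m,q_1,\ldots,q_m]$ with $\{p_i,q_j\}=\delta_{ij}$, $\{p_i,p_j\}=\{q_i,q_j\}=0$; a tensor product of Poisson algebras means the tensor product of commutative algebras with the two factors Poisson-commuting. Order on $A$: $(i,j)\succ(i',j')$ iff $j<j'$, or $j=j'$ and $i>i'$ (so $(n,1)\succ(n-1,1)\succ\cdots\succ(2,1)\succ(n,2)\succ\cdots\succ(n,n-1)$).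 Diagram $\mathcal{D}_{\mathcal{L}}$: places of $A$ are filled with symbols $\bullet,\otimes,+,-$. Step 0: fill every place of $M$ with $\bullet$. Step $i\ge1$ (performed while unfilled places of $A$ remain): put $\otimes$ on the $\succ$-greatest unfilled place $(k,t)$; then for each $a$ with $t<a<k$ such that both $(k,a)$ and $(a,t)$ are still unfilled, put $-$ on $(k,a)$ and $+$ on $(a,t)$ (if one of these two places is already filled, leave the other unchanged). The process ends when all places are filled. $S$, $C^+$, $C^-$ denote the sets of places filled with $\otimes$, $+$, $-$ respectively, so $A=M\sqcup C^+\sqcup C^-\sqcup S$. *)

theory Defs
  imports Main "HOL-Library.Poly_Mapping"
begin

text \<open>Places (i,j) with n >= i > j >= 1 (strictly lower triangular matrix units).\<close>
definition A_set :: "nat \<Rightarrow> (nat \<times> nat) set" where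
  "A_set n = {(i, j). 1 \<le> j \<and> j < i \<and> i \<le> n}"

definition succA :: "nat \<times> nat \<Rightarrow> nat \<times> nat \<Rightarrow> bool" where
  "succA p q \<longleftrightarrow> snd p < snd q \<or> (snd p = snd q \<and> fst p > fst q)"

text \<open>M spans an ideal of the Lie algebra of strictly lower triangular matrices.\<close>
definition is_ideal_set :: "nat \<Rightarrow> (nat \<times> nat) set \<Rightarrow> bool" where
  "is_ideal_set n M \<longleftrightarrow> M \<subseteq> A_set n \<and>
     (\<forall>a b c. (a, b) \<in> A_set n \<and> (b, c) \<in> A_set n \<and> ((a, b) \<in> M \<or> (b, c) \<in> M)
        \<longrightarrow> (a, c) \<in> M)"

datatype symb = Bullet | Otimes | Plus | Minus

type_synonym filling = "nat \<times> nat \<Rightarrow> symb option"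

definition unfilled :: "nat \<Rightarrow> filling \<Rightarrow> (nat \<times> nat) set" where
  "unfilled n f = {\<xi> \<in> A_set n. f \<xi> = None}"

definition greatest_place :: "(nat \<times> nat) set \<Rightarrow> nat \<times> nat" where
  "greatest_place U = (THE \<xi>. \<xi> \<in> U \<and> (\<forall>\<eta>\<in>U. \<eta> \<noteq> \<xi> \<longrightarrow> succA \<xi> \<eta>))"

definition diag_step :: "nat \<Rightarrow> filling \<Rightarrow> filling" where
  "diag_step n f = (let (k, t) = greatest_place (unfilled n f) in
     (\<lambda>\<xi>. if \<xi> = (k, t) then Some Otimes
          else if (\<exists>a. t < a \<and> a < k \<and> \<xi> = (k, a) \<and> f (k, a) = None \<and> f (a, t) = None)
            then Some Minus
          else if (\<exists>a. t < a \<and> a < k \<and> \<xi> = (a, t) \<and> f (k, a) = None \<and> f (a, t) = None)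
            then Some Plus
          else f \<xi>))"

primrec diag_fill :: "nat \<Rightarrow> (nat \<times> nat) set \<Rightarrow> nat \<Rightarrow> filling" where
  "diag_fill n M 0 = (\<lambda>\<xi>. if \<xi> \<in> M then Some Bullet else None)"
| "diag_fill n M (Suc i) =
     (if unfilled n (diag_fill n M i) = {} then diag_fill n M i
      else diag_step n (diag_fill n M i))"

text \<open>Number s of otimes symbols = number of steps performed.\<close>
definition diag_s :: "nat \<Rightarrow> (nat \<times> nat) set \<Rightarrow> nat" where
  "diag_s n M = (LEAST i. unfilled n (diag_fill n M i) = {})"

text \<open>The place receiving otimes at step i+1 (0-indexed: xi_0, ..., xi_(s-1)).\<close>
definition diag_xi :: "nat \<Rightarrow> (nat \<times> nat) set \<Rightarrow> nat \<Rightarrow> nat \<times> nat" where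
  "diag_xi n M i = greatest_place (unfilled n (diag_fill n M i))"

text \<open>Polynomials over K in variables indexed by 'v, exponents in 'e (nat: polynomials,
  int: Laurent polynomials).\<close>
type_synonym ('v, 'e, 'k) mpoly = "('v \<Rightarrow>\<^sub>0 'e) \<Rightarrow>\<^sub>0 'k"

definition var :: "'v \<Rightarrow> ('v, 'e::{zero,one}, 'k::{zero,one}) mpoly" where
  "var v = Poly_Mapping.single (Poly_Mapping.single v 1) 1"

definition const :: "'k \<Rightarrow> ('v, 'e::zero, 'k::zero) mpoly" where
  "const c = Poly_Mapping.single 0 c"

definition vars_in :: "('v, 'e::zero, 'k::zero) mpoly \<Rightarrow> 'v set \<Rightarrow> bool" where
  "vars_in p V \<longleftrightarrow> (\<forall>mo\<in>Poly_Mapping.keys p. Poly_Mapping.keys mo \<subseteq> V)"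

definition pd :: "'v \<Rightarrow> ('v, nat, 'k::comm_ring_1) mpoly \<Rightarrow> ('v, nat, 'k) mpoly" where
  "pd v p = (\<Sum>mo\<in>Poly_Mapping.keys p. Poly_Mapping.single (mo - Poly_Mapping.single v 1)
                (of_nat (Poly_Mapping.lookup mo v) * Poly_Mapping.lookup p mo))"

definition pdL :: "'v \<Rightarrow> ('v, int, 'k::comm_ring_1) mpoly \<Rightarrow> ('v, int, 'k) mpoly" where
  "pdL v p = (\<Sum>mo\<in>Poly_Mapping.keys p. Poly_Mapping.single (mo - Poly_Mapping.single v 1)
                (of_int (Poly_Mapping.lookup mo v) * Poly_Mapping.lookup p mo))"

definition subst :: "('v \<Rightarrow> ('v, nat, 'k::comm_ring_1) mpoly) \<Rightarrow> ('v, nat, 'k) mpoly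
                      \<Rightarrow> ('v, nat, 'k) mpoly" where
  "subst \<sigma> p = (\<Sum>mo\<in>Poly_Mapping.keys p. const (Poly_Mapping.lookup p mo) * (\<Prod>v\<in>Poly_Mapping.keys mo. \<sigma> v ^ Poly_Mapping.lookup mo v))"

definition yv :: "(nat \<times> nat) set \<Rightarrow> nat \<times> nat \<Rightarrow> (nat \<times> nat, nat, 'k::comm_ring_1) mpoly" where
  "yv M \<xi> = (if \<xi> \<in> M then 0 else var \<xi>)"

definition lie_br :: "(nat \<times> nat) set \<Rightarrow> nat \<times> nat \<Rightarrow> nat \<times> nat \<Rightarrow> (nat \<times> nat, nat, 'k::comm_ring_1) mpoly" where
  "lie_br M \<xi> \<eta> = (case \<xi> of (a, b) \<Rightarrow> case \<eta> of (c, d) \<Rightarrow>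
      (if b = c then yv M (a, d) else 0) - (if d = a then yv M (c, b) else 0))"

definition KL :: "nat \<Rightarrow> (nat \<times> nat) set \<Rightarrow> (nat \<times> nat, nat, 'k::comm_ring_1) mpoly set" where
  "KL n M = {p. vars_in p (A_set n - M)}"

text \<open>The Poisson bracket on S(L) determined by {x,y} = [x,y] for x,y in L.\<close>
definition pbr :: "nat \<Rightarrow> (nat \<times> nat) set \<Rightarrow> (nat \<times> nat, nat, 'k::comm_ring_1) mpoly
                   \<Rightarrow> (nat \<times> nat, nat, 'k) mpoly \<Rightarrow> (nat \<times> nat, nat, 'k) mpoly" where
  "pbr n M f g = (\<Sum>\<xi>\<in>A_set n - M. \<Sum>\<eta>\<in>A_set n - M. pd \<xi> f * pd \<eta> g * lie_br M \<xi> \<eta>)"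

definition lower_unitri :: "nat \<Rightarrow> (nat \<Rightarrow> nat \<Rightarrow> 'k::comm_ring_1) \<Rightarrow> bool" where
  "lower_unitri n g \<longleftrightarrow> (\<forall>a\<in>{1..n}. g a a = 1) \<and> (\<forall>a\<in>{1..n}. \<forall>b\<in>{1..n}. a < b \<longrightarrow> g a b = 0)"

definition mat_inverse :: "nat \<Rightarrow> (nat \<Rightarrow> nat \<Rightarrow> 'k::comm_ring_1) \<Rightarrow> (nat \<Rightarrow> nat \<Rightarrow> 'k) \<Rightarrow> bool" where
  "mat_inverse n g h \<longleftrightarrow> (\<forall>a\<in>{1..n}. \<forall>b\<in>{1..n}.
      (\<Sum>c=1..n. g a c * h c b) = (if a = b then 1 else 0))"

text \<open>Action of g (with inverse h) on K[L*]: the algebra automorphism sending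
  y_xi to the image of Ad_g(y_xi) = g E_xi g^(-1) in n/m, i.e.
  y_(i,j) to sum over (a,b) of g_(a,i) h_(j,b) y_(a,b).\<close>
definition coad_act :: "nat \<Rightarrow> (nat \<times> nat) set \<Rightarrow> (nat \<Rightarrow> nat \<Rightarrow> 'k::comm_ring_1) \<Rightarrow> (nat \<Rightarrow> nat \<Rightarrow> 'k)
     \<Rightarrow> (nat \<times> nat, nat, 'k) mpoly \<Rightarrow> (nat \<times> nat, nat, 'k) mpoly" where
  "coad_act n M g h f = subst (\<lambda>(i, j). \<Sum>(a, b)\<in>A_set n - M. const (g a i * h j b) * var (a, b)) f"

definition invariants :: "nat \<Rightarrow> (nat \<times> nat) set \<Rightarrow> (nat \<times> nat, nat, 'k::comm_ring_1) mpoly set" where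
  "invariants n M = {f \<in> KL n M. \<forall>g h. lower_unitri n g \<and> lower_unitri n h \<and> mat_inverse n g h
       \<longrightarrow> coad_act n M g h f = f}"

text \<open>Variables: Inl i = z_i (i < s), Inr (Inl j) = p_j, Inr (Inr j) = q_j (j < m).
  The z_i carry integer exponents, p_j, q_j nonnegative ones.\<close>
type_synonym tvar = "nat + (nat + nat)"

definition target :: "nat \<Rightarrow> nat \<Rightarrow> (tvar, int, 'k::comm_ring_1) mpoly set" where
  "target s m = {b. \<forall>mo\<in>Poly_Mapping.keys b. \<forall>v\<in>Poly_Mapping.keys mo. (case v of
       Inl i \<Rightarrow> i < s
     | Inr (Inl j) \<Rightarrow> j < m \<and> Poly_Mapping.lookup mo v \<ge> 0
     | Inr (Inr j) \<Rightarrow> j < m \<and> Poly_Mapping.lookup mo v \<ge> 0)}"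

text \<open>Bracket: the z_i are Poisson central (zero bracket on the Laurent factor),
  {p_i, q_j} = delta_ij, {p_i,p_j} = {q_i,q_j} = 0, factors Poisson-commute.\<close>
definition target_br :: "nat \<Rightarrow> (tvar, int, 'k::comm_ring_1) mpoly \<Rightarrow> (tvar, int, 'k) mpoly
                         \<Rightarrow> (tvar, int, 'k) mpoly" where
  "target_br m a b = (\<Sum>j<m. pdL (Inr (Inl j)) a * pdL (Inr (Inr j)) b
                          - pdL (Inr (Inr j)) a * pdL (Inr (Inl j)) b)"

definition zinv :: "nat \<Rightarrow> (tvar, int, 'k::comm_ring_1) mpoly" where
  "zinv i = Poly_Mapping.single (Poly_Mapping.single (Inl i) (-1)) 1"

text \<open>phi : K[L*] -> B induces a Poisson isomorphism K[L*]_Z -> B sending z_i to z_i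
  (universal property of the localization at the multiplicative set generated by the z_i):
  phi is an injective K-algebra homomorphism preserving brackets, phi(z_i) = z_i
  (a unit of B), and every element of B is phi(f) times a monomial in the z_i^(-1).\<close>
definition localization_poisson_iso ::
  "nat \<Rightarrow> (nat \<times> nat) set \<Rightarrow> nat \<Rightarrow> (nat \<Rightarrow> (nat \<times> nat, nat, 'k::comm_ring_1) mpoly) \<Rightarrow> nat
   \<Rightarrow> ((nat \<times> nat, nat, 'k) mpoly \<Rightarrow> (tvar, int, 'k) mpoly) \<Rightarrow> bool" where
  "localization_poisson_iso n M s z m \<phi> \<longleftrightarrow>
     (\<forall>p\<in>KL n M. \<phi> p \<in> target s m) \<and>
     (\<forall>p\<in>KL n M. \<forall>q\<in>KL n M. \<phi> (p + q) = \<phi> p + \<phi> q) \<and>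
     (\<forall>p\<in>KL n M. \<forall>q\<in>KL n M. \<phi> (p * q) = \<phi> p * \<phi> q) \<and>
     (\<forall>c. \<phi> (const c) = const c) \<and>
     inj_on \<phi> (KL n M) \<and>
     (\<forall>p\<in>KL n M. \<forall>q\<in>KL n M. \<phi> (pbr n M p q) = target_br m (\<phi> p) (\<phi> q)) \<and>
     (\<forall>i<s. \<phi> (z i) = var (Inl i)) \<and>
     (\<forall>b\<in>target s m. \<exists>p\<in>KL n M. \<exists>\<alpha>::nat \<Rightarrow> nat.
         b = \<phi> p * (\<Prod>i<s. zinv i ^ \<alpha> i))"

end

theory Submission
  imports Defs
begin

text \<open>One step of the diagram, with \<open>\<otimes>\<close> on \<open>(k, t)\<close>, is a reduction. In the Lie algebra spanned by the
  unfilled places the element \<open>y\<^bsub>kt\<^esub>\<close> is central, and the pairs \<open>y\<^bsub>ka\<^esub>, y\<^bsub>at\<^esub>\<close> filled with \<open>-\<close> and \<open>+\<close>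
  form a Heisenberg algebra over it. Clearing column \<open>t\<close> of the generic matrix by a conjugation with pivot
  \<open>y\<^bsub>kt\<^esub>\<close> produces elements that commute with these pairs and satisfy the linear bracket relations of the
  places which remain unfilled. Read backwards, this lifts generators for the remaining places to generators
  for all unfilled places inside the Laurent algebra \<open>K[z\<^sup>\<plusminus>\<^sup>1] \<otimes> A\<^sub>m\<close>, so downward recursion along the diagram
  gives a Poisson homomorphism \<open>\<phi>\<close> that is triangular for \<open>\<succ>\<close>. Triangularity yields injectivity and, after
  clearing denominators, preimages \<open>z\<^sub>i\<close> of the Laurent variables (up to a normalisation of \<open>\<phi>\<close> chosen step by
  step) and surjectivity after localisation. The \<open>z\<^sub>i\<close> are Poisson-central, hence invariant since the
  characteristic is zero.\<close>

text \<open>Two obstacles shape the proof. First, a step fills only complete pairs: an entry of row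
  \<open>k\<close> or column \<open>t\<close> whose partner is already filled survives the step. The
  remaining places are therefore no block of the matrix, and the bracket relations after the
  conjugation hold only because of closure conditions on the unfilled places; each relation comes
  out of one of several mechanisms, and the closure conditions ensure that exactly one of them acts.
  Second, the generator at a pivot equals a leading term plus a correction with denominators.
  Clearing these multiplies the leading term by earlier \<open>z j\<close>, so its image would be a
  variable times a monomial and not the variable itself. Laurent monomials in the \<open>z j\<close>
  are Poisson central, so rescaling a pivot by them preserves all brackets; the construction thus
  carries free exponents \<open>e\<close>. The correction at the \<open>i\<close>-th pivot depends
  only on \<open>e j\<close> with \<open>j < i\<close>, so \<open>e i\<close> may be fixed once its
  denominators are known. Characteristic zero acts through a single fact: a polynomial with
  vanishing derivative in a variable does not contain it.\<close>

lemma poly_mapping_sum_single: "(p :: 'm \<Rightarrow>\<^sub>0 'c::comm_monoid_add) = (\<Sum>k\<in>Poly_Mapping.keys p. Poly_Mapping.single k (Poly_Mapping.lookup p k))"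
  by (rule poly_mapping_eqI)
    (auto simp: lookup_sum lookup_single when_def in_keys_iff sum.delta')

lemma poly_mapping_induct_single [case_names zero single add]:
  fixes p :: "'m \<Rightarrow>\<^sub>0 'c::comm_monoid_add"
  assumes "P 0" "\<And>k c. P (Poly_Mapping.single k c)" "\<And>p q. P p \<Longrightarrow> P q \<Longrightarrow> P (p + q)"
  shows "P p"
proof -
  have "P (\<Sum>k\<in>A. Poly_Mapping.single k (Poly_Mapping.lookup p k))" if "finite A" for A
    using that by induction (auto intro: assms)
  from this[of "Poly_Mapping.keys p"] show ?thesis
    using poly_mapping_sum_single[of p] by simp
qed

lemma sum_keys_add:
  assumes "\<And>k. f k 0 = (0::'b::comm_monoid_add)" "\<And>k a b. f k (a + b) = f k a + f k b"
  shows "(\<Sum>k\<in>Poly_Mapping.keys (p + q). f k (Poly_Mapping.lookup (p + q) k)) =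
    (\<Sum>k\<in>Poly_Mapping.keys p. f k (Poly_Mapping.lookup p k)) + (\<Sum>k\<in>Poly_Mapping.keys q. f k (Poly_Mapping.lookup q k))"
  using setsum_keys_plus_distrib[of f p q] assms by (auto simp: lookup_add)

section \<open>Derivations\<close>

lemma pd_single: "pd v (Poly_Mapping.single mo c) =
    Poly_Mapping.single (mo - Poly_Mapping.single v 1) (of_nat (Poly_Mapping.lookup mo v) * c)"
  unfolding pd_def by (cases "c = 0") auto

lemma pd_add: "pd v (p + q) = pd v p + pd v q"
  unfolding pd_def by (rule sum_keys_add) (auto simp: single_add algebra_simps)

lemma pdL_single: "pdL v (Poly_Mapping.single mo c) =
    Poly_Mapping.single (mo - Poly_Mapping.single v 1) (of_int (Poly_Mapping.lookup mo v) * c)"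
  unfolding pdL_def by (cases "c = 0") auto

lemma pdL_add: "pdL v (p + q) = pdL v p + pdL v q"
  unfolding pdL_def by (rule sum_keys_add) (auto simp: single_add algebra_simps)

lemma additive_zero: "(\<And>p q. f (p + q) = f p + f q) \<Longrightarrow> f 0 = 0" for f :: "'a::monoid_add \<Rightarrow> 'b::group_add"
proof -
  assume "\<And>p q. f (p + q) = f p + f q"
  from this[of 0 0] show ?thesis by (metis add.right_neutral add_left_cancel)
qed

lemma pd_zero [simp]: "pd v 0 = 0" by (simp add: pd_def)
lemma pdL_zero [simp]: "pdL v 0 = 0" by (simp add: pdL_def)

text \<open>Both sides of the product rule are additive in each factor, so single terms decide
  it.\<close>

lemma Leibniz_from_singles:
  fixes D :: "('m::monoid_add \<Rightarrow>\<^sub>0 'c::comm_ring_1) \<Rightarrow> ('m \<Rightarrow>\<^sub>0 'c)"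
  assumes add: "\<And>p q. D (p + q) = D p + D q"
    and single: "\<And>k a l b. D (Poly_Mapping.single k a * Poly_Mapping.single l b) =
      D (Poly_Mapping.single k a) * Poly_Mapping.single l b + Poly_Mapping.single k a * D (Poly_Mapping.single l b)"
  shows "D (p * q) = D p * q + p * D q"
proof -
  have 0: "D 0 = 0" by (rule additive_zero[OF add])
  have 1: "D (Poly_Mapping.single k a * q) = D (Poly_Mapping.single k a) * q + Poly_Mapping.single k a * D q" for k a
    by (induction q rule: poly_mapping_induct_single) (auto simp: 0 single add algebra_simps)
  show ?thesis
    by (induction p rule: poly_mapping_induct_single) (auto simp: 0 1 add algebra_simps)
qed

lemma pd_mult: "pd v (p * q) = pd v p * q + p * pd v q"
proof (rule Leibniz_from_singles[where D = "pd v", OF pd_add])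
  fix k l :: "'a \<Rightarrow>\<^sub>0 nat" and a b :: 'b
  \<comment> \<open>Exponent subtraction is truncated, so the two monomials may differ when
    \<open>v\<close> is absent from \<open>k\<close>; the coefficient is then 0 and both terms
    vanish.\<close>
  have 1: "Poly_Mapping.single (k + l - Poly_Mapping.single v 1) (of_nat (Poly_Mapping.lookup k v) * (a * b))
    = Poly_Mapping.single (k - Poly_Mapping.single v 1 + l) (of_nat (Poly_Mapping.lookup k v) * (a * b))"
  proof (cases "Poly_Mapping.lookup k v = 0")
    case False
    have "k + l - Poly_Mapping.single v 1 = k - Poly_Mapping.single v 1 + l"
      using False by (intro poly_mapping_eqI) (auto simp: lookup_add lookup_minus lookup_single when_def)
    then show ?thesis by simp
  qed simp
  have 2: "Poly_Mapping.single (k + l - Poly_Mapping.single v 1) (of_nat (Poly_Mapping.lookup l v) * (a * b))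
    = Poly_Mapping.single (k + (l - Poly_Mapping.single v 1)) (of_nat (Poly_Mapping.lookup l v) * (a * b))"
  proof (cases "Poly_Mapping.lookup l v = 0")
    case False
    have "k + l - Poly_Mapping.single v 1 = k + (l - Poly_Mapping.single v 1)"
      using False by (intro poly_mapping_eqI) (auto simp: lookup_add lookup_minus lookup_single when_def)
    then show ?thesis by simp
  qed simp
  show "pd v (Poly_Mapping.single k a * Poly_Mapping.single l b) =
      pd v (Poly_Mapping.single k a) * Poly_Mapping.single l b + Poly_Mapping.single k a * pd v (Poly_Mapping.single l b)"
    unfolding pd_single mult_single lookup_add of_nat_add distrib_right single_add 1 2 by (simp only: mult_ac)
qed

lemma pdL_mult: "pdL v (p * q) = pdL v p * q + p * pdL v q"
proof (rule Leibniz_from_singles[where D = "pdL v", OF pdL_add])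
  fix k l :: "'a \<Rightarrow>\<^sub>0 int" and a b :: 'b
  let ?e = "Poly_Mapping.single v (1::int)"
  have "k - ?e + l = k + l - ?e" "k + (l - ?e) = k + l - ?e"
    by (auto simp: algebra_simps)
  then show "pdL v (Poly_Mapping.single k a * Poly_Mapping.single l b) =
      pdL v (Poly_Mapping.single k a) * Poly_Mapping.single l b + Poly_Mapping.single k a * pdL v (Poly_Mapping.single l b)"
    unfolding pdL_single mult_single lookup_add of_int_add distrib_right single_add by (simp only: mult_ac)
qed

lemma pd_const [simp]: "pd v (const c) = 0"
  by (simp add: const_def pd_single)

lemma pdL_const [simp]: "pdL v (const c) = 0"
  by (simp add: const_def pdL_single)

lemma pd_var: "pd v (var u) = (if u = v then 1 else 0)"
  by (simp add: var_def pd_single lookup_single when_def)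

lemma pdL_var: "pdL v (var u) = (if u = v then 1 else 0)"
  by (simp add: var_def pdL_single lookup_single when_def)

lemma const_add: "const (a + b) = const a + const (b::'k::comm_ring_1)"
  by (simp add: const_def single_add)
lemma const_mult: "(const (a * b) :: ('v, 'e::comm_monoid_add, 'k::comm_ring_1) mpoly) = const a * const b"
  by (simp add: const_def mult_single)
lemma const_0 [simp]: "const 0 = 0" by (simp add: const_def)
lemma const_1 [simp]: "const 1 = 1" by (simp add: const_def)
lemma const_uminus: "const (- a) = - const (a::'k::comm_ring_1)"
  by (simp add: const_def single_uminus)

section \<open>Evaluation homomorphisms\<close>

definition mon :: "('v \<Rightarrow> 'a::comm_ring_1) \<Rightarrow> ('v \<Rightarrow>\<^sub>0 nat) \<Rightarrow> 'a" where
  "mon Y mo = (\<Prod>v\<in>Poly_Mapping.keys mo. Y v ^ Poly_Mapping.lookup mo v)"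

definition evalm :: "('k::comm_ring_1 \<Rightarrow> 'a::comm_ring_1) \<Rightarrow> ('v \<Rightarrow> 'a) \<Rightarrow> ('v, nat, 'k) mpoly \<Rightarrow> 'a" where
  "evalm c Y p = (\<Sum>mo\<in>Poly_Mapping.keys p. c (Poly_Mapping.lookup p mo) * mon Y mo)"

lemma subst_eq_evalm: "subst \<sigma> = evalm const \<sigma>"
  by (simp add: fun_eq_iff subst_def evalm_def mon_def)

lemma mon_superset: "finite A \<Longrightarrow> Poly_Mapping.keys mo \<subseteq> A \<Longrightarrow> mon Y mo = (\<Prod>v\<in>A. Y v ^ Poly_Mapping.lookup mo v)"
  unfolding mon_def by (rule prod.mono_neutral_left) (auto simp: in_keys_iff)

lemma mon_add: "mon Y (k + l) = mon Y k * mon Y l"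
proof -
  let ?A = "Poly_Mapping.keys k \<union> Poly_Mapping.keys l"
  have "mon Y (k + l) = (\<Prod>v\<in>?A. Y v ^ Poly_Mapping.lookup (k + l) v)"
    by (rule mon_superset) (auto dest: subsetD[OF keys_add])
  also have "\<dots> = mon Y k * mon Y l"
    by (simp add: mon_superset[of ?A] lookup_add power_add prod.distrib)
  finally show ?thesis .
qed

lemma mon_zero [simp]: "mon Y 0 = 1" by (simp add: mon_def)
lemma mon_single [simp]: "mon Y (Poly_Mapping.single v e) = Y v ^ e"
  by (simp add: mon_def)

locale scalar_hom =
  fixes c :: "'k::comm_ring_1 \<Rightarrow> 'a::comm_ring_1"
  assumes c_add: "c (a + b) = c a + c b" and c_mult: "c (a * b) = c a * c b" and c_1 [simp]: "c 1 = 1"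
begin

lemma c_0 [simp]: "c 0 = 0" by (rule additive_zero[OF c_add])

lemma evalm_single: "evalm c Y (Poly_Mapping.single mo a) = c a * mon Y mo"
  unfolding evalm_def by (cases "a = 0") auto

lemma evalm_add: "evalm c Y (p + q) = evalm c Y p + evalm c Y q"
  unfolding evalm_def by (rule sum_keys_add) (auto simp: c_add algebra_simps)

lemma evalm_0 [simp]: "evalm c Y 0 = 0" by (simp add: evalm_def)
lemma evalm_const [simp]: "evalm c Y (const a) = c a"
  by (simp add: const_def evalm_single)
lemma evalm_1 [simp]: "evalm c Y 1 = 1"
  using evalm_const[of Y 1] by simp
lemma evalm_var [simp]: "evalm c Y (var v) = Y v"
  by (simp add: var_def evalm_single)

lemma evalm_mult: "evalm c Y (p * q) = evalm c Y p * evalm c Y q"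
proof -
  have 1: "evalm c Y (Poly_Mapping.single k a * q) = evalm c Y (Poly_Mapping.single k a) * evalm c Y q" for k a
    by (induction q rule: poly_mapping_induct_single)
      (auto simp: evalm_single mult_single mon_add c_mult evalm_add algebra_simps)
  show ?thesis
    by (induction p rule: poly_mapping_induct_single) (auto simp: 1 evalm_add distrib_right)
qed

lemma evalm_uminus: "evalm c Y (- p) = - evalm c Y p"
  using evalm_add[of Y p "-p"] by (simp add: eq_neg_iff_add_eq_0 add.commute)
lemma evalm_diff: "evalm c Y (p - q) = evalm c Y p - evalm c Y q"
  using evalm_add[of Y p "-q"] by (simp add: evalm_uminus)
lemma evalm_sum: "evalm c Y (\<Sum>x\<in>A. f x) = (\<Sum>x\<in>A. evalm c Y (f x))"
  by (induction A rule: infinite_finite_induct) (auto simp: evalm_add)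
lemma evalm_prod: "evalm c Y (\<Prod>x\<in>A. f x) = (\<Prod>x\<in>A. evalm c Y (f x))"
  by (induction A rule: infinite_finite_induct) (auto simp: evalm_mult)
lemma evalm_power: "evalm c Y (p ^ m) = evalm c Y p ^ m"
  by (induction m) (auto simp: evalm_mult)

end

interpretation const: scalar_hom const
  by unfold_locales (auto simp: const_add const_mult)

lemma evalm_cong:
  assumes "vars_in p V" "\<And>v. v \<in> V \<Longrightarrow> Y v = Y' v"
  shows "evalm c Y p = evalm c Y' p"
  unfolding evalm_def mon_def
  by (intro sum.cong refl arg_cong2[where f = "(*)"] prod.cong)
    (use assms in \<open>auto 0 3 simp: vars_in_def intro!: arg_cong2[where f = "(^)"]\<close>)

lemma vars_in_mono: "vars_in p V \<Longrightarrow> V \<subseteq> W \<Longrightarrow> vars_in p W"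
  by (auto simp: vars_in_def)
lemma vars_in_0 [simp]: "vars_in 0 V" by (simp add: vars_in_def)
lemma vars_in_const [simp]: "vars_in (const c) V"
  by (simp add: vars_in_def const_def)
lemma vars_in_1 [simp]: "vars_in 1 V"
  by (simp add: vars_in_def)
lemma vars_in_var: "v \<in> V \<Longrightarrow> vars_in (var v) V"
  by (auto simp: vars_in_def var_def)
lemma vars_in_add: "vars_in p V \<Longrightarrow> vars_in q V \<Longrightarrow> vars_in (p + q) V"
  using keys_add[of p q] by (auto simp: vars_in_def)
lemma vars_in_uminus [simp]: "vars_in (- p) V = vars_in p V" for p :: "('v, 'e::zero, 'k::comm_ring_1) mpoly"
  by (auto simp: vars_in_def in_keys_iff)
lemma vars_in_diff: "vars_in p V \<Longrightarrow> vars_in q V \<Longrightarrow> vars_in (p - q) V" for p q :: "('v, 'e::zero, 'k::comm_ring_1) mpoly"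
  using vars_in_add[of p V "-q"] by simp
lemma vars_in_mult:
  assumes "vars_in p V" "vars_in q V"
  shows "vars_in (p * q) V"
  unfolding vars_in_def
proof
  fix mo assume "mo \<in> Poly_Mapping.keys (p * q)"
  then obtain a b where "mo = a + b" "a \<in> Poly_Mapping.keys p" "b \<in> Poly_Mapping.keys q"
    using keys_mult[of p q] by blast
  then show "Poly_Mapping.keys mo \<subseteq> V"
    using keys_add[of a b] assms by (auto simp: vars_in_def)
qed
lemma vars_in_sum: "(\<And>x. x \<in> A \<Longrightarrow> vars_in (f x) V) \<Longrightarrow> vars_in (\<Sum>x\<in>A. f x) V"
  by (induction A rule: infinite_finite_induct) (auto simp: vars_in_add)
lemma vars_in_prod: "(\<And>x. x \<in> A \<Longrightarrow> vars_in (f x) V) \<Longrightarrow> vars_in (\<Prod>x\<in>A. f x) V"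
  for f :: "_ \<Rightarrow> ('v, 'e::comm_monoid_add, 'k::comm_ring_1) mpoly"
  by (induction A rule: infinite_finite_induct) (auto simp: vars_in_mult)
lemma vars_in_power: "vars_in p V \<Longrightarrow> vars_in (p ^ m) V"
  for p :: "('v, 'e::comm_monoid_add, 'k::comm_ring_1) mpoly"
  by (induction m) (auto simp: vars_in_mult)

lemma vars_in_pd: "vars_in p V \<Longrightarrow> vars_in (pd v p) V"
  unfolding pd_def
proof (rule vars_in_sum)
  fix mo assume "vars_in p V" "mo \<in> Poly_Mapping.keys p"
  moreover have "Poly_Mapping.keys (mo - Poly_Mapping.single v 1) \<subseteq> Poly_Mapping.keys mo"
    by (auto simp: in_keys_iff lookup_minus)
  ultimately show "vars_in (Poly_Mapping.single (mo - Poly_Mapping.single v 1)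
      (of_nat (Poly_Mapping.lookup mo v) * Poly_Mapping.lookup p mo)) V"
    unfolding vars_in_def by auto
qed

lemma single_eq_const_mon:
  "(Poly_Mapping.single mo a :: ('v, nat, 'k::comm_ring_1) mpoly) = const a * mon var mo"
proof -
  have "mon var mo = (Poly_Mapping.single mo 1 :: ('v, nat, 'k) mpoly)" for mo :: "'v \<Rightarrow>\<^sub>0 nat"
  proof (induction mo rule: poly_mapping_induct_single)
    case (single k c)
    have "var k ^ c = (Poly_Mapping.single (Poly_Mapping.single k c) 1 :: ('v, nat, 'k) mpoly)"
      by (induction c) (auto simp: var_def mult_single single_add[symmetric])
    then show ?case by simp
  qed (auto simp: mon_add mult_single)
  then show ?thesis by (simp add: const_def mult_single)
qed

lemma vars_in_induct [consumes 1, case_names const var add mult]: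
  fixes p :: "('v, nat, 'k::comm_ring_1) mpoly"
  assumes p: "vars_in p V"
    and const: "\<And>c. P (const c)" and var: "\<And>v. v \<in> V \<Longrightarrow> P (var v)"
    and add: "\<And>p q. vars_in p V \<Longrightarrow> vars_in q V \<Longrightarrow> P p \<Longrightarrow> P q \<Longrightarrow> P (p + q)"
    and mult: "\<And>p q. vars_in p V \<Longrightarrow> vars_in q V \<Longrightarrow> P p \<Longrightarrow> P q \<Longrightarrow> P (p * q)"
  shows "P p"
proof -
  define Q where "Q = (\<lambda>p. vars_in p V \<and> P p)"
  have Q1: "Q 1" unfolding Q_def using const[of 1] by simp
  have Qp: "Q (var v ^ m)" if "v \<in> V" for v m
    by (induction m) (use Q1 that in \<open>auto simp: Q_def vars_in_mult vars_in_var intro: mult var\<close>)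
  have Qm: "Q (\<Prod>v\<in>A. var v ^ f v)" if "A \<subseteq> V" "finite A" for A f
    using that(2,1) by induction (use Q1 Qp in \<open>auto simp: Q_def vars_in_mult intro: mult\<close>)
  have Qs: "Q (Poly_Mapping.single mo a)" if "Poly_Mapping.keys mo \<subseteq> V" for mo a
    unfolding single_eq_const_mon mon_def using Qm[OF that finite_keys] const
    by (auto simp: Q_def vars_in_mult intro: mult)
  have "Q (\<Sum>mo\<in>A. Poly_Mapping.single mo (Poly_Mapping.lookup p mo))"
    if "finite A" "A \<subseteq> Poly_Mapping.keys p" for A
    using that
  proof (induction A)
    case empty
    then show ?case using const[of 0] by (simp add: Q_def)
  next
    case (insert mo A)
    then have "Q (Poly_Mapping.single mo (Poly_Mapping.lookup p mo))"
      using p by (intro Qs) (auto simp: vars_in_def)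
    with insert show ?case by (auto simp: Q_def intro: add vars_in_add)
  qed
  from this[of "Poly_Mapping.keys p"] show ?thesis
    using poly_mapping_sum_single[of p] by (simp add: Q_def)
qed

text \<open>Both sides obey the same product rule along \<open>evalm c Y\<close> and agree on
  constants and variables. It is applied with \<open>D\<close> a bracket (compatibility with
  brackets), a Laurent derivative (injectivity) and the derivative in an auxiliary parameter
  (invariance).\<close>

lemma (in scalar_hom) chain_rule:
  assumes D: "\<And>x y. D (x + y) = D x + D y" "\<And>x y. D (x * y) = D x * y + x * D y" "\<And>a. D (c a) = 0"
    and V: "finite V" "vars_in p V"
  shows "D (evalm c Y p) = (\<Sum>v\<in>V. evalm c Y (pd v p) * D (Y v))"
  using V(2)
proof (induction p rule: vars_in_induct)
  case (var u)
  have "(\<Sum>v\<in>V. evalm c Y (pd v (var u)) * D (Y v)) = (\<Sum>v\<in>V. if v = u then D (Y v) else 0)"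
    by (intro sum.cong) (auto simp: pd_var)
  then show ?case using var V(1) by (simp add: sum.delta')
next
  case (mult p q)
  have "D (evalm c Y (p * q)) = D (evalm c Y p) * evalm c Y q + evalm c Y p * D (evalm c Y q)"
    by (simp add: evalm_mult D)
  also have "\<dots> = (\<Sum>v\<in>V. evalm c Y (pd v (p * q)) * D (Y v))"
    unfolding mult.IH sum_distrib_left sum_distrib_right sum.distrib[symmetric]
    by (intro sum.cong refl) (simp add: pd_mult evalm_add evalm_mult algebra_simps)
  finally show ?case .
qed (auto simp: D evalm_add pd_add distrib_right sum.distrib)

lemma evalm_evalm:
  assumes "scalar_hom c"
  shows "evalm c Y (evalm const \<sigma> p) = evalm c (\<lambda>v. evalm c Y (\<sigma> v)) p"
proof -
  interpret scalar_hom c by fact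
  have "vars_in p UNIV" by (simp add: vars_in_def)
  then show ?thesis
    by (induction p rule: vars_in_induct) (auto simp: evalm_add evalm_mult const.evalm_add const.evalm_mult)
qed

lemma evalm_const_var: "evalm const var p = p"
proof -
  have "vars_in p UNIV" by (simp add: vars_in_def)
  then show ?thesis
    by (induction p rule: vars_in_induct) (auto simp: const.evalm_add const.evalm_mult)
qed

lemma lookup_pd:
  fixes p :: "('v, nat, 'k::comm_ring_1) mpoly"
  shows "Poly_Mapping.lookup (pd v p) mo =
    of_nat (Poly_Mapping.lookup mo v + 1) * Poly_Mapping.lookup p (mo + Poly_Mapping.single v 1)"
proof (induction p rule: poly_mapping_induct_single)
  case (single k c)
  show ?case
  proof (cases "Poly_Mapping.lookup k v = 0")
    case True
    then have "k \<noteq> mo + Poly_Mapping.single v 1" by (auto simp: lookup_add)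
    then show ?thesis using True by (simp add: pd_single lookup_single)
  next
    case False
    then have "(k - Poly_Mapping.single v 1 = mo) = (k = mo + Poly_Mapping.single v 1)"
      by (auto simp: poly_mapping_eq_iff fun_eq_iff lookup_add lookup_minus lookup_single when_def)
    then show ?thesis using False by (auto simp: pd_single lookup_single when_def lookup_add)
  qed
qed (auto simp: pd_add lookup_add algebra_simps)

text \<open>A monomial containing \<open>v\<close> reappears in the derivative with its coefficient
  multiplied by a positive integer, which is nonzero in characteristic zero.\<close>

lemma pd_eq_0_imp_vars_in:
  fixes p :: "('v, nat, 'k::field_char_0) mpoly"
  assumes "pd v p = 0"
  shows "vars_in p (- {v})"
  unfolding vars_in_def
proof
  fix mo assume mo: "mo \<in> Poly_Mapping.keys p"
  have "v \<notin> Poly_Mapping.keys mo"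
  proof
    assume v: "v \<in> Poly_Mapping.keys mo"
    define m where "m = mo - Poly_Mapping.single v 1"
    have "m + Poly_Mapping.single v 1 = mo"
      using v by (intro poly_mapping_eqI) (auto simp: m_def lookup_add lookup_minus lookup_single when_def in_keys_iff)
    then have "of_nat (Poly_Mapping.lookup m v + 1) * Poly_Mapping.lookup p mo = 0"
      using lookup_pd[of v p m] assms by simp
    then have "Poly_Mapping.lookup p mo = 0"
      by (metis add_is_0 mult_eq_0_iff of_nat_eq_0_iff zero_neq_one)
    then show False using mo by (simp add: in_keys_iff)
  qed
  then show "Poly_Mapping.keys mo \<subseteq> - {v}" by auto
qed

section \<open>Laurent polynomials\<close>

text \<open>The parameter \<open>W\<close> records which variables may occur: suitably separated
  variable sets give vanishing brackets, and sets bounded by the order on places express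
  triangularity. Only \<open>Inl\<close> variables are invertible, as in
  \<open>target\<close>.\<close>

definition laurent_in :: "tvar set \<Rightarrow> (tvar, int, 'k::comm_ring_1) mpoly set" where
  "laurent_in W = {b. \<forall>mo\<in>Poly_Mapping.keys b. Poly_Mapping.keys mo \<subseteq> W \<and> (\<forall>x. Poly_Mapping.lookup mo (Inr x) \<ge> 0)}"

definition tvars :: "nat \<Rightarrow> nat \<Rightarrow> tvar set" where
  "tvars s m = Inl ` {..<s} \<union> Inr ` (Inl ` {..<m} \<union> Inr ` {..<m})"

lemma target_eq_laurent_in: "target s m = laurent_in (tvars s m)"
proof -
  have "(\<forall>v\<in>Poly_Mapping.keys mo. (case v of Inl i \<Rightarrow> i < s
     | Inr (Inl j) \<Rightarrow> j < m \<and> Poly_Mapping.lookup mo v \<ge> 0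
     | Inr (Inr j) \<Rightarrow> j < m \<and> Poly_Mapping.lookup mo v \<ge> 0)) \<longleftrightarrow>
     (Poly_Mapping.keys mo \<subseteq> tvars s m \<and> (\<forall>x. Poly_Mapping.lookup mo (Inr x) \<ge> 0))" (is "?L \<longleftrightarrow> ?R")
    for mo :: "tvar \<Rightarrow>\<^sub>0 int"
  proof
    assume L: ?L
    have "Poly_Mapping.keys mo \<subseteq> tvars s m"
      using L by (fastforce simp: tvars_def split: sum.splits)
    moreover have "Poly_Mapping.lookup mo (Inr x) \<ge> 0" for x
    proof (cases "Inr x \<in> Poly_Mapping.keys mo")
      case True
      then show ?thesis using L by (fastforce split: sum.splits)
    qed (simp add: in_keys_iff)
    ultimately show ?R by blast
  next
    assume ?R
    then show ?L by (auto simp: tvars_def subset_iff split: sum.splits)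
  qed
  then show ?thesis unfolding target_def laurent_in_def by simp
qed

lemma laurent_in_mono: "b \<in> laurent_in V \<Longrightarrow> V \<subseteq> W \<Longrightarrow> b \<in> laurent_in W"
  by (auto simp: laurent_in_def)
lemma laurent_in_0 [simp]: "0 \<in> laurent_in W"
  by (simp add: laurent_in_def)
lemma laurent_in_const [simp]: "const c \<in> laurent_in W"
  by (simp add: laurent_in_def const_def)
lemma laurent_in_1 [simp]: "1 \<in> laurent_in W"
  by (simp add: laurent_in_def)
lemma laurent_in_var: "v \<in> W \<Longrightarrow> var v \<in> laurent_in W"
  by (auto simp: laurent_in_def var_def lookup_single when_def)
lemma laurent_in_zinv: "Inl i \<in> W \<Longrightarrow> zinv i \<in> laurent_in W"
  by (auto simp: laurent_in_def zinv_def lookup_single when_def)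
lemma laurent_in_add: "p \<in> laurent_in W \<Longrightarrow> q \<in> laurent_in W \<Longrightarrow> p + q \<in> laurent_in W"
  using keys_add[of p q] by (fastforce simp: laurent_in_def)
lemma laurent_in_uminus [simp]: "- p \<in> laurent_in W \<longleftrightarrow> p \<in> laurent_in W"
  by (auto simp: laurent_in_def in_keys_iff)
lemma laurent_in_diff: "p \<in> laurent_in W \<Longrightarrow> q \<in> laurent_in W \<Longrightarrow> p - q \<in> laurent_in W"
  using laurent_in_add[of p W "-q"] by simp
lemma laurent_in_mult:
  assumes "p \<in> laurent_in W" "q \<in> laurent_in W"
  shows "p * q \<in> laurent_in W"
  unfolding laurent_in_def
proof (intro CollectI ballI)
  fix mo assume "mo \<in> Poly_Mapping.keys (p * q)"
  then obtain a b where "mo = a + b" "a \<in> Poly_Mapping.keys p" "b \<in> Poly_Mapping.keys q"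
    using keys_mult[of p q] by blast
  then show "Poly_Mapping.keys mo \<subseteq> W \<and> (\<forall>x. Poly_Mapping.lookup mo (Inr x) \<ge> 0)"
    using keys_add[of a b] assms by (fastforce simp: laurent_in_def lookup_add)
qed
lemma laurent_in_sum: "(\<And>x. x \<in> A \<Longrightarrow> f x \<in> laurent_in W) \<Longrightarrow> (\<Sum>x\<in>A. f x) \<in> laurent_in W"
  by (induction A rule: infinite_finite_induct) (auto simp: laurent_in_add)
lemma laurent_in_prod: "(\<And>x. x \<in> A \<Longrightarrow> f x \<in> laurent_in W) \<Longrightarrow> (\<Prod>x\<in>A. f x) \<in> laurent_in W"
  by (induction A rule: infinite_finite_induct) (auto simp: laurent_in_mult)
lemma laurent_in_power: "p \<in> laurent_in W \<Longrightarrow> p ^ n \<in> laurent_in W"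
  by (induction n) (auto simp: laurent_in_mult)

lemma var_zinv [simp]: "var (Inl i) * zinv i = 1" "zinv i * var (Inl i) = 1"
  by (auto simp: var_def zinv_def mult_single single_add[symmetric])

lemma single_add_one: "Poly_Mapping.single (k + l) 1 = Poly_Mapping.single k 1 * Poly_Mapping.single l (1::'k::comm_ring_1)"
  by (simp add: mult_single)

lemma single_monomial_sum:
  "Poly_Mapping.single (\<Sum>x\<in>A. f x) 1 = (\<Prod>x\<in>A. Poly_Mapping.single (f x) (1::'k::comm_ring_1))"
  by (induction A rule: infinite_finite_induct) (auto simp: single_add_one)

lemma single_var_power:
  "Poly_Mapping.single (Poly_Mapping.single v (int k)) 1 = (var v ^ k :: ('v, int, 'k::comm_ring_1) mpoly)"
  by (induction k) (auto simp: var_def single_add single_add_one)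

lemma single_zinv_power:
  "Poly_Mapping.single (Poly_Mapping.single (Inl i) (- int k)) 1 = (zinv i ^ k :: (tvar, int, 'k::comm_ring_1) mpoly)"
proof (induction k)
  case (Suc k)
  have "Poly_Mapping.single (Inl i :: tvar) (- int (Suc k)) = Poly_Mapping.single (Inl i) (- 1) + Poly_Mapping.single (Inl i) (- int k)"
    by (simp add: single_add[symmetric])
  then show ?case using Suc by (simp add: zinv_def single_add_one)
qed auto

lemma laurent_in_induct [consumes 1, case_names const var zinv add mult]:
  fixes p :: "(tvar, int, 'k::comm_ring_1) mpoly"
  assumes p: "p \<in> laurent_in W"
    and const: "\<And>c. P (const c)" and var: "\<And>v. v \<in> W \<Longrightarrow> P (var v)"
    and zinv: "\<And>i. Inl i \<in> W \<Longrightarrow> P (zinv i)"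
    and add: "\<And>p q. P p \<Longrightarrow> P q \<Longrightarrow> P (p + q)"
    and mult: "\<And>p q. P p \<Longrightarrow> P q \<Longrightarrow> P (p * q)"
  shows "P p"
proof -
  have 1: "P 1" using const[of 1] by simp
  have pow: "P (x ^ k)" if "P x" for x k
    by (induction k) (use 1 that mult in auto)
  have v: "P (Poly_Mapping.single (Poly_Mapping.single v e) 1)" if "v \<in> W" "v \<in> range Inr \<longrightarrow> e \<ge> 0" for v e
  proof (cases "e \<ge> 0")
    case True
    then have "Poly_Mapping.single (Poly_Mapping.single v e) 1 = (var v ^ nat e :: (tvar, int, 'k) mpoly)"
      using single_var_power[of v "nat e"] by simp
    then show ?thesis using pow[OF var[OF that(1)], of "nat e"] by simp
  next
    case False
    with that(2) have "v \<in> range Inl" by (cases v) auto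
    then obtain i where "v = Inl i" by auto
    have "Poly_Mapping.single (Poly_Mapping.single v e) 1 = (zinv i ^ nat (-e) :: (tvar, int, 'k) mpoly)"
      using False single_zinv_power[of i "nat (-e)"] \<open>v = Inl i\<close> by simp
    then show ?thesis using \<open>v = Inl i\<close> pow[OF zinv, of i "nat (-e)"] that(1) by simp
  qed
  have s: "P (Poly_Mapping.single mo a)" if "Poly_Mapping.keys mo \<subseteq> W" "\<forall>x. Poly_Mapping.lookup mo (Inr x) \<ge> 0" for mo a
  proof -
    have "P (\<Prod>v\<in>A. Poly_Mapping.single (Poly_Mapping.single v (Poly_Mapping.lookup mo v)) 1)"
      if "finite A" "A \<subseteq> W" for A
      using that by induction (use 1 \<open>\<forall>x. Poly_Mapping.lookup mo (Inr x) \<ge> 0\<close> in \<open>auto intro!: mult v\<close>)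
    then have "P (Poly_Mapping.single mo 1)"
      by (subst poly_mapping_sum_single[of mo], subst single_monomial_sum) (use that(1) in auto)
    from mult[OF const[of a] this] show ?thesis by (simp add: const_def mult_single)
  qed
  have "P (\<Sum>mo\<in>A. Poly_Mapping.single mo (Poly_Mapping.lookup p mo))"
    if "finite A" "A \<subseteq> Poly_Mapping.keys p" for A
    using that
  proof (induction A)
    case empty
    then show ?case using const[of 0] by simp
  next
    case (insert mo A)
    then show ?case using p by (auto simp: laurent_in_def intro!: add s)
  qed
  from this[of "Poly_Mapping.keys p"] show ?thesis
    using poly_mapping_sum_single[of p] by simp
qed

lemma pdL_eq_0: "p \<in> laurent_in W \<Longrightarrow> v \<notin> W \<Longrightarrow> pdL v p = 0"
  unfolding pdL_def
proof (intro sum.neutral ballI)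
  fix mo assume "p \<in> laurent_in W" "v \<notin> W" "mo \<in> Poly_Mapping.keys p"
  then have "Poly_Mapping.lookup mo v = 0" by (auto simp: laurent_in_def not_in_keys_iff_lookup_eq_zero[symmetric])
  then show "Poly_Mapping.single (mo - Poly_Mapping.single v 1)
      (of_int (Poly_Mapping.lookup mo v) * Poly_Mapping.lookup p mo) = 0" by simp
qed

lemma pdL_uminus: "pdL v (- p) = - pdL v p"
  using pdL_add[of v p "-p"] by (simp add: eq_neg_iff_add_eq_0 add.commute)
lemma pdL_diff: "pdL v (p - q) = pdL v p - pdL v q"
  using pdL_add[of v p "-q"] by (simp add: pdL_uminus)

section \<open>Poisson brackets\<close>

locale poisson =
  fixes br :: "'a::comm_ring_1 \<Rightarrow> 'a \<Rightarrow> 'a"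
  assumes br_add1: "br (x + y) u = br x u + br y u"
    and br_mult1: "br (x * y) u = br x u * y + x * br y u"
    and br_anti: "br x y = - br y x"
begin

lemma br_add2: "br u (x + y) = br u x + br u y"
  using br_add1[of x y u] br_anti[of u x] br_anti[of u y] br_anti[of u "x + y"] by simp
lemma br_mult2: "br u (x * y) = br u x * y + x * br u y"
  using br_mult1[of x y u] br_anti[of u x] br_anti[of u y] br_anti[of u "x * y"] by simp
lemma br_0 [simp]: "br 0 u = 0" "br u 0 = 0"
  using br_add1[of 0 0 u] br_add2[of u 0 0] by auto
lemma br_1 [simp]: "br 1 u = 0" "br u 1 = 0"
  using br_mult1[of 1 1 u] br_mult2[of u 1 1] by auto
lemma br_minus1: "br (- x) u = - br x u"
  using br_add1[of x "-x" u] by (simp add: eq_neg_iff_add_eq_0 add.commute)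
lemma br_minus2: "br u (- x) = - br u x"
  using br_add2[of u x "-x"] by (simp add: eq_neg_iff_add_eq_0 add.commute)
lemma br_diff1: "br (x - y) u = br x u - br y u"
  using br_add1[of x "-y" u] by (simp add: br_minus1)
lemma br_diff2: "br u (x - y) = br u x - br u y"
  using br_add2[of u x "-y"] by (simp add: br_minus2)
lemma br_sum1: "br (\<Sum>x\<in>A. f x) u = (\<Sum>x\<in>A. br (f x) u)"
  by (induction A rule: infinite_finite_induct) (auto simp: br_add1)
lemma br_sum2: "br u (\<Sum>x\<in>A. f x) = (\<Sum>x\<in>A. br u (f x))"
  by (induction A rule: infinite_finite_induct) (auto simp: br_add2)

lemma br_unit:
  assumes "w * v = 1" "br w u = 0" shows "br v u = 0"
proof -
  have "w * br v u = 0" using br_mult1[of w v u] assms by simp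
  then have "v * w * br v u = 0" by (simp add: mult.assoc)
  then show ?thesis using assms(1) by (simp add: mult.commute)
qed

end

text \<open>The chain rule in each argument expands both sides into the same double sum, so
  compatibility with brackets need only be known on generators.\<close>

lemma (in poisson) evalm_pbr:
  assumes "scalar_hom c" "\<And>a u. br (c a) u = 0" "finite (A_set n - M)"
    and f: "f \<in> KL n M" and g: "g \<in> KL n M"
    and gen: "\<And>\<xi> \<eta>. \<xi> \<in> A_set n - M \<Longrightarrow> \<eta> \<in> A_set n - M \<Longrightarrow> br (Y \<xi>) (Y \<eta>) = evalm c Y (lie_br M \<xi> \<eta>)"
  shows "evalm c Y (pbr n M f g) = br (evalm c Y f) (evalm c Y g)"
proof -
  interpret scalar_hom c by fact
  have c2: "br u (c a) = 0" for u a using br_anti[of u "c a"] assms(2) by simp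
  have "br (evalm c Y f) (evalm c Y g) = (\<Sum>\<xi>\<in>A_set n - M. evalm c Y (pd \<xi> f) * br (Y \<xi>) (evalm c Y g))"
    using f by (intro chain_rule[where D = "\<lambda>x. br x (evalm c Y g)"]) (auto simp: br_add1 br_mult1 assms KL_def)
  also have "\<dots> = (\<Sum>\<xi>\<in>A_set n - M. evalm c Y (pd \<xi> f) * (\<Sum>\<eta>\<in>A_set n - M. evalm c Y (pd \<eta> g) * br (Y \<xi>) (Y \<eta>)))"
    using g by (intro sum.cong refl arg_cong2[where f = "(*)"] chain_rule) (auto simp: br_add2 br_mult2 assms c2 KL_def)
  also have "\<dots> = evalm c Y (pbr n M f g)"
    by (simp add: pbr_def evalm_sum evalm_mult sum_distrib_left gen mult.assoc)
  finally show ?thesis by simp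
qed

interpretation target: poisson "target_br m"
proof
  fix x y u :: "(tvar, int, 'k::comm_ring_1) mpoly"
  show "target_br m (x + y) u = target_br m x u + target_br m y u"
    unfolding target_br_def sum.distrib[symmetric] by (intro sum.cong) (auto simp: pdL_add algebra_simps)
  show "target_br m (x * y) u = target_br m x u * y + x * target_br m y u"
    unfolding target_br_def sum_distrib_left sum_distrib_right sum.distrib[symmetric]
    by (intro sum.cong) (auto simp: pdL_mult algebra_simps)
  show "target_br m x y = - target_br m y x"
    unfolding target_br_def sum_negf[symmetric] by (intro sum.cong) (auto simp: algebra_simps)
qed

lemma target_br_eq_0:
  assumes "p \<in> laurent_in V" "q \<in> laurent_in W"
    and "\<And>j. Inr (Inl j) \<in> V \<Longrightarrow> Inr (Inr j) \<notin> W" "\<And>j. Inr (Inr j) \<in> V \<Longrightarrow> Inr (Inl j) \<notin> W"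
  shows "target_br m p q = 0"
  unfolding target_br_def
proof (intro sum.neutral ballI)
  fix j
  have "pdL (Inr (Inl j)) p = 0 \<or> pdL (Inr (Inr j)) q = 0" "pdL (Inr (Inr j)) p = 0 \<or> pdL (Inr (Inl j)) q = 0"
    using assms pdL_eq_0 by blast+
  then show "pdL (Inr (Inl j)) p * pdL (Inr (Inr j)) q - pdL (Inr (Inr j)) p * pdL (Inr (Inl j)) q = 0"
    by auto
qed

lemma target_br_canonical:
  "target_br m (var (Inr (Inl i))) (var (Inr (Inr j))) = (if i = j \<and> i < m then 1 else 0)"
proof -
  have "target_br m (var (Inr (Inl i))) (var (Inr (Inr j))) = (\<Sum>l<m. if l = i then if i = j then 1 else 0 else 0)"
    unfolding target_br_def by (intro sum.cong) (auto simp: pdL_var)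
  also have "\<dots> = (if i = j \<and> i < m then 1 else 0)" by (simp add: sum.delta)
  finally show ?thesis .
qed

section \<open>Unfilled places\<close>

text \<open>Up to \<open>M\<close>, the unfilled places behave like the inversion set of a permutation: they are closed
  and their complement is closed. This survives every step of the diagram.\<close>

definition closed_places :: "nat \<Rightarrow> (nat \<times> nat) set \<Rightarrow> (nat \<times> nat) set \<Rightarrow> bool" where
  "closed_places n M U \<longleftrightarrow> U \<subseteq> A_set n - M \<and>
     (\<forall>a b c. (a, b) \<in> U \<longrightarrow> (b, c) \<in> U \<longrightarrow> (a, c) \<in> U \<union> M) \<and>
     (\<forall>a b c. (a, c) \<in> U \<longrightarrow> c < b \<longrightarrow> b < a \<longrightarrow> (a, b) \<in> U \<or> (b, c) \<in> U) \<and>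
     (\<forall>a b c. (a, c) \<in> M \<longrightarrow> (b, c) \<in> U \<longrightarrow> b < a \<longrightarrow> (a, b) \<in> U \<union> M)"

text \<open>What a step with pivot \<open>\<kappa>\<close> leaves unfilled. A place of the pivot row
  or column disappears only together with its partner; lone ones stay.\<close>

definition peel :: "nat \<times> nat \<Rightarrow> (nat \<times> nat) set \<Rightarrow> (nat \<times> nat) set" where
  "peel \<kappa> U = {(a, b) \<in> U. (a, b) \<noteq> \<kappa> \<and> \<not> (a = fst \<kappa> \<and> (b, snd \<kappa>) \<in> U) \<and> \<not> (b = snd \<kappa> \<and> (fst \<kappa>, a) \<in> U)}"

locale places_step =
  fixes n :: nat and M U :: "(nat \<times> nat) set" and k t :: nat
  assumes ideal: "is_ideal_set n M"
    and closed: "closed_places n M U"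
    and kt: "(k, t) \<in> U"
    and greatest: "\<And>\<eta>. \<eta> \<in> U \<Longrightarrow> \<eta> \<noteq> (k, t) \<Longrightarrow> succA (k, t) \<eta>"
begin

definition U' :: "(nat \<times> nat) set" where "U' = peel (k, t) U"

lemma U'_iff: "(a, b) \<in> U' \<longleftrightarrow>
    (a, b) \<in> U \<and> (a, b) \<noteq> (k, t) \<and> \<not> (a = k \<and> (b, t) \<in> U) \<and> \<not> (b = t \<and> (k, a) \<in> U)"
  by (auto simp: U'_def peel_def)

lemma U'_subset: "U' \<subseteq> U" by (auto simp: U'_iff)

lemma U_A: "(a, b) \<in> U \<Longrightarrow> (a, b) \<in> A_set n"
  and U_M: "(a, b) \<in> U \<Longrightarrow> (a, b) \<notin> M"
  using closed by (auto simp: closed_places_def)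

lemma U_less: "(a, b) \<in> U \<Longrightarrow> b < a"
  using U_A by (auto simp: A_set_def)

lemma U_le: "(a, b) \<in> U \<Longrightarrow> t \<le> b" "(a, t) \<in> U \<Longrightarrow> a \<le> k"
  using greatest[of "(a, b)"] greatest[of "(a, t)"] by (force simp: succA_def)+

lemma tk: "t < k" using kt U_less by auto

lemma U_trans: "(a, b) \<in> U \<Longrightarrow> (b, c) \<in> U \<Longrightarrow> (a, c) \<in> U \<or> (a, c) \<in> M"
  and U_split: "(a, c) \<in> U \<Longrightarrow> c < b \<Longrightarrow> b < a \<Longrightarrow> (a, b) \<in> U \<or> (b, c) \<in> U"
  and U_split_M: "(a, c) \<in> M \<Longrightarrow> (b, c) \<in> U \<Longrightarrow> b < a \<Longrightarrow> (a, b) \<in> U \<or> (a, b) \<in> M"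
  using closed unfolding closed_places_def by blast+

lemma M_left: "(a, b) \<in> M \<Longrightarrow> (b, c) \<in> A_set n \<Longrightarrow> (a, c) \<in> M"
  and M_right: "(b, c) \<in> M \<Longrightarrow> (a, b) \<in> A_set n \<Longrightarrow> (a, c) \<in> M"
  using ideal unfolding is_ideal_set_def by blast+

text \<open>Multiplying by one matrix unit on the right lowers the column index, by one on the left
  raises the row index; an ideal is thus closed towards the lower left corner.\<close>

lemma M_mono: "(a, b) \<in> M \<Longrightarrow> b < a \<Longrightarrow> a \<le> a' \<Longrightarrow> b' \<le> b \<Longrightarrow> (a', b') \<in> A_set n \<Longrightarrow> (a', b') \<in> M"
proof -
  assume *: "(a, b) \<in> M" "b < a" "a \<le> a'" "b' \<le> b" "(a', b') \<in> A_set n"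
  have "(a, b') \<in> M" using * M_left[of a b b'] by (cases "b' = b") (auto simp: A_set_def)
  then show ?thesis using * M_right[of a b' a'] by (cases "a' = a") (auto simp: A_set_def)
qed

text \<open>Turns "in \<open>U\<close> or in \<open>M\<close>" into "in \<open>U\<close>": applied
  to the pivot it keeps all rows up to \<open>k\<close> and columns from \<open>t\<close> on out of
  \<open>M\<close>.\<close>

lemma U_mono: "(a', b') \<in> U \<Longrightarrow> (a, b) \<in> M \<Longrightarrow> b < a \<Longrightarrow> a \<le> a' \<Longrightarrow> b' \<le> b \<Longrightarrow> False"
  using M_mono U_A U_M by blast

text \<open>A place that is in \<open>U\<close> but no longer in \<open>U'\<close> is the pivot or
  half of a complete pair. Transporting its partner through the closure conditions of
  \<open>U\<close> shows that one of the given places was half of a complete pair as well, a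
  contradiction.\<close>

lemma peel_closed: "closed_places n M U'"
proof -
  have "(a, c) \<in> U' \<union> M" if ab: "(a, b) \<in> U'" and bc: "(b, c) \<in> U'" for a b c
  proof (rule ccontr)
    assume nn: "(a, c) \<notin> U' \<union> M"
    have U: "(a, b) \<in> U" "(b, c) \<in> U" using ab bc U'_subset by auto
    have ac: "(a, c) \<in> U" using U_trans[OF U] nn by auto
    consider "(a, c) = (k, t)" | "a = k" "(c, t) \<in> U" | "c = t" "(k, a) \<in> U"
      using nn ac by (auto simp: U'_iff)
    then show False
    proof cases
      case 1
      then show False using ab U by (auto simp: U'_iff)
    next
      case 2
      have "(b, t) \<in> U" using U_trans[OF U(2) 2(2)] U_mono[OF kt, of b t] U_less[OF U(1)] U_less[OF U(2)] 2 U_le(1)[OF U(2)] by auto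
      then show False using ab 2 by (auto simp: U'_iff)
    next
      case 3
      have "(k, b) \<in> U" using U_trans[OF 3(2) U(1)] U_mono[OF kt, of k b] U_less[OF U(1)] U_less[OF 3(2)] 3 U_less[OF U(2)] by auto
      then show False using bc 3 by (auto simp: U'_iff)
    qed
  qed
  moreover have "(a, b) \<in> U' \<or> (b, c) \<in> U'" if ac: "(a, c) \<in> U'" and lt: "c < b" "b < a" for a b c
  proof (rule ccontr)
    assume nn: "\<not> ((a, b) \<in> U' \<or> (b, c) \<in> U')"
    have U: "(a, c) \<in> U" using ac U'_subset by auto
    have tc: "t \<le> c" using U_le(1)[OF U] .
    consider "(a, b) \<in> U" | "(b, c) \<in> U" "(a, b) \<notin> U" using U_split[OF U lt] by auto
    then show False
    proof cases
      case 1
      then have ak: "a = k" "(b, t) \<in> U" using nn lt tc by (auto simp: U'_iff)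
      then have ct: "c \<noteq> t" "(c, t) \<notin> U" using ac by (auto simp: U'_iff)
      then have "(b, c) \<in> U" using U_split[OF ak(2), of c] lt tc by auto
      then show False using nn ct lt ak by (auto simp: U'_iff)
    next
      case 2
      then consider "(b, c) = (k, t)" | "b = k" "(c, t) \<in> U" | "c = t" "(k, b) \<in> U"
        using nn by (auto simp: U'_iff)
      then show False
      proof cases
        case 1
        then show False using U_le(2)[of a] U lt by auto
      next
        case b: 2
        have ct: "t < c" using U_less b(2) by auto
        \<comment> \<open>Row \<open>a\<close> lies below the pivot and column \<open>t\<close> has
          no unfilled place there, so the product can only fall into \<open>M\<close>. The third
          closure condition then forces \<open>(a, k)\<close> into \<open>U\<close>.\<close>
        have "(a, t) \<in> M" using U_trans[OF U b(2)] U_le(2)[of a] lt b by auto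
        then have "(a, k) \<in> U" using U_split_M[of a t k] kt lt b U_mono[OF U, of a k] by auto
        then show False using 2 b by auto
      next
        case c: 3
        have "(a, t) \<in> U" using U c by auto
        then have "a \<le> k" using U_le(2) by auto
        moreover have "a \<noteq> k" using ac c by (auto simp: U'_iff)
        ultimately have "(k, a) \<in> U \<or> (a, b) \<in> U" using U_split[OF c(2), of a] lt by auto
        then show False using 2 ac c by (auto simp: U'_iff)
      qed
    qed
  qed
  moreover have "(a, b) \<in> U' \<union> M" if ac: "(a, c) \<in> M" and bc: "(b, c) \<in> U'" and lt: "b < a" for a b c
  proof (rule ccontr)
    assume nn: "(a, b) \<notin> U' \<union> M"
    have U: "(b, c) \<in> U" using bc U'_subset by auto
    then have "(a, b) \<in> U" "t \<le> c" "c < b" using U_split_M[OF ac U lt] nn U_le U_less by auto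
    then have "a = k" "(b, t) \<in> U" using nn by (auto simp: U'_iff)
    then show False using U_mono[OF kt ac] \<open>c < b\<close> lt \<open>t \<le> c\<close> by auto
  qed
  ultimately show ?thesis
    unfolding closed_places_def using closed U'_subset unfolding closed_places_def by blast
qed

text \<open>The result lies in the rectangle spanned by the pivot, which avoids \<open>M\<close>, so
  closure under products holds there without the alternative \<open>M\<close>.\<close>

lemma trans_col: "(a, b) \<in> U \<Longrightarrow> (b, t) \<in> U \<Longrightarrow> a < k \<Longrightarrow> (a, t) \<in> U"
  using U_trans[of a b t] U_mono[OF kt, of a t] U_less[of a b] U_less[of b t] by auto

lemma trans_row: "(k, a) \<in> U \<Longrightarrow> (a, b) \<in> U \<Longrightarrow> t \<le> b \<Longrightarrow> (k, b) \<in> U"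
  using U_trans[of k a b] U_mono[OF kt, of k b] U_less[of k a] U_less[of a b] by auto

lemma trans_below: "(i, j) \<in> U \<Longrightarrow> (j, l) \<in> U \<Longrightarrow> i \<le> k \<Longrightarrow> (k, l) \<in> U \<Longrightarrow> (i, l) \<in> U"
  using U_trans[of i j l] U_mono[of k l i l] U_less[of i j] U_less[of j l] by auto

text \<open>Row \<open>k\<close> is the last unfilled one in column \<open>t\<close>, and
  \<open>(i, t)\<close> is the product of \<open>(i, k)\<close> with the pivot. This makes the third
  closure condition available for rows below the pivot, as used in \<open>split_below\<close> and
  \<open>split_through\<close>.\<close>

lemma pivot_col_M: "(i, k) \<in> U \<Longrightarrow> (i, t) \<in> M"
  using U_trans[OF _ kt] U_le(2)[of i] U_less[of i k] by force

lemma split_below: "(i, k) \<in> U \<Longrightarrow> (j, t) \<in> U \<Longrightarrow> (i, l) \<in> U \<Longrightarrow> l < j \<Longrightarrow> j < i \<Longrightarrow> (i, j) \<in> U"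
  using U_split_M[OF pivot_col_M, of i j] U_mono[of i l i j] by auto

lemma split_through: "(i', i) \<in> U \<Longrightarrow> (i, k) \<in> U \<Longrightarrow> (a, t) \<in> U \<Longrightarrow> (i', a) \<in> U \<Longrightarrow> a < i \<Longrightarrow> (i, a) \<in> U"
  using U_split_M[OF pivot_col_M, of i a] U_mono[of i' a i a] U_less[of i' i] by auto

lemma trans_pivot: "(i', i) \<in> U \<Longrightarrow> (i, k) \<in> U \<Longrightarrow> (i', a) \<in> U \<Longrightarrow> a < k \<Longrightarrow> (i', k) \<in> U"
  using U_trans[of i' i k] U_mono[of i' a i' k] U_less[of i' i] U_less[of i k] by auto

end

section \<open>One elimination step and its effect on brackets\<close>

definition lin_br :: "(nat \<times> nat) set \<Rightarrow> (nat \<times> nat \<Rightarrow> 'a::comm_ring_1) \<Rightarrow> nat \<times> nat \<Rightarrow> nat \<times> nat \<Rightarrow> 'a" where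
  "lin_br U X \<xi> \<eta> = (if \<xi> \<in> U \<and> \<eta> \<in> U then
     (if snd \<xi> = fst \<eta> then X (fst \<xi>, snd \<eta>) else 0) - (if snd \<eta> = fst \<xi> then X (fst \<eta>, snd \<xi>) else 0) else 0)"

text \<open>\<open>step_Y\<close> undoes the conjugation \<open>g\<inverse> Y g\<close> that clears column \<open>t\<close>, where \<open>g\<close> is the identity except for
  column \<open>k\<close>, which is column \<open>t\<close> of \<open>Y\<close> divided by \<open>w = y\<^bsub>kt\<^esub>\<close>. The entries of row \<open>k\<close> and column \<open>t\<close> are \<open>step_r\<close>
  and \<open>step_c\<close>; the argument \<open>v\<close> stands for the inverse of \<open>w\<close>.\<close>

definition step_r :: "(nat \<times> nat) set \<Rightarrow> nat \<Rightarrow> nat \<Rightarrow> (nat \<times> nat \<Rightarrow> 'a::comm_ring_1) \<Rightarrow> 'a \<Rightarrow> (nat \<Rightarrow> 'a) \<Rightarrow> nat \<Rightarrow> 'a" where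
  "step_r U k t X w p b = (if (k, b) \<in> U \<and> (b, t) \<in> U then w * p b else X (k, b))"

definition step_c :: "(nat \<times> nat) set \<Rightarrow> nat \<Rightarrow> nat \<Rightarrow> (nat \<times> nat \<Rightarrow> 'a::comm_ring_1) \<Rightarrow> (nat \<Rightarrow> 'a) \<Rightarrow> nat \<Rightarrow> 'a" where
  "step_c U k t X q a = (if (k, a) \<in> U \<and> (a, t) \<in> U then q a else X (a, t))"

definition step_Y :: "(nat \<times> nat) set \<Rightarrow> nat \<Rightarrow> nat \<Rightarrow> (nat \<times> nat \<Rightarrow> 'a::comm_ring_1) \<Rightarrow> 'a \<Rightarrow> 'a \<Rightarrow> (nat \<Rightarrow> 'a) \<Rightarrow> (nat \<Rightarrow> 'a)
    \<Rightarrow> nat \<times> nat \<Rightarrow> 'a" where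
  "step_Y U k t X w v p q = (\<lambda>(a, b). if (a, b) \<notin> U then 0 else if (a, b) = (k, t) then w
     else if a = k then step_r U k t X w p b else if b = t then step_c U k t X q a
     else if a < k then X (a, b) + v * (step_r U k t X w p b * step_c U k t X q a)
     else if b = k then X (a, b) - v * (\<Sum>x\<in>{t<..<k}. X (a, x) * step_c U k t X q x)
     else X (a, b))"

text \<open>An abstract target for one step: a central unit \<open>w\<close>, canonical pairs
  \<open>p\<close>, \<open>q\<close>, and generators \<open>X\<close> for the remaining places that
  commute with them. Since \<open>X\<close> vanishes off \<open>U'\<close>, products falling into
  \<open>M\<close> contribute 0 in \<open>lin_br\<close>. The relations between \<open>p\<close> and
  \<open>q\<close> are demanded for complete pairs only, because elsewhere the enumeration that
  later indexes them is arbitrary.\<close>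

locale bracket_step = places_step n M U k t + poisson br
  for n M U k t and br :: "'a::comm_ring_1 \<Rightarrow> 'a \<Rightarrow> 'a" +
  fixes X :: "nat \<times> nat \<Rightarrow> 'a" and w v :: 'a and p q :: "nat \<Rightarrow> 'a"
  assumes X0: "\<And>\<xi>. \<xi> \<notin> U' \<Longrightarrow> X \<xi> = 0"
    and brX: "\<And>\<xi> \<eta>. br (X \<xi>) (X \<eta>) = lin_br U' X \<xi> \<eta>"
    and wv: "w * v = 1" and br_w: "\<And>u. br w u = 0"
    and br_pp: "\<And>a b. br (p a) (p b) = 0" and br_qq: "\<And>a b. br (q a) (q b) = 0"
    and br_pq: "\<And>a b. (k, a) \<in> U \<Longrightarrow> (a, t) \<in> U \<Longrightarrow> (k, b) \<in> U \<Longrightarrow> (b, t) \<in> U \<Longrightarrow> br (p a) (q b) = (if a = b then 1 else 0)"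
    and br_pX: "\<And>a \<xi>. (k, a) \<in> U \<Longrightarrow> (a, t) \<in> U \<Longrightarrow> br (p a) (X \<xi>) = 0"
    and br_qX: "\<And>a \<xi>. (k, a) \<in> U \<Longrightarrow> (a, t) \<in> U \<Longrightarrow> br (q a) (X \<xi>) = 0"
begin

abbreviation r :: "nat \<Rightarrow> 'a" where "r \<equiv> step_r U k t X w p"
abbreviation c :: "nat \<Rightarrow> 'a" where "c \<equiv> step_c U k t X q"
abbreviation Y :: "nat \<times> nat \<Rightarrow> 'a" where "Y \<equiv> step_Y U k t X w v p q"

lemmas r_def = step_r_def[of U k t X w p]
lemmas c_def = step_c_def[of U k t X q]
lemmas Y_def = step_Y_def[of U k t X w v p q]

lemma br_w2 [simp]: "br w u = 0" "br u w = 0"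
  using br_w br_anti[of u w] by auto
lemma br_v [simp]: "br v u = 0" "br u v = 0"
  using br_unit[OF wv br_w] br_anti[of u v] by auto

lemmas br_simps = br_add1 br_add2 br_mult1 br_mult2 br_diff1 br_diff2 br_sum1 br_sum2

lemma vw: "v * w = 1" "v * (w * x) = x" "w * (v * x) = x" "v * (x * w) = x"
  using wv by (simp_all add: ac_simps) (simp_all add: mult.assoc[symmetric])

lemma br_Xp: "(k, a) \<in> U \<Longrightarrow> (a, t) \<in> U \<Longrightarrow> br (X \<xi>) (p a) = 0"
  using br_pX[of a \<xi>] br_anti[of "X \<xi>" "p a"] by simp
lemma br_Xq: "(k, a) \<in> U \<Longrightarrow> (a, t) \<in> U \<Longrightarrow> br (X \<xi>) (q a) = 0"
  using br_qX[of a \<xi>] br_anti[of "X \<xi>" "q a"] by simp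

lemma U'_less: "(a, b) \<in> U' \<Longrightarrow> b < a"
  using U'_subset U_less by auto

lemma br_r_r: "br (r a) (r b) = 0"
proof -
  have "br (X (k, a)) (X (k, b)) = 0"
    using U'_less[of k k] by (auto simp: brX lin_br_def)
  then show ?thesis by (auto simp: r_def br_mult1 br_mult2 br_pp br_pX br_Xp)
qed

lemma br_c_c: "br (c a) (c b) = 0"
proof -
  have "br (X (a, t)) (X (b, t)) = 0"
    using U'_less[of t t] by (auto simp: brX lin_br_def)
  then show ?thesis by (auto simp: c_def br_qq br_qX br_Xq)
qed

text \<open>The factor \<open>w\<close> in \<open>step_r\<close> turns the canonical relation into
  \<open>[y_ka, y_at] = y_kt\<close>. Two surviving entries never meet, because
  \<open>(k, a)\<close> and \<open>(a, t)\<close> both unfilled would be a complete pair.\<close>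

lemma br_r_c: "br (r a) (c b) = (if a = b \<and> (k, a) \<in> U \<and> (a, t) \<in> U then w else 0)"
proof -
  have "br (X (k, a)) (X (b, t)) = 0"
    using tk by (auto simp: brX lin_br_def U'_iff)
  then show ?thesis by (auto simp: r_def c_def br_mult1 br_pq br_pX br_Xq)
qed

lemma br_c_r: "br (c b) (r a) = (if a = b \<and> (k, a) \<in> U \<and> (a, t) \<in> U then - w else 0)"
  using br_r_c[of a b] br_anti[of "c b" "r a"] by auto

text \<open>A paired entry \<open>r l\<close> is \<open>w * p l\<close> and commutes with
  \<open>X\<close>; the right side agrees because \<open>(k, l)\<close> has then left
  \<open>U'\<close>.\<close>

lemma br_X_r: "br (X (a, b)) (r l) = (if b = k \<and> (a, b) \<in> U' \<and> (k, l) \<in> U' then X (a, l) else 0)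
    - (if l = a \<and> (a, b) \<in> U' \<and> (k, l) \<in> U' then X (k, b) else 0)"
proof (cases "(k, l) \<in> U \<and> (l, t) \<in> U")
  case True
  then have "(k, l) \<notin> U'" by (simp add: U'_iff)
  then show ?thesis using True by (simp add: r_def br_mult2 br_Xp)
next
  case False
  then show ?thesis by (auto simp: r_def brX lin_br_def)
qed

lemma br_X_c: "br (X (a, b)) (c l) = (if b = l \<and> (a, b) \<in> U' \<and> (l, t) \<in> U' then X (a, t) else 0)"
proof (cases "(k, l) \<in> U \<and> (l, t) \<in> U")
  case True
  then have "(l, t) \<notin> U'" by (simp add: U'_iff)
  then show ?thesis using True by (simp add: c_def br_Xq)
next
  case False
  have "\<not> ((t, b) \<in> U')" using U'_less[of t b] U_le(1)[of t b] U'_subset by auto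
  then show ?thesis using False by (auto simp: c_def brX lin_br_def)
qed

lemma br_r_X: "br (r l) (X (a, b)) = (if l = a \<and> (a, b) \<in> U' \<and> (k, l) \<in> U' then X (k, b) else 0)
    - (if b = k \<and> (a, b) \<in> U' \<and> (k, l) \<in> U' then X (a, l) else 0)"
  unfolding br_anti[of "r l"] br_X_r by simp

lemma br_c_X: "br (c l) (X (a, b)) = - (if b = l \<and> (a, b) \<in> U' \<and> (l, t) \<in> U' then X (a, t) else 0)"
  unfolding br_anti[of "c l"] br_X_c by simp

lemma r_0: "(k, b) \<notin> U \<Longrightarrow> r b = 0"
  unfolding r_def using X0 U'_subset by auto
lemma c_0: "(a, t) \<notin> U \<Longrightarrow> c a = 0"
  unfolding c_def using X0 U'_subset by auto
lemma r_unpaired: "(b, t) \<notin> U \<Longrightarrow> r b = X (k, b)"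
  by (simp add: r_def)
lemma c_unpaired: "(k, a) \<notin> U \<Longrightarrow> c a = X (a, t)"
  by (simp add: c_def)
lemma X_0: "(a, b) \<notin> U \<Longrightarrow> X (a, b) = 0"
  using X0 U'_subset by auto

lemma Y_0: "\<xi> \<notin> U \<Longrightarrow> Y \<xi> = 0" by (cases \<xi>) (auto simp: Y_def)
lemma Y_kt: "Y (k, t) = w" using kt by (simp add: Y_def)
lemma Y_r: "b \<noteq> t \<Longrightarrow> Y (k, b) = r b" using r_0[of b] by (auto simp: Y_def)
lemma Y_c: "a \<noteq> k \<Longrightarrow> Y (a, t) = c a" using c_0[of a] by (auto simp: Y_def)
lemma Y_inner: "(a, b) \<in> U \<Longrightarrow> a < k \<Longrightarrow> b \<noteq> t \<Longrightarrow> Y (a, b) = X (a, b) + v * (r b * c a)"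
  by (auto simp: Y_def)
lemma Y_low: "k < a \<Longrightarrow> b \<noteq> k \<Longrightarrow> Y (a, b) = X (a, b)"
  using X_0[of a b] U_le(2)[of a] by (auto simp: Y_def c_def)
lemma Y_pivot: "(a, k) \<in> U \<Longrightarrow> Y (a, k) = X (a, k) - v * (\<Sum>x\<in>{t<..<k}. X (a, x) * c x)"
  using tk U_less[of a k] by (auto simp: Y_def)

lemma U'_inner: "a \<noteq> k \<Longrightarrow> b \<noteq> t \<Longrightarrow> (a, b) \<in> U' \<longleftrightarrow> (a, b) \<in> U"
  by (auto simp: U'_iff)

section \<open>Brackets by position relative to the pivot: row \<open>k\<close>, column
  \<open>t\<close>, rows above \<open>k\<close> (inner), rows below \<open>k\<close> (low), column
  \<open>k\<close> below the pivot\<close>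

lemma brY_row_row: "b \<noteq> t \<Longrightarrow> d \<noteq> t \<Longrightarrow> br (Y (k, b)) (Y (k, d)) = lin_br U Y (k, b) (k, d)"
  using U_less by (force simp: Y_r br_r_r lin_br_def)

lemma brY_col_col: "a \<noteq> k \<Longrightarrow> e \<noteq> k \<Longrightarrow> br (Y (a, t)) (Y (e, t)) = lin_br U Y (a, t) (e, t)"
  using U_less by (force simp: Y_c br_c_c lin_br_def)

lemma brY_row_col: "b \<noteq> t \<Longrightarrow> e \<noteq> k \<Longrightarrow> br (Y (k, b)) (Y (e, t)) = lin_br U Y (k, b) (e, t)"
  using tk by (auto simp: Y_c Y_r Y_kt br_r_c lin_br_def)

text \<open>For \<open>d = a\<close> one of two mechanisms yields \<open>- Y (k, b)\<close>. If
  \<open>(a, t)\<close> is unfilled, the correction \<open>v * (r b * c a)\<close> meets its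
  canonical partner \<open>r a\<close> and \<open>v * w\<close> cancels. If not, \<open>c a\<close>
  vanishes, and the \<open>X\<close> part gives \<open>- X (k, b)\<close>, which is
  \<open>- r b\<close> because \<open>b\<close> is then unpaired too.\<close>

lemma brY_inner_row:
  assumes "(a, b) \<in> U" "a < k" "b \<noteq> t" "d \<noteq> t" "(k, d) \<in> U"
  shows "br (Y (a, b)) (Y (k, d)) = lin_br U Y (a, b) (k, d)"
proof -
  have "b < a" "t < b" using U_less assms U_le(1)[of a b] by auto
  have "br (Y (a, b)) (Y (k, d)) = (if d = a then - Y (k, b) else 0)"
  proof (cases "d = a")
    case True
    have "(k, b) \<in> U" using trans_row[of a b] assms U_le(1)[of a b] True by auto
    show ?thesis
    proof (cases "(a, t) \<in> U")
      case True
      then show ?thesis using assms \<open>d = a\<close> \<open>b < a\<close>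
        by (simp add: Y_inner Y_r br_simps br_X_r br_r_r br_c_r U'_iff vw)
    next
      case False
      then have "(b, t) \<notin> U" using trans_col assms by blast
      then have "X (k, b) = r b" by (simp add: r_unpaired)
      then show ?thesis using assms \<open>d = a\<close> \<open>b < a\<close> False \<open>(k, b) \<in> U\<close> \<open>(b, t) \<notin> U\<close>
        by (simp add: Y_inner Y_r br_add1 br_mult1 br_X_r br_r_r br_c_r U'_iff)
    qed
  qed (use assms \<open>b < a\<close> in \<open>simp add: Y_inner Y_r br_simps br_X_r br_r_r br_c_r\<close>)
  then show ?thesis using assms \<open>b < a\<close> by (auto simp: lin_br_def)
qed

lemma brY_inner_col:
  assumes "(a, b) \<in> U" "a < k" "b \<noteq> t" "e \<noteq> k" "(e, t) \<in> U"
  shows "br (Y (a, b)) (Y (e, t)) = lin_br U Y (a, b) (e, t)"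
proof -
  have "b < a" "t < b" using U_less assms U_le(1)[of a b] by auto
  have "br (Y (a, b)) (Y (e, t)) = (if b = e then Y (a, t) else 0)"
  proof (cases "b = e")
    case True
    have "(a, t) \<in> U" using trans_col[of a b] assms True by auto
    show ?thesis
    proof (cases "(k, b) \<in> U")
      case True
      then show ?thesis using assms \<open>b = e\<close> \<open>b < a\<close>
        by (simp add: Y_inner Y_c br_simps br_X_c br_r_c br_c_c U'_iff vw)
    next
      case False
      then have "(k, a) \<notin> U" using trans_row[of a b] assms \<open>t < b\<close> by auto
      then have "X (a, t) = c a" by (simp add: c_unpaired)
      then show ?thesis using assms \<open>b = e\<close> \<open>b < a\<close> False \<open>(a, t) \<in> U\<close> \<open>(k, a) \<notin> U\<close>
        by (simp add: Y_inner Y_c br_add1 br_mult1 br_X_c br_r_c br_c_c U'_iff)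
    qed
  qed (use assms \<open>b < a\<close> in \<open>simp add: Y_inner Y_c br_simps br_X_c br_r_c br_c_c\<close>)
  then show ?thesis using assms \<open>b < a\<close> \<open>t < b\<close> by (auto simp: lin_br_def)
qed

text \<open>For \<open>b = e\<close> the missing summand \<open>v * (r d * c a)\<close> of
  \<open>Y (a, d)\<close> arises once: from \<open>X (a, b)\<close> acting on \<open>c b\<close>,
  from \<open>X (b, d)\<close> acting on \<open>r b\<close>, or from the canonical pair
  \<open>r b\<close>, \<open>c b\<close>, according to which of \<open>(k, b)\<close>,
  \<open>(b, t)\<close> are unfilled. The assumption \<open>d \<noteq> a\<close> removes the
  opposite product.\<close>

lemma brY_inner_inner:
  assumes "(a, b) \<in> U" "a < k" "b \<noteq> t" "(e, d) \<in> U" "e < k" "d \<noteq> t" "d \<noteq> a"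
  shows "br (Y (a, b)) (Y (e, d)) = lin_br U Y (a, b) (e, d)"
proof -
  have lt: "b < a" "t < b" "d < e" "t < d" using U_less assms U_le(1)[of a b] U_le(1)[of e d] by auto
  have "br (Y (a, b)) (Y (e, d)) = (if b = e then Y (a, d) else 0)"
  proof (cases "b = e")
    case False
    then show ?thesis using assms lt
      by (simp add: Y_inner br_simps br_X_c br_X_r br_r_X br_c_X br_r_r br_r_c br_c_r br_c_c brX lin_br_def)
  next
    case True
    have *: "br (Y (a, b)) (Y (e, d)) = X (a, d) + v * (r d * (if (b, t) \<in> U' then X (a, t) else 0))
       + v * (c a * (if (k, b) \<in> U' then X (k, d) else 0)) + v * (r d * (c a * (if (k, b) \<in> U \<and> (b, t) \<in> U then 1 else 0)))"
      using assms lt True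
      by (simp add: Y_inner br_simps br_X_c br_X_r br_r_X br_c_X br_r_r br_r_c br_c_r br_c_c brX lin_br_def U'_inner)
         (simp add: algebra_simps vw)
    have rd: "r d = X (k, d)" if "(k, b) \<in> U" "(b, t) \<notin> U"
      using trans_col[of b d] assms True lt that by (intro r_unpaired) auto
    have ca: "c a = X (a, t)" if "(b, t) \<in> U" "(k, b) \<notin> U"
      using trans_row[of a b] assms True lt that by (intro c_unpaired) auto
    \<comment> \<open>A nonzero product makes \<open>(k, d)\<close> and \<open>(a, t)\<close>
      unfilled. Splitting the pivot at \<open>b\<close> and multiplying \<open>(a, b)\<close> by
      \<open>(b, d)\<close> then contradicts the assumption.\<close>
    have z: "r d * c a = 0" if "\<not> ((k, b) \<in> U \<or> (b, t) \<in> U) \<or> (a, d) \<notin> U"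
    proof (rule ccontr)
      assume "r d * c a \<noteq> 0"
      then have "r d \<noteq> 0" "c a \<noteq> 0" by auto
      then have "(k, d) \<in> U" "(a, t) \<in> U" using r_0 c_0 by blast+
      moreover have "(k, b) \<in> U \<or> (b, t) \<in> U" using U_split[OF kt, of b] lt assms by auto
      moreover have "(a, d) \<in> U" using trans_below[of a b d] assms True \<open>(k, d) \<in> U\<close> by auto
      ultimately show False using that by auto
    qed
    have z': "v * (r d * c a) = 0" if "\<not> ((k, b) \<in> U \<or> (b, t) \<in> U) \<or> (a, d) \<notin> U"
      using z[OF that] by simp
    have "br (Y (a, b)) (Y (e, d)) = X (a, d) + (if (k, b) \<in> U \<or> (b, t) \<in> U then v * (r d * c a) else 0)"
      unfolding * using rd ca assms lt True by (auto simp: U'_iff mult_ac)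
    also have "\<dots> = Y (a, d)"
    proof (cases "(a, d) \<in> U")
      case True
      then show ?thesis using assms z' by (auto simp: Y_inner)
    next
      case False
      then show ?thesis using z' by (auto simp: Y_0 X_0)
    qed
    finally show ?thesis using True by simp
  qed
  then show ?thesis using assms lt by (auto simp: lin_br_def)
qed

lemma brY_low_row: "k < a \<Longrightarrow> b \<noteq> k \<Longrightarrow> d \<noteq> t \<Longrightarrow> br (Y (a, b)) (Y (k, d)) = lin_br U Y (a, b) (k, d)"
  using U_less[of k d] U_less[of k a] U'_subset by (auto simp: Y_low Y_r br_X_r lin_br_def)

lemma brY_low_col: 
  assumes "k < a" "b \<noteq> k" "e \<noteq> k"
  shows "br (Y (a, b)) (Y (e, t)) = lin_br U Y (a, b) (e, t)"
proof -
  have "(a, t) \<notin> U" using assms U_le(2)[of a] by auto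
  then show ?thesis using assms tk by (auto simp: Y_low Y_c br_X_c lin_br_def X_0 Y_0 c_0)
qed

lemma brY_low_inner:
  assumes "k < a" "b \<noteq> k" "(a, b) \<in> U" "(e, d) \<in> U" "e < k" "d \<noteq> t"
  shows "br (Y (a, b)) (Y (e, d)) = lin_br U Y (a, b) (e, d)"
proof -
  have lt: "b < a" "t \<le> b" "d < e" "t < d" using U_less assms U_le(1)[of a b] U_le(1)[of e d] by auto
  have "(a, t) \<notin> U" using assms U_le(2)[of a] by auto
  then show ?thesis using assms lt
    by (auto simp: Y_low Y_inner br_simps br_X_c br_X_r brX lin_br_def X_0 U'_iff)
qed

lemma brY_low_low:
  assumes "k < a" "b \<noteq> k" "(a, b) \<in> U" "(e, d) \<in> U" "k < e" "d \<noteq> k"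
  shows "br (Y (a, b)) (Y (e, d)) = lin_br U Y (a, b) (e, d)"
proof -
  have "(a, t) \<notin> U" "(e, t) \<notin> U" using assms U_le(2)[of a]  U_le(2)[of e] by auto
  then show ?thesis using assms tk by (auto simp: Y_low brX lin_br_def X_0 U'_iff)
qed

lemma sum_delta_interval: "(\<Sum>x\<in>{t<..<k}. if x = j then f x else 0) = (if t < j \<and> j < k then f j else (0::'a))"
  by (simp add: sum.delta)

text \<open>If \<open>d\<close> is paired, \<open>X (a, k)\<close> commutes with \<open>r d\<close>,
  and the summand \<open>x = d\<close> of the correction supplies \<open>X (a, d)\<close> through
  \<open>v * w = 1\<close>; otherwise that summand commutes and \<open>X (a, k)\<close> supplies
  it.\<close>

lemma brY_pivot_row:
  assumes "(a, k) \<in> U" "(k, d) \<in> U" "d \<noteq> t"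
  shows "br (Y (a, k)) (Y (k, d)) = lin_br U Y (a, k) (k, d)"
proof -
  have lt: "k < a" "t < d" "d < k" using U_less assms U_le(1)[of k d] by auto
  have 1: "br (X (a, x) * c x) (r d) = (if x = d then (if (d, t) \<in> U then - (w * X (a, d)) else 0) else 0)"
    if "x \<in> {t<..<k}" for x
    using that lt assms by (simp add: br_simps br_X_r br_c_r)
  have S: "br (\<Sum>x\<in>{t<..<k}. X (a, x) * c x) (r d) = (if (d, t) \<in> U then - (w * X (a, d)) else 0)"
    unfolding br_sum1 using lt by (simp add: 1 sum_delta_interval cong: sum.cong_simp)
  have "br (Y (a, k)) (Y (k, d)) = (if (d, t) \<in> U then 0 else X (a, d)) + (if (d, t) \<in> U then X (a, d) else 0)"
    using lt assms by (simp add: Y_pivot Y_r br_diff1 br_mult1[of v] S br_X_r vw U'_iff)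
  also have "\<dots> = Y (a, d)" using lt by (simp add: Y_low)
  finally show ?thesis using lt assms by (auto simp: lin_br_def)
qed

lemma brY_pivot_col:
  assumes "(a, k) \<in> U" "(e, t) \<in> U" "e \<noteq> k"
  shows "br (Y (a, k)) (Y (e, t)) = lin_br U Y (a, k) (e, t)"
proof -
  have lt: "k < a" "e < k" using U_less assms U_le(2)[of e] by auto
  have at: "(a, t) \<notin> U" using lt U_le(2)[of a] by auto
  have "br (X (a, x)) (c e) = 0" for x using X_0[OF at] by (simp add: br_X_c)
  then show ?thesis using lt assms tk
    by (auto simp: Y_pivot Y_c br_simps br_c_c lin_br_def)
qed

text \<open>The places do not compose, so the bracket must vanish. The negative term needs
  \<open>(a, e)\<close> in \<open>U\<close>, which \<open>split_below\<close> provides; splitting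
  the pivot at \<open>d\<close> shows that exactly one of the three positive terms is present, and
  it equals the negative one. If \<open>(a, d)\<close> or \<open>(e, t)\<close> is filled, every
  term is zero.\<close>

lemma brY_pivot_inner:
  assumes "(a, k) \<in> U" "(e, d) \<in> U" "e < k" "d \<noteq> t"
  shows "br (Y (a, k)) (Y (e, d)) = lin_br U Y (a, k) (e, d)"
proof -
  have lt: "k < a" "t < d" "d < e" using U_less assms U_le(1)[of e d] by auto
  have at: "(a, t) \<notin> U" using lt U_le(2)[of a] by auto
  have 1: "br (X (a, x) * c x) (X (e, d) + v * (r d * c e)) =
      (if x = e then (if (a, e) \<in> U then X (a, d) * c e else 0) else 0)
      - (if x = d then (if (d, t) \<in> U' then X (a, d) * X (e, t) else 0) else 0)
      - (if x = d then (if (k, d) \<in> U \<and> (d, t) \<in> U then X (a, d) * c e else 0) else 0)"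
    if "x \<in> {t<..<k}" for x
    using that lt assms at
    by (simp add: br_simps br_X_r br_X_c br_c_X br_c_c br_c_r brX lin_br_def U'_inner X_0)
       (auto simp: algebra_simps vw X_0)
  have *: "br (Y (a, k)) (Y (e, d)) = v * ((if (k, d) \<in> U' then X (a, d) * c e else 0)
      - (if (a, e) \<in> U then X (a, d) * c e else 0)
      + (if (d, t) \<in> U' then X (a, d) * X (e, t) else 0)
      + (if (k, d) \<in> U \<and> (d, t) \<in> U then X (a, d) * c e else 0))"
  proof -
    have S: "br (\<Sum>x\<in>{t<..<k}. X (a, x) * c x) (X (e, d) + v * (r d * c e)) =
        (if (a, e) \<in> U then X (a, d) * c e else 0) - (if (d, t) \<in> U' then X (a, d) * X (e, t) else 0)
        - (if (k, d) \<in> U \<and> (d, t) \<in> U then X (a, d) * c e else 0)"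
      unfolding br_sum1 using lt assms by (simp add: 1 sum_subtractf sum_delta_interval cong: sum.cong_simp)
    have XX: "br (X (a, k)) (X (e, d) + v * (r d * c e)) = v * (if (k, d) \<in> U' then X (a, d) * c e else 0)"
      using lt assms at by (simp add: br_simps br_X_r br_X_c brX lin_br_def U'_inner)
    have "br (Y (a, k)) (Y (e, d)) = br (X (a, k)) (X (e, d) + v * (r d * c e))
        - v * br (\<Sum>x\<in>{t<..<k}. X (a, x) * c x) (X (e, d) + v * (r d * c e))"
      using assms by (simp add: Y_pivot Y_inner[of e d] br_diff1 br_mult1[of v])
    then show ?thesis unfolding S XX by (simp add: algebra_simps)
  qed
  have "br (Y (a, k)) (Y (e, d)) = 0"
  proof (cases "(a, d) \<in> U \<and> (e, t) \<in> U")
    case True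
    have kd: "(k, d) \<in> U \<or> (d, t) \<in> U" using U_split[OF kt, of d] lt assms by auto
    have ae: "(a, e) \<in> U" using split_below[of a e d] True assms lt by auto
    have ce: "c e = X (e, t)" if "(k, d) \<notin> U"
      using trans_row[of e d] assms lt that by (intro c_unpaired) auto
    show ?thesis unfolding * using kd ae ce lt assms by (auto simp: U'_iff)
  next
    case False
    then show ?thesis unfolding * using X_0[of a d] X_0[of e t] c_0[of e] by auto
  qed
  then show ?thesis using lt assms by (auto simp: lin_br_def)
qed

text \<open>For \<open>d = a\<close> every summand \<open>X (a, x) * c x\<close> must turn into
  \<open>- X (e, x) * c x\<close>; \<open>split_through\<close> ensures that \<open>(a, x)\<close>
  is unfilled whenever that is nonzero. If \<open>(e, k)\<close> is filled,
  \<open>trans_pivot\<close> makes the resulting sum vanish, in accordance with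
  \<open>Y (e, k) = 0\<close>.\<close>

lemma brY_pivot_low:
  assumes "(a, k) \<in> U" "(e, d) \<in> U" "k < e" "d \<noteq> k"
  shows "br (Y (a, k)) (Y (e, d)) = lin_br U Y (a, k) (e, d)"
proof -
  have lt: "k < a" "t \<le> d" "d < e" using U_less assms U_le(1)[of e d] by auto
  have at: "(a, t) \<notin> U" "(e, t) \<notin> U" using lt assms U_le(2)[of a] U_le(2)[of e] by auto
  have 1: "br (X (a, x) * c x) (X (e, d)) = (if d = a then - (X (e, x) * c x) else 0)"
    if "x \<in> {t<..<k}" for x
  proof (cases "(x, t) \<in> U \<and> (e, x) \<in> U \<and> d = a")
    case True
    then have "(a, x) \<in> U" using split_through[of e a x] assms that lt by auto
    then show ?thesis using that lt assms at True
      by (simp add: br_simps br_c_X brX lin_br_def U'_inner X_0)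
  next
    case False
    then show ?thesis using that lt assms at c_0[of x] X_0[of e x]
      by (auto simp: br_simps br_c_X brX lin_br_def U'_inner X_0)
  qed
  have S: "br (\<Sum>x\<in>{t<..<k}. X (a, x) * c x) (X (e, d)) = (if d = a then - (\<Sum>x\<in>{t<..<k}. X (e, x) * c x) else 0)"
    unfolding br_sum1 by (simp add: 1 sum_negf cong: sum.cong_simp)
  have z: "X (e, x) = 0" if "d = a" "(e, k) \<notin> U" "x < k" for x
    using trans_pivot[of e a x] assms that by (intro X_0) auto
  have "br (Y (a, k)) (Y (e, d)) = (if d = a then - (X (e, k) - v * (\<Sum>x\<in>{t<..<k}. X (e, x) * c x)) else 0)"
    using lt assms at tk
    by (auto simp: Y_pivot Y_low br_diff1 br_mult1[of v] S brX lin_br_def U'_inner)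
  also have "\<dots> = (if d = a then - Y (e, k) else 0)"
    using z by (cases "(e, k) \<in> U") (auto simp: Y_pivot Y_0 X_0)
  finally show ?thesis using lt assms by (auto simp: lin_br_def)
qed

lemma brY_pivot_pivot:
  assumes "(a, k) \<in> U" "(e, k) \<in> U"
  shows "br (Y (a, k)) (Y (e, k)) = lin_br U Y (a, k) (e, k)"
proof -
  have lt: "k < a" "k < e" using U_less assms by auto
  have at: "(a, t) \<notin> U" "(e, t) \<notin> U" using lt U_le(2)[of a] U_le(2)[of e] by auto
  have "br (X (a, k)) (X (e, k)) = 0" using lt by (simp add: brX lin_br_def)
  moreover have "br (X (a, x) * c x) (X (e, y) * c y) = 0" "br (X (a, k)) (X (e, y) * c y) = 0" "br (X (a, x) * c x) (X (e, k)) = 0"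
    if "x \<in> {t<..<k}" "y \<in> {t<..<k}" for x y
    using that lt at by (simp_all add: br_simps br_c_X br_X_c br_c_c brX lin_br_def X_0)
  ultimately have "br (Y (a, k)) (Y (e, k)) = 0" using assms
    by (simp add: Y_pivot br_diff1 br_diff2 br_mult1[of v] br_mult2[of _ v] br_sum1 br_sum2 cong: sum.cong_simp)
  then show ?thesis using lt by (simp add: lin_br_def)
qed

lemma lin_br_anti: "lin_br U Y \<eta> \<xi> = - lin_br U Y \<xi> \<eta>"
  by (auto simp: lin_br_def)

lemma brY_U: assumes "\<xi> \<in> U" "\<eta> \<in> U" shows "br (Y \<xi>) (Y \<eta>) = lin_br U Y \<xi> \<eta>"
proof -
  obtain a b where \<xi>: "\<xi> = (a, b)" by force
  obtain e d where \<eta>: "\<eta> = (e, d)" by force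
  have sym: "br (Y \<xi>) (Y \<eta>) = lin_br U Y \<xi> \<eta>" if "br (Y \<eta>) (Y \<xi>) = lin_br U Y \<eta> \<xi>"
    using that br_anti[of "Y \<xi>" "Y \<eta>"] lin_br_anti[of \<xi> \<eta>] by simp
  have Y0: "Y (i, t) = 0" if "k < i" for i
    using U_le(2)[of i] that by (intro Y_0) auto
  have w: "br (Y (k, t)) (Y (i, j)) = lin_br U Y (k, t) (i, j)" if "(i, j) \<in> U" for i j
    using that U_less[of t j] U_le(1)[of i j] Y0 U_less[of i j]
    by (auto simp: Y_kt lin_br_def)
  have types: thesis if "(i, j) \<in> U" "(i, j) = (k, t) \<Longrightarrow> thesis" "i = k \<Longrightarrow> j \<noteq> t \<Longrightarrow> thesis"
      "j = t \<Longrightarrow> i \<noteq> k \<Longrightarrow> thesis" "i < k \<Longrightarrow> j \<noteq> t \<Longrightarrow> thesis" "k < i \<Longrightarrow> j \<noteq> k \<Longrightarrow> thesis"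
      "k < i \<Longrightarrow> j = k \<Longrightarrow> thesis" for i j thesis
    using that by (metis linorder_neqE_nat)
  have U: "(a, b) \<in> U" "(e, d) \<in> U" using assms \<xi> \<eta> by auto
  have wZ: "br (Y (a, b)) (Y (e, d)) = lin_br U Y (a, b) (e, d)" if "(a, b) = (k, t) \<or> (e, d) = (k, t)"
    using w[OF U(1)] w[OF U(2)] that sym unfolding \<xi> \<eta> by metis
  show ?thesis
  proof (cases "(a, b) = (k, t) \<or> (e, d) = (k, t)")
    case True
    then show ?thesis using wZ \<xi> \<eta> by simp
  next
    case False
    have "br (Y (a, b)) (Y (e, d)) = lin_br U Y (a, b) (e, d)"
    proof (rule types[OF U(1)])
      assume "(a, b) = (k, t)"
      then show ?thesis using wZ by blast
    next
      assume x: "a = k" "b \<noteq> t"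
      show ?thesis
      proof (rule types[OF U(2)])
        assume "(e, d) = (k, t)"
        then show ?thesis using wZ by blast
      next
        assume y: "e = k" "d \<noteq> t"
        show ?thesis using brY_row_row[of b d] U x y by auto
      next
        assume y: "d = t" "e \<noteq> k"
        show ?thesis using brY_row_col[of b e] U x y by auto
      next
        assume y: "e < k" "d \<noteq> t"
        show ?thesis using brY_inner_row[of e d b] U x y sym \<xi> \<eta> by auto
      next
        assume y: "k < e" "d \<noteq> k"
        show ?thesis using brY_low_row[of e d b] U x y sym \<xi> \<eta> by auto
      next
        assume y: "k < e" "d = k"
        show ?thesis using brY_pivot_row[of e b] U x y sym \<xi> \<eta> by auto
      qed
    next
      assume x: "b = t" "a \<noteq> k"
      show ?thesis
      proof (rule types[OF U(2)])
        assume "(e, d) = (k, t)"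
        then show ?thesis using wZ by blast
      next
        assume y: "e = k" "d \<noteq> t"
        show ?thesis using brY_row_col[of d a] U x y sym \<xi> \<eta> by auto
      next
        assume y: "d = t" "e \<noteq> k"
        show ?thesis using brY_col_col[of a e] U x y by auto
      next
        assume y: "e < k" "d \<noteq> t"
        show ?thesis using brY_inner_col[of e d a] U x y sym \<xi> \<eta> by auto
      next
        assume y: "k < e" "d \<noteq> k"
        show ?thesis using brY_low_col[of e d a] U x y sym \<xi> \<eta> by auto
      next
        assume y: "k < e" "d = k"
        show ?thesis using brY_pivot_col[of e a] U x y sym \<xi> \<eta> by auto
      qed
    next
      assume x: "a < k" "b \<noteq> t"
      show ?thesis
      proof (rule types[OF U(2)])
        assume "(e, d) = (k, t)"
        then show ?thesis using wZ by blast
      next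
        assume y: "e = k" "d \<noteq> t"
        show ?thesis using brY_inner_row[of a b d] U x y by auto
      next
        assume y: "d = t" "e \<noteq> k"
        show ?thesis using brY_inner_col[of a b e] U x y by auto
      next
        assume y: "e < k" "d \<noteq> t"
        show ?thesis
        proof (cases "d = a")
          case True
          \<comment> \<open>At most one of the two products of a pair of strictly lower matrix units
            is nonzero, so exchanging the arguments meets the side condition of
            \<open>brY_inner_inner\<close>.\<close>
          then have "b \<noteq> e" using U_less[OF U(1)] U_less[OF U(2)] by auto
          then show ?thesis using brY_inner_inner[of e d a b] U x y sym \<xi> \<eta> by auto
        qed (use brY_inner_inner[of a b e d] U x y in auto)
      next
        assume y: "k < e" "d \<noteq> k"
        show ?thesis using brY_low_inner[of e d a b] U x y sym \<xi> \<eta> by auto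
      next
        assume y: "k < e" "d = k"
        show ?thesis using brY_pivot_inner[of e a b] U x y sym \<xi> \<eta> by auto
      qed
    next
      assume x: "k < a" "b \<noteq> k"
      show ?thesis
      proof (rule types[OF U(2)])
        assume "(e, d) = (k, t)"
        then show ?thesis using wZ by blast
      next
        assume y: "e = k" "d \<noteq> t"
        show ?thesis using brY_low_row[of a b d] U x y by auto
      next
        assume y: "d = t" "e \<noteq> k"
        show ?thesis using brY_low_col[of a b e] U x y by auto
      next
        assume y: "e < k" "d \<noteq> t"
        show ?thesis using brY_low_inner[of a b e d] U x y by auto
      next
        assume y: "k < e" "d \<noteq> k"
        show ?thesis using brY_low_low[of a b e d] U x y by auto
      next
        assume y: "k < e" "d = k"
        show ?thesis using brY_pivot_low[of e a b] U x y sym \<xi> \<eta> by auto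
      qed
    next
      assume x: "k < a" "b = k"
      show ?thesis
      proof (rule types[OF U(2)])
        assume "(e, d) = (k, t)"
        then show ?thesis using wZ by blast
      next
        assume y: "e = k" "d \<noteq> t"
        show ?thesis using brY_pivot_row[of a d] U x y by auto
      next
        assume y: "d = t" "e \<noteq> k"
        show ?thesis using brY_pivot_col[of a e] U x y by auto
      next
        assume y: "e < k" "d \<noteq> t"
        show ?thesis using brY_pivot_inner[of a e d] U x y by auto
      next
        assume y: "k < e" "d \<noteq> k"
        show ?thesis using brY_pivot_low[of a e d] U x y by auto
      next
        assume y: "k < e" "d = k"
        show ?thesis using brY_pivot_pivot[of a e] U x y by auto
      qed
    qed
    then show ?thesis using \<xi> \<eta> by simp
  qed
qed

lemma brY: "br (Y \<xi>) (Y \<eta>) = lin_br U Y \<xi> \<eta>"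
  using brY_U[of \<xi> \<eta>] by (cases "\<xi> \<in> U \<and> \<eta> \<in> U") (auto simp: Y_0 lin_br_def)

end

section \<open>The diagram\<close>

lemma finite_A_set [simp]: "finite (A_set n)"
  by (rule finite_subset[of _ "{..n} \<times> {..n}"]) (auto simp: A_set_def)

lemma succA_trans: "succA x y \<Longrightarrow> succA y z \<Longrightarrow> succA x z"
  by (auto simp: succA_def)
lemma succA_irrefl: "\<not> succA x x"
  by (auto simp: succA_def)
lemma succA_total: "x \<noteq> y \<Longrightarrow> succA x y \<or> succA y x"
  by (cases x; cases y) (auto simp: succA_def)

lemma ex_dominating:
  assumes "finite U" "U \<noteq> {}"
    and trans: "\<And>x y z. R x y \<Longrightarrow> R y z \<Longrightarrow> R x z" and total: "\<And>x y. x \<noteq> y \<Longrightarrow> R x y \<or> R y x"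
  shows "\<exists>\<xi>\<in>U. \<forall>\<eta>\<in>U. \<eta> \<noteq> \<xi> \<longrightarrow> R \<xi> \<eta>"
  using assms(1,2)
proof (induction rule: finite_ne_induct)
  case (insert x F)
  then obtain \<xi> where \<xi>: "\<xi> \<in> F" "\<forall>\<eta>\<in>F. \<eta> \<noteq> \<xi> \<longrightarrow> R \<xi> \<eta>" by blast
  show ?case
  proof (cases "R x \<xi>")
    case True
    then have "\<forall>\<eta>\<in>insert x F. \<eta> \<noteq> x \<longrightarrow> R x \<eta>" using \<xi> trans[OF True] True by (metis insert_iff)
    then show ?thesis by blast
  next
    case False
    then have "\<forall>\<eta>\<in>insert x F. \<eta> \<noteq> \<xi> \<longrightarrow> R \<xi> \<eta>" using \<xi> total by blast
    then show ?thesis using \<xi>(1) by blast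
  qed
qed auto

lemma greatest_place:
  assumes "finite U" "U \<noteq> {}"
  shows "greatest_place U \<in> U" "\<And>\<eta>. \<eta> \<in> U \<Longrightarrow> \<eta> \<noteq> greatest_place U \<Longrightarrow> succA (greatest_place U) \<eta>"
proof -
  let ?P = "\<lambda>\<xi>. \<xi> \<in> U \<and> (\<forall>\<eta>\<in>U. \<eta> \<noteq> \<xi> \<longrightarrow> succA \<xi> \<eta>)"
  have "\<exists>!\<xi>. ?P \<xi>"
  proof (rule ex_ex1I)
    show "\<exists>\<xi>. ?P \<xi>" using ex_dominating[of U succA] assms succA_trans succA_total
      by (simp only: Bex_def) blast
    fix x y assume "?P x" "?P y"
    then have "x \<noteq> y \<Longrightarrow> succA x y \<and> succA y x" by metis
    then show "x = y" using succA_trans[of x y x] succA_irrefl[of x] by metis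
  qed
  from theI'[OF this] show "greatest_place U \<in> U"
    "\<And>\<eta>. \<eta> \<in> U \<Longrightarrow> \<eta> \<noteq> greatest_place U \<Longrightarrow> succA (greatest_place U) \<eta>"
    by (auto simp: greatest_place_def)
qed

locale diagram =
  fixes n :: nat and M :: "(nat \<times> nat) set"
  assumes ideal: "is_ideal_set n M"
begin

definition Us :: "nat \<Rightarrow> (nat \<times> nat) set" where "Us i = unfilled n (diag_fill n M i)"
abbreviation kap :: "nat \<Rightarrow> nat \<times> nat" where "kap \<equiv> diag_xi n M"
abbreviation K :: "nat \<Rightarrow> nat" where "K i \<equiv> fst (kap i)"
abbreviation T :: "nat \<Rightarrow> nat" where "T i \<equiv> snd (kap i)"
abbreviation s :: nat where "s \<equiv> diag_s n M"

lemma Us_0: "Us 0 = A_set n - M"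
  by (auto simp: Us_def unfilled_def)

lemma Us_A: "Us i \<subseteq> A_set n" by (auto simp: Us_def unfilled_def)
lemma finite_Us [simp]: "finite (Us i)" using Us_A finite_subset finite_A_set by blast

lemma kap: "Us i \<noteq> {} \<Longrightarrow> kap i \<in> Us i" "\<And>\<eta>. \<eta> \<in> Us i \<Longrightarrow> \<eta> \<noteq> kap i \<Longrightarrow> succA (kap i) \<eta>"
proof -
  have *: "kap i = greatest_place (Us i)" by (simp add: diag_xi_def Us_def)
  show "Us i \<noteq> {} \<Longrightarrow> kap i \<in> Us i" unfolding * by (rule greatest_place) auto
  show "\<And>\<eta>. \<eta> \<in> Us i \<Longrightarrow> \<eta> \<noteq> kap i \<Longrightarrow> succA (kap i) \<eta>" unfolding *
    by (rule greatest_place) auto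
qed

text \<open>The bounds \<open>t < a < k\<close> in the filling rule are automatic for unfilled
  places. From here on only the set of unfilled places matters and no longer the symbols.\<close>

lemma Us_Suc:
  assumes "Us i \<noteq> {}"
  shows "Us (Suc i) = peel (kap i) (Us i)"
proof -
  obtain k t where kt: "kap i = (k, t)" by force
  define f where "f = diag_fill n M i"
  have U: "Us i = unfilled n f" by (simp add: Us_def f_def)
  have "(k, t) \<in> A_set n" using kap(1)[OF assms] Us_A kt by auto
  then have A: "t < a \<Longrightarrow> a < k \<Longrightarrow> (k, a) \<in> A_set n \<and> (a, t) \<in> A_set n" for a
    by (auto simp: A_set_def)
  have lt: "(a, b) \<in> Us i \<Longrightarrow> b < a" for a b using Us_A[of i] by (auto simp: A_set_def)
  have Us: "Us (Suc i) = unfilled n (diag_step n f)"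
    using assms by (simp add: Us_def f_def)
  have gp: "greatest_place (unfilled n f) = (k, t)" using kt by (simp add: diag_xi_def f_def)
  have fin: "diag_step n f \<xi> = None \<longleftrightarrow> f \<xi> = None \<and> \<xi> \<noteq> (k, t)
      \<and> \<not> (\<exists>a. t < a \<and> a < k \<and> \<xi> = (k, a) \<and> f (k, a) = None \<and> f (a, t) = None)
      \<and> \<not> (\<exists>a. t < a \<and> a < k \<and> \<xi> = (a, t) \<and> f (k, a) = None \<and> f (a, t) = None)" for \<xi>
    unfolding diag_step_def gp Let_def prod.case
    by (simp only: if_split[where P = "\<lambda>x. x = None"]) blast
  have mem: "x \<in> Us i \<longleftrightarrow> x \<in> A_set n \<and> f x = None" for x by (auto simp: U unfilled_def)
  have "(a, b) \<in> Us (Suc i) \<longleftrightarrow> (a, b) \<in> peel (kap i) (Us i)" for a b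
  proof -
    have "(\<exists>a'. t < a' \<and> a' < k \<and> (a, b) = (k, a') \<and> f (k, a') = None \<and> f (a', t) = None)
        \<longleftrightarrow> a = k \<and> (b, t) \<in> Us i" if "(a, b) \<in> Us i"
      using that A lt[of b t] lt[of k b] by (auto simp: mem)
    moreover have "(\<exists>a'. t < a' \<and> a' < k \<and> (a, b) = (a', t) \<and> f (k, a') = None \<and> f (a', t) = None)
        \<longleftrightarrow> b = t \<and> (k, a) \<in> Us i" if "(a, b) \<in> Us i"
      using that A lt[of a t] lt[of k a] by (auto simp: mem)
    ultimately show ?thesis
      using mem[of "(a, b)"]
      by (simp only: Us peel_def kt fst_conv snd_conv unfilled_def mem_Collect_eq prod.case fin[of "(a, b)"]) blast
  qed
  then show ?thesis by auto
qed

lemma places_step: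
  assumes "Us i \<noteq> {}" "closed_places n M (Us i)"
  shows "places_step n M (Us i) (K i) (T i)"
proof
  show "is_ideal_set n M" "closed_places n M (Us i)" by (fact ideal assms(2))+
  show "(K i, T i) \<in> Us i" using kap(1)[OF assms(1)] by simp
  show "succA (K i, T i) \<eta>" if "\<eta> \<in> Us i" "\<eta> \<noteq> (K i, T i)" for \<eta>
    using kap(2)[OF that(1)] that(2) by simp
qed

text \<open>Initially the set is the complement of \<open>M\<close>: conclusions in its union with
  \<open>M\<close> just say that a place is strictly lower triangular, and splitting is the ideal
  property read backwards. \<open>peel_closed\<close> carries the invariant through each
  step.\<close>

lemma closed_Us: "closed_places n M (Us i)"
proof (induction i)
  case 0
  have A: "(a, b) \<in> A_set n \<longleftrightarrow> 1 \<le> b \<and> b < a \<and> a \<le> n" for a b by (auto simp: A_set_def)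
  have id: "(a, c) \<in> M" if "(a, b) \<in> A_set n" "(b, c) \<in> A_set n" "(a, b) \<in> M \<or> (b, c) \<in> M" for a b c
    using ideal that unfolding is_ideal_set_def by blast
  have MA: "(a, b) \<in> M \<Longrightarrow> (a, b) \<in> A_set n" for a b
    using ideal unfolding is_ideal_set_def by blast
  show ?case unfolding closed_places_def Us_0
  proof (intro conjI allI impI)
    fix a b c assume "(a, c) \<in> A_set n - M" "c < b" "b < a"
    then show "(a, b) \<in> A_set n - M \<or> (b, c) \<in> A_set n - M"
      using id[of a b c] by (auto simp: A)
  next
    fix a b c assume "(a, c) \<in> M" "(b, c) \<in> A_set n - M" "b < a"
    then show "(a, b) \<in> A_set n - M \<union> M" using MA[of a c] by (auto simp: A)
  qed (auto simp: A)
next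
  case (Suc i)
  show ?case
  proof (cases "Us i = {}")
    case True
    then have "Us (Suc i) = Us i" by (simp add: Us_def)
    then show ?thesis using Suc by simp
  next
    case False
    then interpret places_step n M "Us i" "K i" "T i"
      using Suc by (rule places_step)
    show ?thesis using peel_closed unfolding U'_def Us_Suc[OF False] by simp
  qed
qed

lemma Us_Suc_subset: "Us (Suc i) \<subseteq> Us i"
proof (cases "Us i = {}")
  case True
  then have "Us (Suc i) = Us i" by (simp add: Us_def)
  then show ?thesis by simp
next
  case False
  then show ?thesis by (auto simp: Us_Suc peel_def)
qed

lemma Us_antimono: "i \<le> j \<Longrightarrow> Us j \<subseteq> Us i"
  by (induction rule: dec_induct) (use Us_Suc_subset in auto)

lemma kap_notin_Suc: "Us i \<noteq> {} \<Longrightarrow> kap i \<notin> Us (Suc i)"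
  by (auto simp: Us_Suc peel_def)

lemma card_Us: "Us i \<noteq> {} \<Longrightarrow> card (Us (Suc i)) < card (Us i)"
proof (rule psubset_card_mono)
  assume "Us i \<noteq> {}"
  then show "Us (Suc i) \<subset> Us i" using Us_Suc_subset[of i] kap_notin_Suc[of i] kap(1)[of i] by blast
qed simp

lemma Us_s: "Us s = {}" and Us_less_s: "i < s \<Longrightarrow> Us i \<noteq> {}"
proof -
  have "\<exists>i. Us i = {}"
  proof (rule ccontr)
    assume "\<nexists>i. Us i = {}"
    then have "card (Us i) + i \<le> card (Us 0)" for i
      by (induction i) (use card_Us in \<open>auto simp: less_eq_Suc_le intro: order.trans[rotated]\<close>)
    from this[of "Suc (card (Us 0))"] show False by simp
  qed
  then show "Us s = {}" unfolding diag_s_def Us_def by (rule LeastI_ex)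
  show "i < s \<Longrightarrow> Us i \<noteq> {}" unfolding diag_s_def Us_def by (rule not_less_Least)
qed

lemma step_at: "i < s \<Longrightarrow> places_step n M (Us i) (K i) (T i)"
  using places_step[OF Us_less_s closed_Us] .

lemma kap_in: "i < s \<Longrightarrow> kap i \<in> Us i"
  using kap Us_less_s by blast

lemma kap_in_0: "i < s \<Longrightarrow> kap i \<in> Us 0"
  using kap_in Us_antimono[of 0 i] by auto

lemma kap_succ: "i < j \<Longrightarrow> j < s \<Longrightarrow> succA (kap i) (kap j)"
proof -
  assume "i < j" "j < s"
  then have "kap j \<in> Us (Suc i)" using kap_in Us_antimono[of "Suc i" j] by auto
  then show ?thesis using kap(2)[of "kap j" i] kap_notin_Suc[of i] Us_Suc_subset by fastforce
qed

section \<open>The dictionary between places and Laurent variables\<close>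

definition level :: "nat \<times> nat \<Rightarrow> nat" where "level \<xi> = (LEAST i. \<xi> \<notin> Us (Suc i))"

lemma level_eq: "\<xi> \<in> Us i \<Longrightarrow> \<xi> \<notin> Us (Suc i) \<Longrightarrow> level \<xi> = i"
  unfolding level_def
proof (rule Least_equality)
  fix j assume "\<xi> \<in> Us i" "\<xi> \<notin> Us (Suc j)"
  then show "i \<le> j" using Us_antimono[of "Suc j" i] by (cases "i \<le> j") auto
qed

lemma level: assumes "\<xi> \<in> Us 0" shows "\<xi> \<in> Us (level \<xi>)" "\<xi> \<notin> Us (Suc (level \<xi>))" "level \<xi> < s"
proof -
  have "\<exists>i. \<xi> \<in> Us i \<and> \<xi> \<notin> Us (Suc i) \<and> i < s"
  proof (rule ccontr)
    assume *: "\<nexists>i. \<xi> \<in> Us i \<and> \<xi> \<notin> Us (Suc i) \<and> i < s"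
    have "i \<le> s \<Longrightarrow> \<xi> \<in> Us i" for i
      by (induction i) (use * assms in auto)
    then show False using Us_s by auto
  qed
  then show "\<xi> \<in> Us (level \<xi>)" "\<xi> \<notin> Us (Suc (level \<xi>))" "level \<xi> < s"
    using level_eq by blast+
qed

lemma removed_at:
  assumes "\<xi> \<in> Us 0"
  obtains i where "i < s" "\<xi> \<in> Us i" "\<xi> \<notin> Us (Suc i)"
  using level[OF assms] by blast

lemma level_kap: "i < s \<Longrightarrow> level (kap i) = i"
  using kap_in kap_notin_Suc Us_less_s level_eq by blast

text \<open>One canonical pair for each element: the minus on \<open>(K i, a)\<close> with the plus
  on \<open>(a, T i)\<close>. Its cardinality is the \<open>m\<close> of the theorem.\<close>

definition Pairs :: "(nat \<times> nat) set" where
  "Pairs = {(i, a). i < s \<and> (K i, a) \<in> Us i \<and> (a, T i) \<in> Us i}"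

lemma finite_Pairs: "finite Pairs"
proof (rule finite_subset)
  show "Pairs \<subseteq> {..<s} \<times> snd ` Us 0"
    using Us_antimono[of 0] by (force simp: Pairs_def)
qed auto

definition m :: nat where "m = card Pairs"
definition h :: "nat \<times> nat \<Rightarrow> nat" where "h = (SOME h. bij_betw h Pairs {..<m})"

lemma h: "bij_betw h Pairs {..<m}"
proof -
  have "\<exists>h. bij_betw h Pairs {..<m}"
    using ex_bij_betw_finite_nat[OF finite_Pairs] by (auto simp: m_def atLeast0LessThan)
  then show ?thesis unfolding h_def by (rule someI_ex)
qed

lemma h_less: "x \<in> Pairs \<Longrightarrow> h x < m"
  using h by (auto simp: bij_betw_def)
lemma h_inj: "x \<in> Pairs \<Longrightarrow> y \<in> Pairs \<Longrightarrow> h x = h y \<longleftrightarrow> x = y"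
  using h by (auto simp: bij_betw_def inj_on_def)

text \<open>The variable that a place contributes: a pivot gives a \<open>z\<close>, a minus a
  \<open>p\<close>, a plus a \<open>q\<close>. This is a bijection from the places outside
  \<open>M\<close> onto the variables of the target, so the homomorphism can be triangular.\<close>

definition vmap :: "nat \<times> nat \<Rightarrow> tvar" where
  "vmap \<xi> = (let i = level \<xi> in if \<xi> = kap i then Inl i
     else if fst \<xi> = K i then Inr (Inl (h (i, snd \<xi>))) else Inr (Inr (h (i, fst \<xi>))))"

lemma removed_cases:
  assumes "i < s" "\<xi> \<in> Us i" "\<xi> \<notin> Us (Suc i)"
  obtains (kap) "\<xi> = kap i" "vmap \<xi> = Inl i"
  | (row) a where "\<xi> = (K i, a)" "(i, a) \<in> Pairs" "a \<noteq> T i" "vmap \<xi> = Inr (Inl (h (i, a)))"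
  | (col) a where "\<xi> = (a, T i)" "(i, a) \<in> Pairs" "a \<noteq> K i" "vmap \<xi> = Inr (Inr (h (i, a)))"
proof -
  have l: "level \<xi> = i" using level_eq assms by auto
  interpret places_step n M "Us i" "K i" "T i" by (rule step_at[OF assms(1)])
  obtain a b where ab: "\<xi> = (a, b)" by force
  show ?thesis
  proof (cases "\<xi> = kap i")
    case True
    then show ?thesis using l kap by (simp add: vmap_def)
  next
    case False
    then consider "a = K i" "(b, T i) \<in> Us i" | "a \<noteq> K i" "b = T i" "(K i, a) \<in> Us i"
      using assms ab U_less[of "K i" "K i"] by (auto simp: Us_Suc[OF Us_less_s] peel_def)
    then show ?thesis
    proof cases
      case 1
      then show ?thesis using row[of b] False l ab assms U_less[of "T i" "T i"] by (auto simp: vmap_def Pairs_def)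
    next
      case 2
      then show ?thesis using col[of a] False l ab assms by (auto simp: vmap_def Pairs_def)
    qed
  qed
qed

lemma vmap_kap: "i < s \<Longrightarrow> vmap (kap i) = Inl i"
  by (simp add: vmap_def level_kap)

lemma pair_places:
  assumes "(i, a) \<in> Pairs"
  shows "(K i, a) \<in> Us i" "(K i, a) \<notin> Us (Suc i)" "(a, T i) \<in> Us i" "(a, T i) \<notin> Us (Suc i)"
    "vmap (K i, a) = Inr (Inl (h (i, a)))" "vmap (a, T i) = Inr (Inr (h (i, a)))"
proof -
  have i: "i < s" using assms by (simp add: Pairs_def)
  interpret places_step n M "Us i" "K i" "T i" by (rule step_at[OF i])
  show 1: "(K i, a) \<in> Us i" "(a, T i) \<in> Us i" using assms by (auto simp: Pairs_def)
  show 2: "(K i, a) \<notin> Us (Suc i)" "(a, T i) \<notin> Us (Suc i)"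
    using 1 by (auto simp: Us_Suc[OF Us_less_s[OF i]] peel_def)
  have "a \<noteq> K i" "a \<noteq> T i" using U_less 1 by auto
  moreover have "level (K i, a) = i" "level (a, T i) = i" using 1 2 level_eq by auto
  ultimately show "vmap (K i, a) = Inr (Inl (h (i, a)))" "vmap (a, T i) = Inr (Inr (h (i, a)))"
    by (auto simp: vmap_def prod_eq_iff)
qed

lemma inj_vmap: "inj_on vmap (Us 0)"
proof (rule inj_onI)
  fix x y assume x: "x \<in> Us 0" and y: "y \<in> Us 0" and eq: "vmap x = vmap y"
  obtain i where i: "i < s" "x \<in> Us i" "x \<notin> Us (Suc i)" using removed_at[OF x] .
  obtain j where j: "j < s" "y \<in> Us j" "y \<notin> Us (Suc j)" using removed_at[OF y] .
  show "x = y"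
    by (rule removed_cases[OF i]; rule removed_cases[OF j]) (use eq h_inj in auto)
qed

lemma vmap_image: "vmap ` Us 0 = tvars s m"
proof (intro equalityI subsetI)
  fix v assume "v \<in> vmap ` Us 0"
  then obtain x where x: "x \<in> Us 0" "v = vmap x" by auto
  obtain i where i: "i < s" "x \<in> Us i" "x \<notin> Us (Suc i)" using removed_at[OF x(1)] .
  show "v \<in> tvars s m" unfolding x(2)
    by (rule removed_cases[OF i]) (use i(1) h_less in \<open>auto simp: tvars_def\<close>)
next
  fix v assume v: "v \<in> tvars s m"
  have sur: "\<exists>i a. (i, a) \<in> Pairs \<and> h (i, a) = j" if "j < m" for j
  proof -
    have "j \<in> h ` Pairs" using h that by (auto simp: bij_betw_def)
    then show ?thesis by auto
  qed
  consider i where "v = Inl i" "i < s" | j where "v = Inr (Inl j)" "j < m" | j where "v = Inr (Inr j)" "j < m"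
    using v by (auto simp: tvars_def)
  then show "v \<in> vmap ` Us 0"
  proof cases
    case 1
    then show ?thesis using vmap_kap[of i] kap_in_0[of i] by (metis imageI)
  next
    case 2
    then show ?thesis using sur[of j] pair_places Us_antimono[of 0] by (metis imageI le0 subsetD)
  next
    case 3
    then show ?thesis using sur[of j] pair_places Us_antimono[of 0] by (metis imageI le0 subsetD)
  qed
qed

end

section \<open>Generators in the Laurent algebra, built backwards along the diagram\<close>

lemma step_r_in:
  assumes "w \<in> laurent_in W" "X (k, b) \<in> laurent_in W"
    "(k, b) \<in> U \<Longrightarrow> (b, t) \<in> U \<Longrightarrow> p b \<in> laurent_in W"
  shows "step_r U k t X w p b \<in> laurent_in W"
  using assms by (auto simp: step_r_def laurent_in_mult)

lemma step_c_in:
  assumes "X (a, t) \<in> laurent_in W" "(k, a) \<in> U \<Longrightarrow> (a, t) \<in> U \<Longrightarrow> q a \<in> laurent_in W"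
  shows "step_c U k t X q a \<in> laurent_in W"
  using assms by (auto simp: step_c_def)

lemma step_Y_in:
  assumes "w \<in> laurent_in W" "v \<in> laurent_in W" "\<And>\<xi>. X \<xi> \<in> laurent_in W"
    "\<And>b. (k, b) \<in> U \<Longrightarrow> (b, t) \<in> U \<Longrightarrow> p b \<in> laurent_in W \<and> q b \<in> laurent_in W"
  shows "step_Y U k t X w v p q \<xi> \<in> laurent_in W"
proof -
  have r: "step_r U k t X w p b \<in> laurent_in W" for b using assms by (intro step_r_in) auto
  have c: "step_c U k t X q a \<in> laurent_in W" for a using assms by (intro step_c_in) auto
  show ?thesis using assms r c
    by (cases \<xi>) (auto simp: step_Y_def intro!: laurent_in_add laurent_in_diff laurent_in_mult laurent_in_sum)
qed

context diagram
begin

text \<open>The image of the \<open>i\<close>-th pivot is a Laurent monomial \<open>ww e i\<close> with inverse \<open>vv e i\<close>. The exponents \<open>e\<close> are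
  chosen later so that the \<open>z\<^sub>i\<close> are mapped exactly to the variables.\<close>

definition ww :: "(nat \<Rightarrow> nat \<Rightarrow> nat) \<Rightarrow> nat \<Rightarrow> (tvar, int, 'k::field_char_0) mpoly" where
  "ww e i = var (Inl i) * (\<Prod>j<i. zinv j ^ e i j)"
definition vv :: "(nat \<Rightarrow> nat \<Rightarrow> nat) \<Rightarrow> nat \<Rightarrow> (tvar, int, 'k::field_char_0) mpoly" where
  "vv e i = zinv i * (\<Prod>j<i. var (Inl j) ^ e i j)"
definition pp :: "nat \<Rightarrow> nat \<Rightarrow> (tvar, int, 'k::field_char_0) mpoly" where
  "pp i a = var (Inr (Inl (h (i, a))))"
definition qq :: "nat \<Rightarrow> nat \<Rightarrow> (tvar, int, 'k::field_char_0) mpoly" where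
  "qq i a = var (Inr (Inr (h (i, a))))"

text \<open>The argument counts the steps still to come, so the recursion starts after the last
  step, where nothing is unfilled and all generators are 0, and its stage \<open>Suc d\<close>
  undoes step \<open>s - Suc d\<close>.\<close>

primrec Yd :: "(nat \<Rightarrow> nat \<Rightarrow> nat) \<Rightarrow> nat \<Rightarrow> nat \<times> nat \<Rightarrow> (tvar, int, 'k::field_char_0) mpoly" where
  "Yd e 0 = (\<lambda>_. 0)"
| "Yd e (Suc d) = (let i = s - Suc d in
     step_Y (Us i) (K i) (T i) (Yd e d) (ww e i) (vv e i) (pp i) (qq i))"

definition Ys :: "(nat \<Rightarrow> nat \<Rightarrow> nat) \<Rightarrow> nat \<Rightarrow> nat \<times> nat \<Rightarrow> (tvar, int, 'k::field_char_0) mpoly" where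
  "Ys e i = Yd e (s - i)"

lemma Ys_s: "Ys e s = (\<lambda>_. 0)" by (simp add: Ys_def)

lemma Ys_step: "i < s \<Longrightarrow> Ys e i = step_Y (Us i) (K i) (T i) (Ys e (Suc i)) (ww e i) (vv e i) (pp i) (qq i)"
proof -
  assume "i < s"
  then have 1: "s - i = Suc (s - Suc i)" and 2: "s - Suc (s - Suc i) = i" by auto
  show ?thesis unfolding Ys_def 1 Yd.simps Let_def 2 ..
qed

lemma ww_vv: "ww e i * vv e i = 1"
proof -
  have "ww e i * vv e i = (var (Inl i) * zinv i) * (\<Prod>j<i. (zinv j * var (Inl j)) ^ e i j)"
    unfolding ww_def vv_def power_mult_distrib prod.distrib by (simp only: mult_ac)
  then show ?thesis by simp
qed

lemma ww_vv_in: "ww e i \<in> laurent_in (Inl ` {..i})" "vv e i \<in> laurent_in (Inl ` {..i})"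
  unfolding ww_def vv_def
  by (auto intro!: laurent_in_mult laurent_in_var laurent_in_zinv laurent_in_prod laurent_in_power)

lemma target_br_Inl: "x \<in> laurent_in (range Inl) \<Longrightarrow> target_br l x u = 0"
proof -
  assume "x \<in> laurent_in (range Inl)"
  then have "pdL (Inr y) x = 0" for y by (rule pdL_eq_0) auto
  then show ?thesis by (simp add: target_br_def)
qed

text \<open>The bound on the occurring variables belongs to the induction: it shows that the
  canonical pairs introduced at step \<open>i\<close> commute with all generators of later steps, as
  \<open>bracket_step\<close> demands.\<close>

lemma Ys_invariant:
  fixes e :: "nat \<Rightarrow> nat \<Rightarrow> nat" and Y' :: "nat \<Rightarrow> nat \<times> nat \<Rightarrow> (tvar, int, 'k::field_char_0) mpoly"
  defines "Y' \<equiv> Ys e"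
  assumes "i \<le> s"
  shows "(\<forall>\<xi>. \<xi> \<notin> Us i \<longrightarrow> Y' i \<xi> = 0) \<and>
    (\<forall>\<xi> \<eta>. target_br m (Y' i \<xi>) (Y' i \<eta>) = lin_br (Us i) (Y' i) \<xi> \<eta>) \<and>
    (\<forall>\<xi>. Y' i \<xi> \<in> laurent_in (range Inl \<union> vmap ` Us i))"
  using assms(2)
proof (induction rule: inc_induct)
  case base
  show ?case by (simp add: Y'_def Ys_s lin_br_def Us_s target.br_0)
next
  case (step i)
  let ?X = "Y' (Suc i)"
  interpret places_step n M "Us i" "K i" "T i" by (rule step_at[OF step(2)])
  have U': "U' = Us (Suc i)" using step(2) by (simp add: U'_def Us_Suc Us_less_s)
  have pair: "(i, a) \<in> Pairs" if "(K i, a) \<in> Us i" "(a, T i) \<in> Us i" for a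
    using that step(2) by (simp add: Pairs_def)
  \<comment> \<open>By injectivity of \<open>vmap\<close>, the variables of places filled at step
    \<open>i\<close> are absent from all generators built so far.\<close>
  have vm: "vmap \<xi> \<notin> vmap ` Us (Suc i)" if "\<xi> \<in> Us i" "\<xi> \<notin> Us (Suc i)" for \<xi>
    using that inj_vmap Us_antimono[of 0 i] Us_antimono[of 0 "Suc i"] by (auto simp: inj_on_def)
  have X: "?X \<xi> \<in> laurent_in (range Inl \<union> vmap ` Us (Suc i))" for \<xi> using step by blast
  interpret bracket_step n M "Us i" "K i" "T i" "target_br m" ?X "ww e i" "vv e i" "pp i" "qq i"
  proof
    show "?X \<xi> = 0" if "\<xi> \<notin> U'" for \<xi> using step that U' by blast
    show "target_br m (?X \<xi>) (?X \<eta>) = lin_br U' ?X \<xi> \<eta>" for \<xi> \<eta>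
      using step unfolding U' by blast
    show "ww e i * vv e i = 1" by (rule ww_vv)
    show "target_br m (ww e i) u = 0" for u
      by (rule target_br_Inl, rule laurent_in_mono[OF ww_vv_in(1)]) auto
    show "target_br m (pp i a) (pp i b) = 0" for a b
      by (rule target_br_eq_0[of _ "range (Inr \<circ> Inl)" _ "range (Inr \<circ> Inl)"])
        (auto simp: pp_def intro!: laurent_in_var)
    show "target_br m (qq i a) (qq i b) = 0" for a b
      by (rule target_br_eq_0[of _ "range (Inr \<circ> Inr)" _ "range (Inr \<circ> Inr)"])
        (auto simp: qq_def intro!: laurent_in_var)
    show "target_br m (pp i a) (qq i b) = (if a = b then 1 else 0)"
      if "(K i, a) \<in> Us i" "(a, T i) \<in> Us i" "(K i, b) \<in> Us i" "(b, T i) \<in> Us i" for a b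
      using pair[OF that(1,2)] pair[OF that(3,4)] h_inj h_less
      by (auto simp: pp_def qq_def target_br_canonical)
    show "target_br m (pp i a) (?X \<xi>) = 0" if "(K i, a) \<in> Us i" "(a, T i) \<in> Us i" for a \<xi>
    proof (rule target_br_eq_0[OF _ X])
      show "pp i a \<in> laurent_in {Inr (Inl (h (i, a)))}" by (auto simp: pp_def intro: laurent_in_var)
      show "Inr (Inr j) \<notin> range Inl \<union> vmap ` Us (Suc i)" if "Inr (Inl j) \<in> {Inr (Inl (h (i, a)))}" for j
        using that vm[of "(a, T i)"] pair_places[OF pair] \<open>(K i, a) \<in> Us i\<close> \<open>(a, T i) \<in> Us i\<close> by auto
    qed auto
    show "target_br m (qq i a) (?X \<xi>) = 0" if "(K i, a) \<in> Us i" "(a, T i) \<in> Us i" for a \<xi>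
    proof (rule target_br_eq_0[OF _ X])
      show "qq i a \<in> laurent_in {Inr (Inr (h (i, a)))}" by (auto simp: qq_def intro: laurent_in_var)
      show "Inr (Inl j) \<notin> range Inl \<union> vmap ` Us (Suc i)" if "Inr (Inr j) \<in> {Inr (Inr (h (i, a)))}" for j
        using that vm[of "(K i, a)"] pair_places[OF pair] \<open>(K i, a) \<in> Us i\<close> \<open>(a, T i) \<in> Us i\<close> by auto
    qed auto
  qed
  have Y: "Y \<xi> \<in> laurent_in (range Inl \<union> vmap ` Us i)" for \<xi>
  proof (rule step_Y_in)
    show "ww e i \<in> laurent_in (range Inl \<union> vmap ` Us i)" "vv e i \<in> laurent_in (range Inl \<union> vmap ` Us i)"
      by (rule laurent_in_mono[OF ww_vv_in(1)] laurent_in_mono[OF ww_vv_in(2)]; auto)+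
    show "?X \<xi> \<in> laurent_in (range Inl \<union> vmap ` Us i)" for \<xi>
      by (rule laurent_in_mono[OF X]) (use Us_Suc_subset in auto)
    show "pp i b \<in> laurent_in (range Inl \<union> vmap ` Us i) \<and> qq i b \<in> laurent_in (range Inl \<union> vmap ` Us i)"
      if b: "(K i, b) \<in> Us i" "(b, T i) \<in> Us i" for b
      unfolding pp_def qq_def pair_places(5,6)[OF pair[OF b], symmetric]
      using b by (auto intro!: laurent_in_var)
  qed
  have eq: "Y' i = Y" unfolding Y'_def by (rule Ys_step[OF step(2)])
  show ?case unfolding eq using Y_0 brY Y by (intro conjI allI impI)
qed

section \<open>Triangularity with respect to the order on places\<close>

definition above :: "nat \<times> nat \<Rightarrow> tvar set" where
  "above \<xi> = vmap ` {\<eta> \<in> Us 0. succA \<eta> \<xi>}"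
definition atleast :: "nat \<times> nat \<Rightarrow> tvar set" where
  "atleast \<xi> = vmap ` {\<eta> \<in> Us 0. \<eta> = \<xi> \<or> succA \<eta> \<xi>}"

lemma above_subset: "above \<xi> \<subseteq> atleast \<xi>" by (auto simp: above_def atleast_def)
lemma atleast_above: "succA \<eta> \<xi> \<Longrightarrow> atleast \<eta> \<subseteq> above \<xi>"
  unfolding above_def atleast_def by (intro image_mono) (auto intro: succA_trans)
lemma atleast_mono: "\<eta> = \<xi> \<or> succA \<eta> \<xi> \<Longrightarrow> atleast \<eta> \<subseteq> atleast \<xi>"
  using atleast_above above_subset by blast

lemma Inl_atleast: "i < s \<Longrightarrow> Inl ` {..i} \<subseteq> atleast (kap i)"
proof
  fix x :: tvar assume "i < s" "x \<in> Inl ` {..i}"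
  then obtain j where j: "x = Inl j" "j \<le> i" by auto
  then have "kap j \<in> Us 0" "kap j = kap i \<or> succA (kap j) (kap i)" "vmap (kap j) = x"
    using \<open>i < s\<close> kap_in_0[of j] kap_succ[of j i] vmap_kap[of j] by (cases "j = i"; auto)+
  then show "x \<in> atleast (kap i)" unfolding atleast_def by blast
qed

text \<open>In all three cases this is \<open>var (vmap \<xi>)\<close> times an invertible monomial
  in the \<open>z\<close> variables, so a triangular system with these leading terms can be
  solved.\<close>

definition lead :: "(nat \<Rightarrow> nat \<Rightarrow> nat) \<Rightarrow> nat \<times> nat \<Rightarrow> (tvar, int, 'k::field_char_0) mpoly" where
  "lead e \<xi> = (let i = level \<xi> in if \<xi> = kap i then ww e i
     else if fst \<xi> = K i then ww e i * var (vmap \<xi>) else var (vmap \<xi>))"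

lemma lead_in:
  assumes "\<xi> \<in> Us 0"
  shows "(lead e \<xi> :: (tvar, int, 'k::field_char_0) mpoly) \<in> laurent_in (atleast \<xi>)"
proof -
  obtain i where i: "i < s" "\<xi> \<in> Us i" "\<xi> \<notin> Us (Suc i)" using removed_at[OF assms] .
  have "(ww e i :: (tvar, int, 'k) mpoly) \<in> laurent_in (atleast \<xi>)"
    using Inl_atleast[OF i(1)] atleast_mono[of "kap i" \<xi>] kap(2)[OF i(2)]
    by (intro laurent_in_mono[OF ww_vv_in(1)]) blast
  moreover have "(var (vmap \<xi>) :: (tvar, int, 'k) mpoly) \<in> laurent_in (atleast \<xi>)"
    using assms by (intro laurent_in_var) (auto simp: atleast_def)
  ultimately show ?thesis using level_eq[OF i(2,3)] by (auto simp: lead_def laurent_in_mult)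
qed

lemma lead_kap: "i < s \<Longrightarrow> lead e (kap i) = ww e i"
  by (simp add: lead_def level_kap)
lemma lead_row: "(i, a) \<in> Pairs \<Longrightarrow> lead e (K i, a) = ww e i * pp i a"
  and lead_col: "(i, a) \<in> Pairs \<Longrightarrow> lead e (a, T i) = qq i a"
proof -
  assume ia: "(i, a) \<in> Pairs"
  then have i: "i < s" by (simp add: Pairs_def)
  interpret places_step n M "Us i" "K i" "T i" by (rule step_at[OF i])
  note pl = pair_places[OF ia]
  have "a \<noteq> K i" "a \<noteq> T i" using U_less pl by auto
  then show "lead e (K i, a) = ww e i * pp i a" "lead e (a, T i) = qq i a"
    using pl level_eq[OF pl(1,2)] level_eq[OF pl(3,4)] by (auto simp: lead_def pp_def qq_def prod_eq_iff)
qed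

text \<open>Each correction added by \<open>step_Y\<close> uses only greater places: for an inner
  \<open>(a, b)\<close> the factors belong to \<open>(k, b)\<close>, lower in the same column, and
  to \<open>(a, t)\<close>, in an earlier column; for \<open>(a, k)\<close> they belong to columns
  before \<open>k\<close>. The factor \<open>vv e i\<close> belongs to pivots, all greater than the
  place.\<close>

lemma Ys_triangular:
  fixes e :: "nat \<Rightarrow> nat \<Rightarrow> nat"
  assumes "i \<le> s"
  shows "\<forall>\<xi>\<in>Us i. (Ys e i \<xi> - lead e \<xi> :: (tvar, int, 'k::field_char_0) mpoly) \<in> laurent_in (above \<xi>)"
  using assms
proof (induction rule: inc_induct)
  case base
  show ?case by (simp add: Us_s)
next
  case (step i)
  let ?X = "Ys e (Suc i) :: _ \<Rightarrow> (tvar, int, 'k) mpoly"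
  let ?r = "step_r (Us i) (K i) (T i) ?X (ww e i) (pp i)"
  let ?c = "step_c (Us i) (K i) (T i) ?X (qq i)"
  interpret places_step n M "Us i" "K i" "T i" by (rule step_at[OF step(2)])
  have U': "U' = Us (Suc i)" using step(2) by (simp add: U'_def Us_Suc Us_less_s)
  have U0: "Us i \<subseteq> Us 0" by (rule Us_antimono) simp
  have pair: "(i, a) \<in> Pairs" if "(K i, a) \<in> Us i" "(a, T i) \<in> Us i" for a
    using that step(2) by (simp add: Pairs_def)
  have IH: "?X \<xi> - lead e \<xi> \<in> laurent_in (above \<xi>)" if "\<xi> \<in> U'" for \<xi> using that step U' by blast
  have X0: "?X \<xi> = 0" if "\<xi> \<notin> U'" for \<xi> using that step(2) unfolding U'
    by (intro Ys_invariant[THEN conjunct1, rule_format]) auto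
  have X: "?X \<xi> \<in> laurent_in (atleast \<xi>)" for \<xi>
  proof (cases "\<xi> \<in> U'")
    case True
    then have "(lead e \<xi> :: (tvar, int, 'k) mpoly) \<in> laurent_in (atleast \<xi>)" using U'_subset U0 by (intro lead_in) auto
    from laurent_in_add[OF laurent_in_mono[OF IH[OF True] above_subset] this] show ?thesis by simp
  qed (simp add: X0)
  have top: "succA (kap i) \<xi>" if "\<xi> \<in> Us i" "\<xi> \<noteq> kap i" for \<xi> using kap(2) that by blast
  have w: "(ww e i :: (tvar, int, 'k) mpoly) \<in> laurent_in (atleast (kap i))" "(vv e i :: (tvar, int, 'k) mpoly) \<in> laurent_in (atleast (kap i))"
    by (rule laurent_in_mono[OF ww_vv_in(1) Inl_atleast[OF step(2)]]
       laurent_in_mono[OF ww_vv_in(2) Inl_atleast[OF step(2)]])+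
  have r: "?r b \<in> laurent_in (atleast (K i, b))" for b
  proof (cases "(K i, b) \<in> Us i \<and> (b, T i) \<in> Us i")
    case True
    then have "(ww e i :: (tvar, int, 'k) mpoly) \<in> laurent_in (atleast (K i, b))"
      using top[of "(K i, b)"] by (intro laurent_in_mono[OF w(1)] atleast_mono) metis
    moreover have "(pp i b :: (tvar, int, 'k) mpoly) \<in> laurent_in (atleast (K i, b))"
      unfolding pp_def pair_places(5)[OF pair[OF conjunct1[OF True] conjunct2[OF True]], symmetric]
      using True U0 by (intro laurent_in_var) (auto simp: atleast_def)
    ultimately show ?thesis using True by (simp add: step_r_def laurent_in_mult)
  next
    case False
    then show ?thesis using X by (auto simp: step_r_def)
  qed
  have c: "?c a \<in> laurent_in (atleast (a, T i))" for a
  proof (cases "(K i, a) \<in> Us i \<and> (a, T i) \<in> Us i")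
    case True
    have "(qq i a :: (tvar, int, 'k) mpoly) \<in> laurent_in (atleast (a, T i))"
      unfolding qq_def pair_places(6)[OF pair[OF conjunct1[OF True] conjunct2[OF True]], symmetric]
      using True U0 by (intro laurent_in_var) (auto simp: atleast_def)
    then show ?thesis using True by (simp add: step_c_def)
  next
    case False
    then show ?thesis using X by (auto simp: step_c_def)
  qed
  show ?case
  proof
    fix \<xi> assume \<xi>: "\<xi> \<in> Us i"
    obtain a b where ab: "\<xi> = (a, b)" by force
    have tb: "T i \<le> b" using U_le \<xi> ab by auto
    have ba: "b < a" using U_less \<xi> ab by auto
    have \<xi>U: "(a, b) \<in> Us i" using \<xi> ab by simp
    have v: "(vv e i :: (tvar, int, 'k) mpoly) \<in> laurent_in (above (a, b))" if "(a, b) \<noteq> kap i"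
      using top[of "(a, b)"] \<xi> ab that by (intro laurent_in_mono[OF w(2)] atleast_above) auto
    have keq: "(a, b) = kap i \<longleftrightarrow> a = K i \<and> b = T i" by (auto simp: prod_eq_iff)
    consider "(a, b) = kap i" | "a = K i" "b \<noteq> T i" | "a \<noteq> K i" "b = T i" | "a < K i" "b \<noteq> T i"
      | "K i < a" "b \<noteq> T i" "b \<noteq> K i" | "K i < a" "b = K i"
      by (metis linorder_neqE_nat prod.collapse)
    then show "(Ys e i \<xi> - lead e \<xi> :: (tvar, int, 'k) mpoly) \<in> laurent_in (above \<xi>)"
    proof cases
      case 1
      then have "lead e (a, b) = (ww e i :: (tvar, int, 'k) mpoly)"
        using lead_kap[OF step(2)] by simp
      moreover have "K i = a" "T i = b" using 1 by (metis fst_conv, metis snd_conv)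
      then have "Ys e i (a, b) = (ww e i :: (tvar, int, 'k) mpoly)"
        using \<xi> ab step(2) by (simp add: Ys_step step_Y_def)
      ultimately show ?thesis using ab by simp
    next
      case 2
      show ?thesis
      proof (cases "(b, T i) \<in> Us i")
        case True
        moreover have "(K i, b) \<noteq> kap i" using 2 by (metis snd_conv)
        ultimately show ?thesis using 2 \<xi> ab step(2)
          by (simp add: lead_row[OF pair] Ys_step step_Y_def step_r_def)
      next
        case False
        have ne: "(K i, b) \<noteq> kap i" using 2 by (metis snd_conv)
        with False have "\<xi> \<in> U'" using 2 \<xi> ab by (auto simp: U'_iff)
        then show ?thesis using ne IH[of \<xi>] 2 \<xi> ab step(2) False
          by (simp add: Ys_step step_Y_def step_r_def)
      qed
    next
      case 3
      have ne: "(a, T i) \<noteq> kap i" using 3 by (metis fst_conv)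
      show ?thesis
      proof (cases "(K i, a) \<in> Us i")
        case True
        then show ?thesis using ne 3 \<xi> ab step(2)
          by (simp add: lead_col[OF pair] Ys_step step_Y_def step_c_def)
      next
        case False
        then have "\<xi> \<in> U'" using ne 3 \<xi> ab by (auto simp: U'_iff)
        then show ?thesis using ne IH[of \<xi>] 3 \<xi> ab step(2) False
          by (simp add: Ys_step step_Y_def step_c_def)
      qed
    next
      case 4
      then have "\<xi> \<in> U'" using \<xi> ab by (auto simp: U'_iff keq)
      moreover have "?r b \<in> laurent_in (above \<xi>)" "?c a \<in> laurent_in (above \<xi>)"
        using 4 tb ab by (auto intro!: laurent_in_mono[OF r] laurent_in_mono[OF c] atleast_above[THEN subsetD] simp: succA_def)
      ultimately have "(?X \<xi> - lead e \<xi>) + vv e i * (?r b * ?c a) \<in> laurent_in (above \<xi>)"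
        using v keq 4 ab IH by (intro laurent_in_add laurent_in_mult) auto
      then show ?thesis using 4 ab \<xi> step(2) by (auto simp: Ys_step step_Y_def keq algebra_simps)
    next
      case 5
      then have "\<xi> \<in> U'" using \<xi> ab by (auto simp: U'_iff keq)
      then show ?thesis using IH[of \<xi>] 5 ab \<xi> step(2) by (auto simp: Ys_step step_Y_def keq)
    next
      case 6
      then have "(a, b) \<noteq> kap i" unfolding keq by auto
      then have "\<xi> \<in> U'" using 6 \<xi> ab tk by (auto simp: U'_iff)
      have "?X (a, x) * ?c x \<in> laurent_in (above \<xi>)" if "x \<in> {T i<..<K i}" for x
        using 6 that ab tk
        by (intro laurent_in_mult laurent_in_mono[OF X] laurent_in_mono[OF c] atleast_above) (auto simp: succA_def)
      then have "(\<Sum>x\<in>{T i<..<K i}. ?X (a, x) * ?c x) \<in> laurent_in (above \<xi>)"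
        by (rule laurent_in_sum)
      then have "vv e i * (\<Sum>x\<in>{T i<..<K i}. ?X (a, x) * ?c x) \<in> laurent_in (above \<xi>)"
        using v[OF \<open>(a, b) \<noteq> kap i\<close>] ab by (intro laurent_in_mult) auto
      from laurent_in_diff[OF IH[OF \<open>\<xi> \<in> U'\<close>] this]
      have "(?X \<xi> - lead e \<xi>) - vv e i * (\<Sum>x\<in>{T i<..<K i}. ?X (a, x) * ?c x) \<in> laurent_in (above \<xi>)" .
      then show ?thesis using \<open>(a, b) \<noteq> kap i\<close> 6 ab \<xi> step(2) tk by (auto simp: Ys_step step_Y_def keq algebra_simps)
    qed
  qed
qed

lemma Ys_in:
  assumes "\<xi> \<in> Us i" "i \<le> s"
  shows "Ys e i \<xi> \<in> laurent_in (atleast \<xi>)"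
proof -
  have "\<xi> \<in> Us 0" using assms Us_antimono[of 0 i] by auto
  from laurent_in_add[OF laurent_in_mono[OF bspec[OF Ys_triangular[OF assms(2)] assms(1)] above_subset] lead_in[OF this]]
  show ?thesis by (metis diff_add_cancel)
qed

lemma lead_cong:
  assumes "\<xi> \<in> Us 0" "\<And>j. j < s \<Longrightarrow> kap j = \<xi> \<or> succA (kap j) \<xi> \<Longrightarrow> e j = e' j"
  shows "lead e \<xi> = lead e' \<xi>"
proof -
  obtain i where i: "i < s" "\<xi> \<in> Us i" "\<xi> \<notin> Us (Suc i)" using removed_at[OF assms(1)] .
  then have "e i = e' i" using kap(2)[OF i(2)] assms(2) by metis
  then show ?thesis using level_eq[OF i(2,3)] by (simp add: lead_def ww_def)
qed

text \<open>Triangularity in the exponents: beyond its leading term, a generator sees only the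
  exponents of strictly greater pivots. This allows \<open>e i\<close> to be chosen after the
  correction at \<open>kap i\<close> is known, without disturbing earlier choices.\<close>

lemma Ys_cong:
  fixes e e' :: "nat \<Rightarrow> nat \<Rightarrow> nat"
  assumes "i \<le> s"
  shows "\<forall>\<xi>\<in>Us i. (\<forall>j<s. succA (kap j) \<xi> \<longrightarrow> e j = e' j) \<longrightarrow>
    (Ys e i \<xi> - lead e \<xi> :: (tvar, int, 'k::field_char_0) mpoly) = Ys e' i \<xi> - lead e' \<xi>"
  using assms
proof (induction rule: inc_induct)
  case base
  show ?case by (simp add: Us_s)
next
  case (step i)
  let ?X = "\<lambda>e. Ys e (Suc i) :: _ \<Rightarrow> (tvar, int, 'k) mpoly"
  let ?r = "\<lambda>e. step_r (Us i) (K i) (T i) (?X e) (ww e i) (pp i)"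
  let ?c = "\<lambda>e. step_c (Us i) (K i) (T i) (?X e) (qq i)"
  interpret places_step n M "Us i" "K i" "T i" by (rule step_at[OF step(2)])
  have U': "U' = Us (Suc i)" using step(2) by (simp add: U'_def Us_Suc Us_less_s)
  have U0: "Us i \<subseteq> Us 0" by (rule Us_antimono) simp
  have pair: "(i, a) \<in> Pairs" if "(K i, a) \<in> Us i" "(a, T i) \<in> Us i" for a
    using that step(2) by (simp add: Pairs_def)
  have IH: "?X e \<xi> - lead e \<xi> = ?X e' \<xi> - lead e' \<xi>" if "\<xi> \<in> U'" "\<And>j. j < s \<Longrightarrow> succA (kap j) \<xi> \<Longrightarrow> e j = e' j" for \<xi>
    using that step U' by blast
  have X0: "?X e \<xi> = 0" if "\<xi> \<notin> U'" for \<xi> e using that step(2) unfolding U'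
    by (intro Ys_invariant[THEN conjunct1, rule_format]) auto
  have X: "?X e \<xi> = ?X e' \<xi>" if "\<And>j. j < s \<Longrightarrow> kap j = \<xi> \<or> succA (kap j) \<xi> \<Longrightarrow> e j = e' j" for \<xi>
  proof (cases "\<xi> \<in> U'")
    case True
    have "?X e \<xi> - lead e \<xi> = ?X e' \<xi> - lead e' \<xi>" using that by (intro IH[OF True]) auto
    moreover have "lead e \<xi> = (lead e' \<xi> :: (tvar, int, 'k) mpoly)"
      using True U'_subset U0 that by (intro lead_cong) auto
    ultimately show ?thesis by simp
  qed (simp add: X0)
  show ?case
  proof (intro ballI impI)
    fix \<xi> assume \<xi>: "\<xi> \<in> Us i" and ag: "\<forall>j<s. succA (kap j) \<xi> \<longrightarrow> e j = e' j"
    obtain a b where ab: "\<xi> = (a, b)" by force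
    have tb: "T i \<le> b" using U_le \<xi> ab by auto
    have ba: "b < a" using U_less \<xi> ab by auto
    have e: "e i = e' i" if "\<xi> \<noteq> kap i" using ag kap(2)[OF \<xi> that] step(2) by auto
    then have w: "ww e i = (ww e' i :: (tvar, int, 'k) mpoly)" "vv e i = (vv e' i :: (tvar, int, 'k) mpoly)" if "\<xi> \<noteq> kap i"
      using that by (auto simp: ww_def vv_def)
    have up: "e j = e' j" if "succA \<eta> \<xi>" "j < s" "kap j = \<eta> \<or> succA (kap j) \<eta>" for \<eta> j
      using that ag succA_trans by blast
    have Xs: "?X e \<eta> = ?X e' \<eta>" if "succA \<eta> \<xi>" for \<eta>
      using up[OF that] by (intro X)
    have r: "?r e b = ?r e' b" if "a < K i"
    proof -
      have "?X e (K i, b) = ?X e' (K i, b)" using that ab by (intro Xs) (simp add: succA_def)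
      moreover have "\<xi> \<noteq> kap i" using that ab by (auto simp: prod_eq_iff)
      ultimately show ?thesis using w by (simp add: step_r_def)
    qed
    have c: "?c e x = ?c e' x" if "T i < b" for x
    proof -
      have "?X e (x, T i) = ?X e' (x, T i)" using that ab by (intro Xs) (simp add: succA_def)
      then show ?thesis by (simp add: step_c_def)
    qed
    have keq: "(a, b) = kap i \<longleftrightarrow> a = K i \<and> b = T i" by (auto simp: prod_eq_iff)
    consider "(a, b) = kap i" | "a = K i" "b \<noteq> T i" | "a \<noteq> K i" "b = T i" | "a < K i" "b \<noteq> T i"
      | "K i < a" "b \<noteq> T i" "b \<noteq> K i" | "K i < a" "b = K i"
      by (metis linorder_neqE_nat prod.collapse)
    then show "Ys e i \<xi> - lead e \<xi> = (Ys e' i \<xi> - lead e' \<xi> :: (tvar, int, 'k) mpoly)"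
    proof cases
      case 1
      then have "lead e (a, b) = (ww e i :: (tvar, int, 'k) mpoly)" for e
        using lead_kap[OF step(2)] by simp
      moreover have "K i = a" "T i = b" using 1 by (metis fst_conv, metis snd_conv)
      then have "Ys e i (a, b) = (ww e i :: (tvar, int, 'k) mpoly)" for e
        using \<xi> ab step(2) by (simp add: Ys_step step_Y_def)
      ultimately show ?thesis using ab by simp
    next
      case 2
      show ?thesis
      proof (cases "(b, T i) \<in> Us i")
        case True
        moreover have "(K i, b) \<noteq> kap i" using 2 by (metis snd_conv)
        ultimately show ?thesis using 2 \<xi> ab step(2)
          by (simp add: lead_row[OF pair] Ys_step step_Y_def step_r_def)
      next
        case False
        have ne: "(K i, b) \<noteq> kap i" using 2 by (metis snd_conv)
        with False have "\<xi> \<in> U'" using 2 \<xi> ab by (auto simp: U'_iff)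
        then show ?thesis using ne IH[of \<xi>] ag 2 \<xi> ab step(2) False
          by (simp add: Ys_step step_Y_def step_r_def)
      qed
    next
      case 3
      have ne: "(a, T i) \<noteq> kap i" using 3 by (metis fst_conv)
      show ?thesis
      proof (cases "(K i, a) \<in> Us i")
        case True
        then show ?thesis using ne 3 \<xi> ab step(2)
          by (simp add: lead_col[OF pair] Ys_step step_Y_def step_c_def)
      next
        case False
        then have "\<xi> \<in> U'" using ne 3 \<xi> ab by (auto simp: U'_iff)
        then show ?thesis using ne IH[of \<xi>] ag 3 \<xi> ab step(2) False
          by (simp add: Ys_step step_Y_def step_c_def)
      qed
    next
      case 4
      then have "\<xi> \<in> U'" using \<xi> ab by (auto simp: U'_iff keq)
      moreover have "\<xi> \<noteq> kap i" using 4 unfolding ab keq by auto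
      moreover have "T i < b" using 4 tb by simp
      ultimately show ?thesis using IH[of \<xi>] ag r c[of a] w 4 ab \<xi> step(2)
        by (auto simp: Ys_step step_Y_def keq add_diff_eq diff_add_eq)
    next
      case 5
      then have "\<xi> \<in> U'" using \<xi> ab by (auto simp: U'_iff keq)
      then show ?thesis using IH[of \<xi>] ag 5 ab \<xi> step(2) by (auto simp: Ys_step step_Y_def keq)
    next
      case 6
      then have "(a, b) \<noteq> kap i" unfolding keq by auto
      then have "\<xi> \<in> U'" using 6 \<xi> ab tk by (auto simp: U'_iff)
      moreover have "\<xi> \<noteq> kap i" using 6 unfolding ab keq by auto
      moreover have "(\<Sum>x\<in>{T i<..<K i}. ?X e (a, x) * ?c e x) = (\<Sum>x\<in>{T i<..<K i}. ?X e' (a, x) * ?c e' x)"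
      proof (intro sum.cong refl)
        fix x assume "x \<in> {T i<..<K i}"
        then have "?X e (a, x) = ?X e' (a, x)" using 6 ab by (intro Xs) (simp add: succA_def)
        then show "?X e (a, x) * ?c e x = ?X e' (a, x) * ?c e' x" using c[of x] 6 tk by simp
      qed
      ultimately show ?thesis using IH[of \<xi>] ag w 6 ab \<xi> step(2) tk
        by (auto simp: Ys_step step_Y_def keq algebra_simps)
    qed
  qed
qed

end

section \<open>Triangular evaluations have no kernel\<close>

definition mdeg :: "('v \<Rightarrow>\<^sub>0 nat) \<Rightarrow> nat" where
  "mdeg mo = (\<Sum>v\<in>Poly_Mapping.keys mo. Poly_Mapping.lookup mo v)"

lemma mdeg_add: "mdeg (k + l) = mdeg k + mdeg l"
  unfolding mdeg_def by (rule sum_keys_add) auto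
lemma mdeg_single: "mdeg (Poly_Mapping.single v e) = e"
  by (simp add: mdeg_def)

text \<open>The kernel is closed under the derivative in its smallest variable.\<close>

lemma triangular_kernel:
  fixes Y :: "nat \<times> nat \<Rightarrow> (tvar, int, 'k::field_char_0) mpoly" and p :: "(nat \<times> nat, nat, 'k) mpoly"
  assumes V: "finite V"
    and unit: "\<And>\<xi>. \<xi> \<in> V \<Longrightarrow> \<exists>u. pdL (f \<xi>) (Y \<xi>) * u = 1"
    and zero: "\<And>\<xi> \<eta>. \<xi> \<in> V \<Longrightarrow> \<eta> \<in> V \<Longrightarrow> succA \<eta> \<xi> \<Longrightarrow> pdL (f \<xi>) (Y \<eta>) = 0"
    and p: "vars_in p V" "evalm const Y p = 0"
  shows "p = 0"
proof -
  have "p = 0" if "\<forall>mo\<in>Poly_Mapping.keys p. mdeg mo \<le> N" "vars_in p V" "evalm const Y p = 0" for p N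
    using that
  proof (induction N arbitrary: p rule: less_induct)
    case (less N)
    define W where "W = (\<Union>mo\<in>Poly_Mapping.keys p. Poly_Mapping.keys mo)"
    have W: "finite W" "W \<subseteq> V" using less.prems(2) by (auto simp: W_def vars_in_def)
    show ?case
    proof (cases "W = {}")
      case True
      then have "Poly_Mapping.keys p \<subseteq> {0}" by (auto simp: W_def)
      then have "p = const (Poly_Mapping.lookup p 0)"
        by (intro poly_mapping_eqI) (auto simp: const_def lookup_single when_def in_keys_iff)
      moreover have "const (Poly_Mapping.lookup p 0) = (0 :: (tvar, int, 'k) mpoly)"
        using less.prems(3) const.evalm_const[of Y "Poly_Mapping.lookup p 0"] calculation by metis
      then have "Poly_Mapping.lookup p 0 = 0"
        unfolding const_def by (metis lookup_single_eq lookup_zero)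
      ultimately show ?thesis by simp
    next
      case False
      \<comment> \<open>The smallest place occurring in \<open>p\<close>; its variable
        \<open>f \<xi>\<close> is absent from the generators of all other places of
        \<open>p\<close>.\<close>
      have "\<exists>\<xi>\<in>W. \<forall>\<eta>\<in>W. \<eta> \<noteq> \<xi> \<longrightarrow> succA \<eta> \<xi>"
        by (rule ex_dominating[OF W(1) False]) (use succA_trans succA_total in blast)+
      then obtain \<xi> where \<xi>: "\<xi> \<in> W" "\<And>\<eta>. \<eta> \<in> W \<Longrightarrow> \<eta> \<noteq> \<xi> \<Longrightarrow> succA \<eta> \<xi>" by blast
      have pW: "vars_in p W" by (auto simp: vars_in_def W_def)
      obtain u where u: "pdL (f \<xi>) (Y \<xi>) * u = 1" using unit \<xi>(1) W(2) by blast
      have "0 = pdL (f \<xi>) (evalm const Y p)" using less.prems(3) by simp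
      also have "\<dots> = (\<Sum>v\<in>W. evalm const Y (pd v p) * pdL (f \<xi>) (Y v))"
        by (rule const.chain_rule) (auto simp: pdL_add pdL_mult W(1) pW)
      \<comment> \<open>Only the summand for \<open>\<xi>\<close> survives, and its second factor is
        a unit, so \<open>pd \<xi> p\<close> lies in the kernel and has smaller degree.\<close>
      also have "\<dots> = (\<Sum>v\<in>W. if v = \<xi> then evalm const Y (pd \<xi> p) * pdL (f \<xi>) (Y \<xi>) else 0)"
      proof (intro sum.cong refl)
        fix v assume v: "v \<in> W"
        show "evalm const Y (pd v p) * pdL (f \<xi>) (Y v) = (if v = \<xi> then evalm const Y (pd \<xi> p) * pdL (f \<xi>) (Y \<xi>) else 0)"
        proof (cases "v = \<xi>")
          case False
          have "\<xi> \<in> V" "v \<in> V" using v \<xi>(1) W(2) by auto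
          from zero[OF this \<xi>(2)[OF v False]] False show ?thesis by simp
        qed simp
      qed
      also have "\<dots> = evalm const Y (pd \<xi> p) * pdL (f \<xi>) (Y \<xi>)"
        using W(1) \<xi>(1) by simp
      finally have "evalm const Y (pd \<xi> p) * (pdL (f \<xi>) (Y \<xi>) * u) = 0"
        by (simp add: mult.assoc[symmetric])
      then have ev0: "evalm const Y (pd \<xi> p) = 0" using u by simp
      have deg: "Suc (mdeg mo) \<le> N" if "mo \<in> Poly_Mapping.keys (pd \<xi> p)" for mo
      proof -
        have "mo + Poly_Mapping.single \<xi> 1 \<in> Poly_Mapping.keys p"
          using that by (auto simp: in_keys_iff lookup_pd)
        then show ?thesis using less.prems(1) by (fastforce simp: mdeg_add mdeg_single)
      qed
      have "pd \<xi> p = 0"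
      proof (cases "N = 0")
        case True
        then have "Poly_Mapping.keys (pd \<xi> p) = {}" using deg by fastforce
        then show ?thesis by simp
      next
        case False
        then show ?thesis using deg vars_in_pd[OF less.prems(2)] ev0
          by (intro less.IH[of "N - 1"]) fastforce+
      qed
      \<comment> \<open>The derivative vanishes by induction although \<open>\<xi>\<close> occurs in
        \<open>p\<close>: impossible in characteristic zero.\<close>
      then have "vars_in p (- {\<xi>})" by (rule pd_eq_0_imp_vars_in)
      then have False using \<xi>(1) by (auto simp: W_def vars_in_def)
      then show ?thesis ..
    qed
  qed
  then show ?thesis using p by (metis Max_ge finite_imageI finite_keys image_eqI)
qed

section \<open>The Poisson homomorphism \<open>phi\<close>\<close>

context diagram
begin

definition phi :: "(nat \<Rightarrow> nat \<Rightarrow> nat) \<Rightarrow> (nat \<times> nat, nat, 'k::field_char_0) mpoly \<Rightarrow> (tvar, int, 'k) mpoly" where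
  "phi e = evalm const (Ys e 0)"

lemma phi_add: "phi e (p + q) = phi e p + phi e q"
  and phi_mult: "phi e (p * q) = phi e p * phi e q"
  and phi_diff: "phi e (p - q) = phi e p - phi e q"
  and phi_const [simp]: "phi e (const c) = const c"
  and phi_1 [simp]: "phi e 1 = 1"
  and phi_0 [simp]: "phi e 0 = 0"
  and phi_var [simp]: "phi e (var \<xi>) = Ys e 0 \<xi>"
  and phi_prod: "phi e (\<Prod>x\<in>A. g x) = (\<Prod>x\<in>A. phi e (g x))"
  and phi_power: "phi e (p ^ k) = phi e p ^ k"
  by (simp_all add: phi_def const.evalm_add const.evalm_mult const.evalm_diff const.evalm_prod const.evalm_power)

lemma Ys_0: "\<xi> \<notin> A_set n - M \<Longrightarrow> Ys e 0 \<xi> = 0"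
  using Ys_invariant[of 0 e] unfolding Us_0 by blast

lemma phi_yv: "phi e (yv M \<xi>) = Ys e 0 \<xi>"
  by (simp add: yv_def Ys_0)

lemma phi_pbr:
  assumes "f \<in> KL n M" "g \<in> KL n M"
  shows "phi e (pbr n M f g) = target_br m (phi e f) (phi e g)"
  unfolding phi_def
proof (rule target.evalm_pbr[OF const.scalar_hom_axioms])
  show "target_br m (const a) u = 0" for a :: 'a and u by (rule target_br_Inl) simp
  fix \<xi> \<eta> assume *: "\<xi> \<in> A_set n - M" "\<eta> \<in> A_set n - M"
  have "target_br m (Ys e 0 \<xi>) (Ys e 0 \<eta>) = lin_br (Us 0) (Ys e 0) \<xi> \<eta>"
    using Ys_invariant[of 0 e] by blast
  also have "\<dots> = phi e (lie_br M \<xi> \<eta>)"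
    using * by (cases \<xi>; cases \<eta>) (simp add: lin_br_def lie_br_def Us_0 phi_diff phi_yv)
  finally show "target_br m (Ys e 0 \<xi>) (Ys e 0 \<eta>) = evalm const (Ys e 0) (lie_br M \<xi> \<eta>)"
    by (simp add: phi_def)
qed (use assms in auto)

lemma phi_in:
  assumes "vars_in p V" "V \<subseteq> Us 0"
  shows "phi e p \<in> laurent_in (\<Union>\<xi>\<in>V. atleast \<xi>)"
  using assms(1)
proof (induction p rule: vars_in_induct)
  case (var \<xi>)
  then show ?case using assms(2) by (auto intro: laurent_in_mono[OF Ys_in])
qed (auto simp: phi_add phi_mult laurent_in_add laurent_in_mult)

lemma phi_target: "p \<in> KL n M \<Longrightarrow> phi e p \<in> target s m"
  unfolding target_eq_laurent_in vmap_image[symmetric]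
  by (rule laurent_in_mono[OF phi_in[of p "Us 0"]]) (auto simp: KL_def Us_0 atleast_def)

text \<open>By triangularity the derivative of a generator in its own variable is that of its
  leading term: a monomial in inverses of earlier \<open>z\<close> variables for a pivot,
  \<open>ww e i\<close> for a minus, 1 for a plus. All are units, so
  \<open>triangular_kernel\<close> applies.\<close>

lemma inj_phi: "inj_on (phi e) (KL n M)"
proof (rule inj_onI)
  fix x y :: "(nat \<times> nat, nat, 'k::field_char_0) mpoly"
  assume xy: "x \<in> KL n M" "y \<in> KL n M" "phi e x = phi e y"
  have above_notin: "vmap \<xi> \<notin> above \<xi>" if "\<xi> \<in> Us 0" for \<xi>
    using inj_vmap that succA_irrefl by (auto simp: above_def inj_on_def)
  have "x - y = 0"
  proof (rule triangular_kernel)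
    show "finite (Us 0)" by simp
    show "vars_in (x - y) (Us 0)" using xy by (simp add: KL_def Us_0 vars_in_diff)
    show "evalm const (Ys e 0) (x - y) = 0" using xy(3) by (simp add: phi_def const.evalm_diff)
    fix \<xi> assume \<xi>: "\<xi> \<in> Us 0"
    show "pdL (vmap \<xi>) (Ys e 0 \<eta> :: (tvar, int, 'k) mpoly) = 0" if "\<eta> \<in> Us 0" "succA \<eta> \<xi>" for \<eta>
      using above_notin[OF \<xi>] atleast_above[OF that(2)] by (intro pdL_eq_0[OF Ys_in[OF that(1)]]) auto
    obtain i where i: "i < s" "\<xi> \<in> Us i" "\<xi> \<notin> Us (Suc i)" using removed_at[OF \<xi>] .
    have "pdL (vmap \<xi>) (Ys e 0 \<xi> - lead e \<xi> :: (tvar, int, 'k) mpoly) = 0"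
      using above_notin[OF \<xi>] by (intro pdL_eq_0[OF bspec[OF Ys_triangular \<xi>]]) auto
    then have eq: "pdL (vmap \<xi>) (Ys e 0 \<xi>) = pdL (vmap \<xi>) (lead e \<xi> :: (tvar, int, 'k) mpoly)"
      by (simp add: pdL_diff)
    have w0: "pdL (Inr x) (ww e i :: (tvar, int, 'k) mpoly) = 0" for x
      by (rule pdL_eq_0[OF ww_vv_in(1)]) auto
    show "\<exists>u. pdL (vmap \<xi>) (Ys e 0 \<xi> :: (tvar, int, 'k) mpoly) * u = 1"
    proof (rule removed_cases[OF i])
      assume k: "\<xi> = kap i" "vmap \<xi> = Inl i"
      have "pdL (Inl i) (\<Prod>j<i. zinv j ^ e i j :: (tvar, int, 'k) mpoly) = 0"
        by (rule pdL_eq_0[of _ "Inl ` {..<i}"]) (auto intro!: laurent_in_prod laurent_in_power laurent_in_zinv)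
      then have "pdL (vmap \<xi>) (lead e \<xi> :: (tvar, int, 'k) mpoly) = (\<Prod>j<i. zinv j ^ e i j)"
        using k by (simp add: lead_kap[OF i(1)] ww_def pdL_mult pdL_var)
      moreover have "(\<Prod>j<i. zinv j ^ e i j) * (\<Prod>j<i. var (Inl j) ^ e i j :: (tvar, int, 'k) mpoly) = 1"
        by (simp add: prod.distrib[symmetric] power_mult_distrib[symmetric])
      ultimately show ?thesis unfolding eq by (intro exI) simp
    next
      fix a assume "\<xi> = (K i, a)" "(i, a) \<in> Pairs" "vmap \<xi> = Inr (Inl (h (i, a)))"
      then have "pdL (vmap \<xi>) (lead e \<xi> :: (tvar, int, 'k) mpoly) = ww e i"
        by (simp add: lead_row pp_def pdL_mult pdL_var w0)
      then show ?thesis unfolding eq using ww_vv by (intro exI) simp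
    next
      fix a assume "\<xi> = (a, T i)" "(i, a) \<in> Pairs" "vmap \<xi> = Inr (Inr (h (i, a)))"
      then have "pdL (vmap \<xi>) (lead e \<xi> :: (tvar, int, 'k) mpoly) = 1"
        by (simp add: lead_col qq_def pdL_var)
      then show ?thesis unfolding eq by (intro exI[of _ 1]) simp
    qed
  qed
  then show "x = y" by simp
qed

section \<open>Clearing denominators\<close>

definition upper :: "nat \<times> nat \<Rightarrow> (nat \<times> nat) set" where
  "upper \<xi> = {\<eta> \<in> Us 0. \<eta> = \<xi> \<or> succA \<eta> \<xi>}"

definition up_set :: "(nat \<times> nat) set \<Rightarrow> bool" where
  "up_set D \<longleftrightarrow> D \<subseteq> Us 0 \<and> (\<forall>\<xi>\<in>D. upper \<xi> \<subseteq> D)"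

definition good_z :: "(nat \<Rightarrow> nat \<Rightarrow> nat) \<Rightarrow> (nat \<Rightarrow> (nat \<times> nat, nat, 'k::field_char_0) mpoly) \<Rightarrow> nat \<Rightarrow> bool" where
  "good_z e z j \<longleftrightarrow> phi e (z j) = var (Inl j) \<and> vars_in (z j) (upper (kap j))"

text \<open>The image of the polynomials in \<open>D\<close> with denominators allowed. Only pivots
  inside \<open>D\<close> may occur in a denominator, so that clearing it never leaves the variables
  of \<open>D\<close>.\<close>

definition cleared :: "(nat \<Rightarrow> nat \<Rightarrow> nat) \<Rightarrow> (nat \<times> nat) set \<Rightarrow> (tvar, int, 'k::field_char_0) mpoly set" where
  "cleared e D = {b. \<exists>\<alpha> p. vars_in p D \<and> b * (\<Prod>j\<in>{j. j < s \<and> kap j \<in> D}. var (Inl j) ^ \<alpha> j) = phi e p}"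

lemma finite_J [simp]: "finite {j. j < s \<and> kap j \<in> D}"
  by (rule finite_subset[of _ "{..<s}"]) auto

lemma up_set_upper: "up_set (upper \<xi>)"
  unfolding up_set_def upper_def by (blast intro: succA_trans)

lemma upper_mono: "up_set D \<Longrightarrow> \<xi> \<in> D \<Longrightarrow> upper \<xi> \<subseteq> D"
  by (auto simp: up_set_def)

lemma cleared_mono:
  assumes "b \<in> cleared e D" "D \<subseteq> D'"
  shows "b \<in> cleared e D'"
proof -
  let ?J = "{j. j < s \<and> kap j \<in> D}" and ?J' = "{j. j < s \<and> kap j \<in> D'}"
  obtain \<alpha> p where *: "vars_in p D" "b * (\<Prod>j\<in>?J. var (Inl j) ^ \<alpha> j) = phi e p"
    using assms(1) by (auto simp: cleared_def)
  have "(\<Prod>j\<in>?J'. var (Inl j) ^ (if j \<in> ?J then \<alpha> j else 0)) = (\<Prod>j\<in>?J. var (Inl j) ^ \<alpha> j :: (tvar, int, 'a) mpoly)"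
    using assms(2) by (intro prod.mono_neutral_cong_right) auto
  then have "b * (\<Prod>j\<in>?J'. var (Inl j) ^ (if j \<in> ?J then \<alpha> j else 0)) = phi e p" using *(2) by simp
  then show ?thesis unfolding cleared_def using vars_in_mono[OF *(1) assms(2)]
    by (intro CollectI exI[of _ "\<lambda>j. if j \<in> ?J then \<alpha> j else 0"] exI[of _ p]) simp
qed

lemma cleared_phi: "vars_in p D \<Longrightarrow> phi e p \<in> cleared e D"
  unfolding cleared_def by (auto intro!: exI[of _ "\<lambda>_. 0"] exI[of _ p])

lemma cleared_mult:
  assumes "b \<in> cleared e D" "b' \<in> cleared e D"
  shows "b * b' \<in> cleared e D"
proof -
  let ?J = "{j. j < s \<and> kap j \<in> D}"
  obtain \<alpha> p where 1: "vars_in p D" "b * (\<Prod>j\<in>?J. var (Inl j) ^ \<alpha> j) = phi e p"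
    using assms(1) by (auto simp: cleared_def)
  obtain \<alpha>' p' where 2: "vars_in p' D" "b' * (\<Prod>j\<in>?J. var (Inl j) ^ \<alpha>' j) = phi e p'"
    using assms(2) by (auto simp: cleared_def)
  have "b * b' * (\<Prod>j\<in>?J. var (Inl j) ^ (\<alpha> j + \<alpha>' j)) = phi e (p * p')"
    unfolding phi_mult 1(2)[symmetric] 2(2)[symmetric] power_add prod.distrib by (simp only: mult_ac)
  then show ?thesis using vars_in_mult[OF 1(1) 2(1)]
    unfolding cleared_def by (intro CollectI exI[of _ "\<lambda>j. \<alpha> j + \<alpha>' j"] exI[of _ "p * p'"]) simp
qed

text \<open>Passing to a common denominator multiplies each numerator by powers of \<open>z\<close>
  variables; these need preimages in the variables of \<open>D\<close>, which \<open>good_z\<close>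
  and \<open>up_set D\<close> supply.\<close>

lemma cleared_add:
  fixes z :: "nat \<Rightarrow> (nat \<times> nat, nat, 'k::field_char_0) mpoly" and b :: "(tvar, int, 'k) mpoly"
  assumes "b \<in> cleared e D" "b' \<in> cleared e D" and D: "up_set D"
    and z: "\<And>j. j < s \<Longrightarrow> kap j \<in> D \<Longrightarrow> good_z e z j"
  shows "b + b' \<in> cleared e D"
proof -
  let ?J = "{j. j < s \<and> kap j \<in> D}"
  obtain \<alpha> p where 1: "vars_in p D" "b * (\<Prod>j\<in>?J. var (Inl j) ^ \<alpha> j) = phi e p"
    using assms(1) by (auto simp: cleared_def)
  obtain \<alpha>' p' where 2: "vars_in p' D" "b' * (\<Prod>j\<in>?J. var (Inl j) ^ \<alpha>' j) = phi e p'"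
    using assms(2) by (auto simp: cleared_def)
  define Z where "Z = (\<lambda>\<alpha>. \<Prod>j\<in>?J. z j ^ \<alpha> j)"
  have phiZ: "phi e (Z \<alpha>) = (\<Prod>j\<in>?J. var (Inl j) ^ \<alpha> j)" for \<alpha>
    unfolding Z_def phi_prod phi_power using z by (intro prod.cong refl) (auto simp: good_z_def)
  have varsZ: "vars_in (Z \<alpha>) D" for \<alpha>
    unfolding Z_def
  proof (intro vars_in_prod vars_in_power)
    fix j assume "j \<in> ?J"
    then have j: "j < s" "kap j \<in> D" by auto
    then have "vars_in (z j) (upper (kap j))" using z[of j] by (simp add: good_z_def)
    then show "vars_in (z j) D" by (rule vars_in_mono) (rule upper_mono[OF D j(2)])
  qed
  have "(b + b') * (\<Prod>j\<in>?J. var (Inl j) ^ (\<alpha> j + \<alpha>' j)) = phi e (p * Z \<alpha>' + p' * Z \<alpha>)"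
    unfolding phi_mult phi_add phiZ 1(2)[symmetric] 2(2)[symmetric] power_add prod.distrib
    by (simp only: distrib_right mult_ac)
  moreover have "vars_in (p * Z \<alpha>' + p' * Z \<alpha>) D"
    using 1(1) 2(1) varsZ by (intro vars_in_add vars_in_mult)
  ultimately show ?thesis
    unfolding cleared_def by (intro CollectI exI[of _ "\<lambda>j. \<alpha> j + \<alpha>' j"] exI[of _ "p * Z \<alpha>' + p' * Z \<alpha>"]) simp
qed

lemma cleared_zinv: "j < s \<Longrightarrow> kap j \<in> D \<Longrightarrow> zinv j \<in> cleared e D"
proof -
  assume j: "j < s" "kap j \<in> D"
  have "(\<Prod>l\<in>{l. l < s \<and> kap l \<in> D}. var (Inl l) ^ (if l = j then 1 else 0)) = (\<Prod>l\<in>{l. l < s \<and> kap l \<in> D}. if l = j then var (Inl l) else (1 :: (tvar, int, 'a) mpoly))"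
    by (intro prod.cong) auto
  also have "\<dots> = var (Inl j)" using j by (simp add: prod.delta)
  finally show ?thesis unfolding cleared_def
    by (intro CollectI exI[of _ "\<lambda>l. if l = j then 1 else 0"] exI[of _ 1]) simp
qed

lemma laurent_in_cleared:
  fixes z :: "nat \<Rightarrow> (nat \<times> nat, nat, 'k::field_char_0) mpoly" and b :: "(tvar, int, 'k) mpoly"
  assumes D: "up_set D" and z: "\<And>j. j < s \<Longrightarrow> kap j \<in> D \<Longrightarrow> good_z e z j"
    and var: "\<And>\<xi>. \<xi> \<in> D' \<Longrightarrow> (var (vmap \<xi>) :: (tvar, int, 'k) mpoly) \<in> cleared e D" and D': "D' \<subseteq> D"
    and b: "b \<in> laurent_in (vmap ` D')"
  shows "b \<in> cleared e D"
  using b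
proof (induction rule: laurent_in_induct)
  case (const c)
  show ?case using cleared_phi[of "const c" D e] by simp
next
  case (var v)
  then show ?case using assms(3) by auto
next
  case (zinv i)
  then obtain \<xi> where \<xi>: "\<xi> \<in> D'" "vmap \<xi> = Inl i" by auto
  have "\<xi> \<in> Us 0" using \<xi> D D' by (auto simp: up_set_def)
  then obtain l where l: "l < s" "\<xi> \<in> Us l" "\<xi> \<notin> Us (Suc l)" using removed_at by blast
  have "\<xi> = kap i \<and> i < s" using \<xi>(2) l(1) by (rule_tac removed_cases[OF l]) auto
  then show ?case using cleared_zinv[of i D] \<xi> D' by auto
qed (auto intro: cleared_add[OF _ _ D z] cleared_mult)

text \<open>Solves the triangular system for one variable: the correction involves only greater
  places and is cleared by induction, the generator itself is an image, and their difference is the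
  leading term. Multiplying by \<open>vv e i\<close> then frees the variable of a minus; that of a
  pivot is the image of \<open>z i\<close>.\<close>

lemma var_cleared:
  fixes z :: "nat \<Rightarrow> (nat \<times> nat, nat, 'k::field_char_0) mpoly"
  assumes z: "\<And>j. j < s \<Longrightarrow> kap j \<in> upper \<xi> \<Longrightarrow> good_z e z j" and "\<xi> \<in> Us 0"
  shows "(var (vmap \<xi>) :: (tvar, int, 'k) mpoly) \<in> cleared e (upper \<xi>)"
  using assms
proof (induction "card {\<eta> \<in> Us 0. succA \<eta> \<xi>}" arbitrary: \<xi> rule: less_induct)
  case less
  let ?C = "cleared e (upper \<xi>) :: (tvar, int, 'k) mpoly set"
  note D = up_set_upper[of \<xi>]
  have mem: "\<xi> \<in> upper \<xi>" using less.prems by (simp add: upper_def)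
  have IH: "var (vmap \<eta>) \<in> ?C" if \<eta>: "\<eta> \<in> Us 0" "succA \<eta> \<xi>" for \<eta>
  proof -
    have sub: "upper \<eta> \<subseteq> upper \<xi>" using \<eta> D by (intro upper_mono) (auto simp: upper_def)
    have "{\<zeta> \<in> Us 0. succA \<zeta> \<eta>} \<subset> {\<zeta> \<in> Us 0. succA \<zeta> \<xi>}"
      using \<eta> succA_trans succA_irrefl by blast
    then have "card {\<zeta> \<in> Us 0. succA \<zeta> \<eta>} < card {\<zeta> \<in> Us 0. succA \<zeta> \<xi>}"
      by (intro psubset_card_mono) auto
    from less.hyps[OF this] have "(var (vmap \<eta>) :: (tvar, int, 'k) mpoly) \<in> cleared e (upper \<eta>)"
      using less.prems(1) sub \<eta> by blast
    then show ?thesis using sub by (rule cleared_mono)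
  qed
  let ?Y = "Ys e 0 \<xi> :: (tvar, int, 'k) mpoly"
  have "?Y - lead e \<xi> \<in> ?C"
  proof (rule laurent_in_cleared[OF D less.prems(1)])
    show "?Y - lead e \<xi> \<in> laurent_in (vmap ` {\<eta> \<in> Us 0. succA \<eta> \<xi>})"
      using bspec[OF Ys_triangular[of 0 e] less.prems(2)] by (simp add: above_def)
  qed (use IH in \<open>auto simp: upper_def\<close>)
  then have "phi e (var \<xi>) + (const (-1)) * (?Y - lead e \<xi>) \<in> ?C"
    using mem cleared_phi[of "const (-1)" "upper \<xi>" e]
    by (intro cleared_add[OF _ _ D less.prems(1)] cleared_mult cleared_phi vars_in_var) auto
  then have lead: "lead e \<xi> \<in> ?C" by (simp add: const_uminus)
  obtain i where i: "i < s" "\<xi> \<in> Us i" "\<xi> \<notin> Us (Suc i)" using removed_at[OF less.prems(2)] .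
  \<comment> \<open>A place filled at step \<open>i\<close> is at most the pivot of that step, hence
    below all earlier pivots; every factor of \<open>vv e i\<close> is thus an admissible
    denominator or numerator.\<close>
  have kj: "kap j \<in> upper \<xi>" if "j \<le> i" for j
    using that i kap_in_0[of j] kap_succ[of j i] kap(2)[OF i(2)] succA_trans[of "kap j" "kap i" \<xi>]
    by (cases "j = i"; cases "\<xi> = kap i") (auto simp: upper_def)
  have Z: "var (Inl j) \<in> ?C" if "j \<le> i" for j
  proof -
    have g: "good_z e z j" using less.prems(1)[of j] kj[OF that] that i(1) by simp
    then have "vars_in (z j) (upper (kap j))" by (simp add: good_z_def)
    then have "vars_in (z j) (upper \<xi>)" by (rule vars_in_mono) (rule upper_mono[OF D kj[OF that]])
    from cleared_phi[OF this, of e] show ?thesis using g by (simp add: good_z_def)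
  qed
  have one: "1 \<in> ?C" using cleared_phi[of 1 "upper \<xi>" e] by simp
  have pow: "b ^ k \<in> ?C" if "b \<in> ?C" for b k
    by (induction k) (use one that cleared_mult in auto)
  have prod: "(\<Prod>j\<in>B. var (Inl j) ^ e i j) \<in> ?C" if "B \<subseteq> {..i}" for B
    using finite_subset[OF that finite_atMost] that
    by (induction B) (use one in \<open>auto intro!: cleared_mult pow Z\<close>)
  have "{..<i} \<subseteq> {..i}" by auto
  from prod[OF this] have "vv e i \<in> ?C"
    unfolding vv_def by (intro cleared_mult cleared_zinv i kj) auto
  note vv = cleared_mult[OF this lead]
  show ?case
  proof (rule removed_cases[OF i])
    assume "vmap \<xi> = Inl i"
    then show ?thesis using Z by simp
  next
    fix a assume a: "\<xi> = (K i, a)" "(i, a) \<in> Pairs" "vmap \<xi> = Inr (Inl (h (i, a)))"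
    have "vv e i * lead e \<xi> = (ww e i * vv e i) * (pp i a :: (tvar, int, 'k) mpoly)"
      by (simp add: a lead_row mult_ac)
    then show ?thesis using vv a by (simp add: ww_vv pp_def)
  next
    fix a assume a: "\<xi> = (a, T i)" "(i, a) \<in> Pairs" "vmap \<xi> = Inr (Inr (h (i, a)))"
    then show ?thesis using lead by (simp add: lead_col qq_def)
  qed
qed

lemma laurent_in_cleared_up:
  fixes z :: "nat \<Rightarrow> (nat \<times> nat, nat, 'k::field_char_0) mpoly" and b :: "(tvar, int, 'k) mpoly"
  assumes D: "up_set D" and z: "\<And>j. j < s \<Longrightarrow> kap j \<in> D \<Longrightarrow> good_z e z j"
    and b: "b \<in> laurent_in (vmap ` D)"
  shows "b \<in> cleared e D"
proof (rule laurent_in_cleared[OF D z _ order.refl b])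
  fix \<xi> assume \<xi>: "\<xi> \<in> D"
  have "(var (vmap \<xi>) :: (tvar, int, 'k) mpoly) \<in> cleared e (upper \<xi>)"
    using upper_mono[OF D \<xi>] z D \<xi> by (intro var_cleared) (auto simp: up_set_def)
  then show "(var (vmap \<xi>) :: (tvar, int, 'k) mpoly) \<in> cleared e D" using upper_mono[OF D \<xi>] by (rule cleared_mono)
qed auto

end

section \<open>Poisson-central elements are invariant\<close>

lemma lie_br_anti: "lie_br M \<eta> \<xi> = - lie_br M \<xi> \<eta>"
  by (cases \<xi>; cases \<eta>) (auto simp: lie_br_def)

locale ideal_places =
  fixes n :: nat and M :: "(nat \<times> nat) set"
  assumes ideal: "is_ideal_set n M"
begin

lemma M_absorbs: "(a, b) \<in> A_set n \<Longrightarrow> (b, c) \<in> A_set n \<Longrightarrow> (a, b) \<in> M \<or> (b, c) \<in> M \<Longrightarrow> (a, c) \<in> M"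
  using ideal unfolding is_ideal_set_def by blast

lemma lie_br_M:
  assumes "\<xi> \<in> A_set n" "\<eta> \<in> M"
  shows "lie_br M \<xi> \<eta> = 0"
proof -
  have "\<eta> \<in> A_set n" using ideal assms(2) unfolding is_ideal_set_def by blast
  then show ?thesis using assms M_absorbs
    by (cases \<xi>; cases \<eta>) (auto simp: lie_br_def yv_def)
qed

lemma lie_br_KL: "\<xi> \<in> A_set n \<Longrightarrow> \<eta> \<in> A_set n \<Longrightarrow> lie_br M \<xi> \<eta> \<in> KL n M"
  by (cases \<xi>; cases \<eta>) (auto simp: lie_br_def KL_def yv_def A_set_def intro!: vars_in_diff vars_in_var)

lemma pbr_KL: "f \<in> KL n M \<Longrightarrow> g \<in> KL n M \<Longrightarrow> pbr n M f g \<in> KL n M"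
  using lie_br_KL unfolding pbr_def KL_def
  by (auto intro!: vars_in_sum vars_in_mult vars_in_pd)

text \<open>The identity plus a column \<open>u\<close> below the diagonal in position
  \<open>b\<close>. Products of two such columns vanish, so the inverse is the same matrix with
  \<open>- u\<close>; these matrices generate the unitriangular group column by column.\<close>

definition col_mat :: "nat \<Rightarrow> (nat \<Rightarrow> 'k::comm_ring_1) \<Rightarrow> nat \<Rightarrow> nat \<Rightarrow> 'k" where
  "col_mat b u a c = (if a = c then 1 else 0) + (if c = b \<and> b < a then u a else 0)"

lemma yv_sum: "\<xi> \<in> A_set n \<Longrightarrow> yv M \<xi> = (\<Sum>x\<in>A_set n - M. if x = \<xi> then var x else 0)"
  by (simp add: yv_def sum.delta)

text \<open>The infinitesimal action of the same column: bracket with the sum of the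
  \<open>u a\<close> times the matrix units \<open>(a, b)\<close>.\<close>

definition col_der :: "nat \<Rightarrow> (nat \<Rightarrow> 'k::comm_ring_1) \<Rightarrow> nat \<times> nat \<Rightarrow> (nat \<times> nat, nat, 'k) mpoly" where
  "col_der b u \<xi> = (\<Sum>a\<in>{b<..n}. const (u a) * lie_br M (a, b) \<xi>)"

text \<open>Conjugation of a matrix unit has a linear part, the bracket, and a quadratic part, which
  would need \<open>i = b\<close> and \<open>b < j\<close>, against \<open>j < i\<close>.\<close>

lemma col_act_generator:
  fixes u :: "nat \<Rightarrow> 'k::comm_ring_1"
  assumes "(i, j) \<in> A_set n - M" "1 \<le> b"
  shows "(\<Sum>(a, c)\<in>A_set n - M. const (col_mat b u a i * col_mat b (\<lambda>x. - u x) j c) * var (a, c))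
    = var (i, j) + col_der b u (i, j)"
proof -
  have ij: "1 \<le> j" "j < i" "i \<le> n" using assms by (auto simp: A_set_def)
  \<comment> \<open>Writing each \<open>yv M\<close> as a delta sum over the places outside
    \<open>M\<close> discards the entries in \<open>M\<close> and allows coefficients of
    \<open>var x\<close> to be compared.\<close>
  have "col_der b u (i, j) = (\<Sum>a\<in>{b<..n}. const (u a) *
      ((if b = i then \<Sum>x\<in>A_set n - M. if x = (a, j) then var x else 0 else 0)
       - (if j = a then \<Sum>x\<in>A_set n - M. if x = (i, b) then var x else 0 else 0)))"
    unfolding col_der_def
  proof (intro sum.cong refl arg_cong2[where f = "(*)"])
    fix a assume "a \<in> {b<..n}"
    then have "b = i \<Longrightarrow> (a, j) \<in> A_set n" "j = a \<Longrightarrow> (i, b) \<in> A_set n"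
      using ij assms(2) by (auto simp: A_set_def)
    then show "(lie_br M (a, b) (i, j) :: (nat \<times> nat, nat, 'k) mpoly) = (if b = i then \<Sum>x\<in>A_set n - M. if x = (a, j) then var x else 0 else 0)
       - (if j = a then \<Sum>x\<in>A_set n - M. if x = (i, b) then var x else 0 else 0)"
      by (simp add: lie_br_def yv_sum)
  qed
  also have "\<dots> = (\<Sum>x\<in>A_set n - M. \<Sum>a\<in>{b<..n}. const (u a) *
      ((if b = i then if x = (a, j) then var x else 0 else 0) - (if j = a then if x = (i, b) then var x else 0 else 0)))"
  proof (subst sum.swap, intro sum.cong refl)
    fix a assume "a \<in> {b<..n}"
    show "const (u a) * ((if b = i then \<Sum>x\<in>A_set n - M. if x = (a, j) then var x else 0 else 0)
       - (if j = a then \<Sum>x\<in>A_set n - M. if x = (i, b) then var x else 0 else 0)) =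
      (\<Sum>x\<in>A_set n - M. const (u a) *
      ((if b = i then if x = (a, j) then var x else 0 else 0) - (if j = a then if x = (i, b) then var x else 0 else 0)))"
      unfolding sum_distrib_left[symmetric] sum_subtractf
      by (cases "b = i"; cases "j = a") (simp_all only: if_True if_False simp_thms sum.neutral_const)
  qed
  also have "\<dots> = (\<Sum>x\<in>A_set n - M. const ((if b = i \<and> snd x = j \<and> b < fst x then u (fst x) else 0)
       - (if x = (i, b) \<and> b < j then u j else 0)) * var x)"
  proof (intro sum.cong refl)
    fix x assume x: "x \<in> A_set n - M"
    obtain c d where cd: "x = (c, d)" by force
    have c: "c \<le> n" using x cd by (auto simp: A_set_def)
    have "(\<Sum>a\<in>{b<..n}. const (u a) *
      ((if b = i then if x = (a, j) then var x else 0 else 0) - (if j = a then if x = (i, b) then var x else 0 else 0)))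
      = (\<Sum>a\<in>{b<..n}. (if a = c then (if b = i \<and> d = j then const (u a) * var x else 0) else 0)
         - (if a = j then (if x = (i, b) then const (u a) * var x else 0) else 0))"
      using cd by (intro sum.cong refl) (auto simp: algebra_simps)
    also have "\<dots> = (if b < c then (if b = i \<and> d = j then const (u c) * var x else 0) else 0)
        - (if b < j then (if x = (i, b) then const (u j) * var x else 0) else 0)"
      using c ij by (simp add: sum_subtractf sum.delta)
    also have "\<dots> = const ((if b = i \<and> snd x = j \<and> b < fst x then u (fst x) else 0)
       - (if x = (i, b) \<and> b < j then u j else 0)) * var x"
      using cd ij by (auto simp: const_uminus)
    finally show "(\<Sum>a\<in>{b<..n}. const (u a) *
      ((if b = i then if x = (a, j) then var x else 0 else 0) - (if j = a then if x = (i, b) then var x else 0 else 0)))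
      = const ((if b = i \<and> snd x = j \<and> b < fst x then u (fst x) else 0)
       - (if x = (i, b) \<and> b < j then u j else 0)) * var x" .
  qed
  finally have D: "col_der b u (i, j) = \<dots>" .
  have V: "(var (i, j) :: (nat \<times> nat, nat, 'k) mpoly) = (\<Sum>x\<in>A_set n - M. const (if x = (i, j) then 1 else 0) * var x)"
    using assms by (subst sum.cong[OF refl, of _ _ "\<lambda>x. if x = (i, j) then var x else 0"]) (auto simp: sum.delta)
  show ?thesis unfolding D unfolding V sum.distrib[symmetric] case_prod_unfold distrib_right[symmetric] const_add[symmetric]
    using ij by (intro sum.cong refl arg_cong2[where f = "(*)"] arg_cong[where f = const])
      (auto simp: col_mat_def prod_eq_iff)
qed

text \<open>The derivation squares to zero on generators: after one bracket the row index exceeds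
  \<open>b\<close> or the column index equals \<open>b\<close>, and no further bracket with column
  \<open>b\<close> is possible.\<close>

lemma col_der_yv:
  fixes u :: "nat \<Rightarrow> 'k::comm_ring_1"
  assumes "\<xi> \<in> A_set n" "a \<in> {b<..n}" "lie_br M (a, b) \<xi> \<noteq> (0 :: (nat \<times> nat, nat, 'k) mpoly)"
  shows "\<exists>\<eta> c. (lie_br M (a, b) \<xi> :: (nat \<times> nat, nat, 'k) mpoly) = const c * yv M \<eta> \<and> col_der b u \<eta> = 0"
proof -
  obtain i j where ij: "\<xi> = (i, j)" by force
  have lt: "j < i" using assms ij by (auto simp: A_set_def)
  show ?thesis
  proof (cases "b = i")
    case True
    then have "(lie_br M (a, b) \<xi> :: (nat \<times> nat, nat, 'k) mpoly) = const 1 * yv M (a, j)" using ij lt assms(2) by (simp add: lie_br_def)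
    moreover have "col_der b u (a, j) = 0"
      using True lt assms(2) by (auto simp: col_der_def lie_br_def intro!: sum.neutral)
    ultimately show ?thesis by blast
  next
    case False
    then have "j = a" using assms(3) ij by (auto simp: lie_br_def split: if_splits)
    then have "(lie_br M (a, b) \<xi> :: (nat \<times> nat, nat, 'k) mpoly) = const (-1) * yv M (i, b)" using False ij by (simp add: lie_br_def const_uminus)
    moreover have "col_der b u (i, b) = 0"
      using \<open>j = a\<close> lt assms(2) by (auto simp: col_der_def lie_br_def intro!: sum.neutral)
    ultimately show ?thesis by blast
  qed
qed

text \<open>The one-parameter group acts through \<open>y + \<tau> D y\<close>, where the extra variable \<open>None\<close> plays the role
  of \<open>\<tau>\<close>; as \<open>D\<close> annihilates \<open>f\<close>, the result does not depend on \<open>\<tau>\<close>.\<close>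

lemma col_act_central:
  fixes f :: "(nat \<times> nat, nat, 'k::field_char_0) mpoly"
  assumes f: "f \<in> KL n M" and b: "1 \<le> b"
    and central: "\<And>\<eta>. \<eta> \<in> A_set n - M \<Longrightarrow> (\<Sum>\<xi>\<in>A_set n - M. pd \<xi> f * lie_br M \<xi> \<eta>) = 0"
  shows "coad_act n M (col_mat b u) (col_mat b (\<lambda>x. - u x)) f = f"
proof -
  let ?D = "col_der b u"
  define \<iota> where "\<iota> = (evalm const (\<lambda>\<xi>. var (Some \<xi>)) :: (nat \<times> nat, nat, 'k) mpoly \<Rightarrow> ((nat \<times> nat) option, nat, 'k) mpoly)"
  define \<sigma> where "\<sigma> = (\<lambda>\<xi>. var (Some \<xi>) + var None * \<iota> (?D \<xi>))"
  define \<tau> where "\<tau> = (\<lambda>c. case_option (const c) var :: (nat \<times> nat) option \<Rightarrow> (nat \<times> nat, nat, 'k) mpoly)"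
  have fV: "vars_in f (A_set n - M)" using f by (simp add: KL_def)
  have zero: "(\<Sum>\<xi>\<in>A_set n - M. pd \<xi> f * lie_br M (a, b) \<xi>) = 0" if "a \<in> {b<..n}" for a
  proof (cases "(a, b) \<in> M")
    case True
    then have "lie_br M (a, b) \<xi> = (0 :: (nat \<times> nat, nat, 'k) mpoly)" if "\<xi> \<in> A_set n - M" for \<xi>
      using that True by (subst lie_br_anti) (simp add: lie_br_M)
    then show ?thesis by simp
  next
    case False
    then have "(a, b) \<in> A_set n - M" using that b by (auto simp: A_set_def)
    from central[OF this] show ?thesis
      unfolding lie_br_anti[of M "(a, b)"] by (simp add: sum_negf)
  qed
  have Df: "(\<Sum>\<xi>\<in>A_set n - M. pd \<xi> f * ?D \<xi>) = 0"
  proof -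
    have "(\<Sum>\<xi>\<in>A_set n - M. pd \<xi> f * ?D \<xi>) = (\<Sum>a\<in>{b<..n}. const (u a) * (\<Sum>\<xi>\<in>A_set n - M. pd \<xi> f * lie_br M (a, b) \<xi>))"
      unfolding col_der_def sum_distrib_left sum.swap[of _ "{b<..n}"]
      by (intro sum.cong refl) (simp add: mult_ac)
    also have "\<dots> = 0" by (intro sum.neutral) (simp add: zero)
    finally show ?thesis .
  qed
  \<comment> \<open>Since \<open>D\<close> applied twice to a generator is zero, the shift by the
    parameter does not change \<open>D\<close> of a generator.\<close>
  have \<sigma>D: "evalm const \<sigma> (?D \<xi>) = \<iota> (?D \<xi>)" if "\<xi> \<in> A_set n" for \<xi>
    unfolding col_der_def \<iota>_def const.evalm_sum
  proof (intro sum.cong refl)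
    fix a assume a: "a \<in> {b<..n}"
    show "evalm const \<sigma> (const (u a) * lie_br M (a, b) \<xi>) = evalm const (\<lambda>\<xi>. var (Some \<xi>)) (const (u a) * lie_br M (a, b) \<xi>)"
    proof (cases "lie_br M (a, b) \<xi> = (0 :: (nat \<times> nat, nat, 'k) mpoly)")
      case False
      from col_der_yv[OF that a False, of u] obtain \<eta> c where
        *: "lie_br M (a, b) \<xi> = (const c * yv M \<eta> :: (nat \<times> nat, nat, 'k) mpoly)" "?D \<eta> = 0" by blast
      have "evalm const \<sigma> (yv M \<eta>) = evalm const (\<lambda>\<xi>. var (Some \<xi>)) (yv M \<eta>)"
        using *(2) by (simp add: yv_def \<sigma>_def \<iota>_def)
      then show ?thesis unfolding *(1) by (simp add: const.evalm_mult)
    qed simp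
  qed
  have pd\<iota>: "pd None (\<iota> p) = 0" for p
  proof -
    have "vars_in p UNIV" by (simp add: vars_in_def)
    then show ?thesis unfolding \<iota>_def
      by (induction p rule: vars_in_induct) (auto simp: const.evalm_add const.evalm_mult pd_add pd_mult pd_var)
  qed
  have "pd None (evalm const \<sigma> f) = (\<Sum>\<xi>\<in>A_set n - M. evalm const \<sigma> (pd \<xi> f) * pd None (\<sigma> \<xi>))"
    by (rule const.chain_rule) (auto simp: pd_add pd_mult fV)
  also have "\<dots> = (\<Sum>\<xi>\<in>A_set n - M. evalm const \<sigma> (pd \<xi> f * ?D \<xi>))"
  proof (intro sum.cong refl)
    fix \<xi> assume "\<xi> \<in> A_set n - M"
    moreover have "pd None (\<sigma> \<xi>) = \<iota> (?D \<xi>)"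
      unfolding \<sigma>_def by (simp add: pd_add pd_mult pd_var pd\<iota>)
    ultimately show "evalm const \<sigma> (pd \<xi> f) * pd None (\<sigma> \<xi>) = evalm const \<sigma> (pd \<xi> f * ?D \<xi>)"
      by (simp add: const.evalm_mult \<sigma>D)
  qed
  also have "\<dots> = 0" using Df by (simp add: const.evalm_sum[symmetric])
  finally have none: "vars_in (evalm const \<sigma> f) (- {None})" by (rule pd_eq_0_imp_vars_in)
  have \<tau>\<iota>: "evalm const (\<tau> c) (\<iota> p) = p" for c p
    unfolding \<iota>_def by (simp add: evalm_evalm[OF const.scalar_hom_axioms] \<tau>_def evalm_const_var)
  have \<tau>\<sigma>: "evalm const (\<tau> c) (\<sigma> \<xi>) = var \<xi> + const c * ?D \<xi>" for c \<xi>
    by (simp add: \<sigma>_def const.evalm_add const.evalm_mult \<tau>\<iota>) (simp add: \<tau>_def)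
  have eq: "evalm const (\<tau> c) (evalm const \<sigma> f) = evalm const (\<lambda>\<xi>. var \<xi> + const c * ?D \<xi>) f" for c
    by (simp add: evalm_evalm[OF const.scalar_hom_axioms] \<tau>\<sigma>)
  have "coad_act n M (col_mat b u) (col_mat b (\<lambda>x. - u x)) f = evalm const (\<lambda>\<xi>. var \<xi> + const 1 * ?D \<xi>) f"
    unfolding coad_act_def subst_eq_evalm
    by (rule evalm_cong[OF fV]) (use col_act_generator[OF _ b] in auto)
  \<comment> \<open>The polynomial does not contain the parameter, so its value at 1, the group
    action, equals its value at 0, which is \<open>f\<close>.\<close>
  also have "\<dots> = evalm const (\<tau> 0) (evalm const \<sigma> f)"
    unfolding eq[symmetric] by (rule evalm_cong[OF none]) (auto simp: \<tau>_def split: option.splits)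
  also have "\<dots> = f" unfolding eq by (simp add: evalm_const_var)
  finally show ?thesis .
qed

lemma M_mono:
  assumes "(a, b) \<in> M" "a \<le> a'" "b' \<le> b" "(a', b') \<in> A_set n"
  shows "(a', b') \<in> M"
proof -
  have ab: "(a, b) \<in> A_set n" using ideal assms(1) unfolding is_ideal_set_def by blast
  have "(a, b') \<in> M" using assms ab M_absorbs[of a b b'] by (cases "b' = b") (auto simp: A_set_def)
  then show ?thesis using assms ab M_absorbs[of a' a b'] by (cases "a' = a") (auto simp: A_set_def)
qed

text \<open>Conjugations compose by matrix multiplication on all index pairs, while the action keeps
  only places outside \<open>M\<close>; discarding the others in between is harmless because
  \<open>M\<close> spans an ideal.\<close>

lemma coad_act_mult:
  fixes f :: "(nat \<times> nat, nat, 'k::comm_ring_1) mpoly"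
  assumes f: "f \<in> KL n M"
    and tri: "lower_unitri n g1" "lower_unitri n h1" "lower_unitri n g2" "lower_unitri n h2"
    and g: "\<And>a c. a \<in> {1..n} \<Longrightarrow> c \<in> {1..n} \<Longrightarrow> g a c = (\<Sum>b=1..n. g1 a b * g2 b c)"
    and h: "\<And>a c. a \<in> {1..n} \<Longrightarrow> c \<in> {1..n} \<Longrightarrow> h a c = (\<Sum>b=1..n. h2 a b * h1 b c)"
  shows "coad_act n M g h f = coad_act n M g1 h1 (coad_act n M g2 h2 f)"
  unfolding coad_act_def subst_eq_evalm evalm_evalm[OF const.scalar_hom_axioms]
proof (rule evalm_cong)
  show "vars_in f (A_set n - M)" using f by (simp add: KL_def)
  fix \<xi> assume "\<xi> \<in> A_set n - M"
  then obtain i j where ij: "\<xi> = (i, j)" "(i, j) \<in> A_set n - M" by (cases \<xi>) auto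
  let ?V = "A_set n - M"
  have tri0: "a \<in> {1..n} \<Longrightarrow> c \<in> {1..n} \<Longrightarrow> a < c \<Longrightarrow> g1 a c = 0 \<and> h1 a c = 0 \<and> g2 a c = 0 \<and> h2 a c = 0" for a c
    using tri by (auto simp: lower_unitri_def)
  have coef: "(\<Sum>(a, b)\<in>?V. g2 a i * h2 j b * (g1 c a * h1 b d)) = g c i * h j d" if "(c, d) \<in> ?V" for c d
  proof -
    have cd: "c \<in> {1..n}" "d \<in> {1..n}" "i \<in> {1..n}" "j \<in> {1..n}" "j < i" using that ij by (auto simp: A_set_def)
    have "g c i * h j d = (\<Sum>a=1..n. \<Sum>b=1..n. g2 a i * h2 j b * (g1 c a * h1 b d))"
      unfolding g[OF cd(1,3)] h[OF cd(4,2)] sum_product by (intro sum.cong refl) (simp add: mult_ac)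
    also have "\<dots> = (\<Sum>(a, b)\<in>{1..n} \<times> {1..n}. g2 a i * h2 j b * (g1 c a * h1 b d))"
      by (simp add: sum.cartesian_product)
    also have "\<dots> = (\<Sum>(a, b)\<in>?V. g2 a i * h2 j b * (g1 c a * h1 b d))"
    proof (rule sum.mono_neutral_right)
      show "\<forall>x\<in>{1..n} \<times> {1..n} - ?V. (case x of (a, b) \<Rightarrow> g2 a i * h2 j b * (g1 c a * h1 b d)) = 0"
      proof
        fix x assume "x \<in> {1..n} \<times> {1..n} - ?V"
        then obtain a b where x: "x = (a, b)" "a \<in> {1..n}" "b \<in> {1..n}" "(a, b) \<notin> ?V" by (cases x) auto
        \<comment> \<open>Each alternative makes one of the four matrix entries zero. If all fail,
          \<open>(a, b)\<close> is a place of \<open>M\<close>, and \<open>(c, d)\<close>, further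
          down and left, would lie in \<open>M\<close> too.\<close>
        have "a < i \<or> j < b \<or> c < a \<or> b < d"
        proof (rule ccontr)
          assume neg: "\<not> ?thesis"
          then have le: "a \<le> c" "d \<le> b" by auto
          have "(a, b) \<in> M" using neg x cd by (auto simp: A_set_def)
          from M_mono[OF this le] that show False by simp
        qed
        then show "(case x of (a, b) \<Rightarrow> g2 a i * h2 j b * (g1 c a * h1 b d)) = 0"
          using tri0 x cd by auto
      qed
    qed (auto simp: A_set_def)
    finally show ?thesis by simp
  qed
  have "(case \<xi> of (i, j) \<Rightarrow> \<Sum>(c, d)\<in>?V. const (g c i * h j d) * var (c, d))
      = (\<Sum>x\<in>?V. \<Sum>y\<in>?V. const (g2 (fst y) i * h2 j (snd y)) * (const (g1 (fst x) (fst y) * h1 (snd y) (snd x)) * (var x :: (nat \<times> nat, nat, 'k) mpoly)))"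
  proof -
    have "const (g (fst x) i * h j (snd x)) = (\<Sum>y\<in>?V. const (g2 (fst y) i * h2 j (snd y)) * const (g1 (fst x) (fst y) * h1 (snd y) (snd x)) :: (nat \<times> nat, nat, 'k) mpoly)"
      if "x \<in> ?V" for x
    proof -
      have const_sum: "const (\<Sum>x\<in>A. u x) = (\<Sum>x\<in>A. const (u x) :: (nat \<times> nat, nat, 'k) mpoly)" for u :: "nat \<times> nat \<Rightarrow> 'k" and A
        by (induction A rule: infinite_finite_induct) (auto simp: const_add)
      have "g (fst x) i * h j (snd x) = (\<Sum>y\<in>?V. g2 (fst y) i * h2 j (snd y) * (g1 (fst x) (fst y) * h1 (snd y) (snd x)))"
        using coef[of "fst x" "snd x"] that by (simp add: case_prod_unfold)
      then show ?thesis by (simp only: const_sum const_mult)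
    qed
    then show ?thesis using ij(1)
      by (auto simp: case_prod_unfold sum_distrib_right mult.assoc intro!: sum.cong)
  qed
  also have "\<dots> = (\<Sum>y\<in>?V. const (g2 (fst y) i * h2 j (snd y)) * (\<Sum>x\<in>?V. const (g1 (fst x) (fst y) * h1 (snd y) (snd x)) * var x))"
    by (subst sum.swap) (simp add: sum_distrib_left)
  also have "\<dots> = evalm const (\<lambda>(i, j). \<Sum>(a, b)\<in>?V. const (g1 a i * h1 j b) * var (a, b))
      (case \<xi> of (i, j) \<Rightarrow> \<Sum>(a, b)\<in>?V. const (g2 a i * h2 j b) * var (a, b))"
    using ij(1) by (simp add: const.evalm_sum const.evalm_mult case_prod_unfold)
  finally show "(case \<xi> of (i, j) \<Rightarrow> \<Sum>(c, d)\<in>?V. const (g c i * h j d) * var (c, d)) = \<dots>" .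
qed

text \<open>Induction on the number of columns of \<open>g\<close> that may differ from the
  identity: the last of them is split off as a \<open>col_mat\<close>, which fixes \<open>f\<close>
  by \<open>col_act_central\<close>.\<close>

lemma central_invariant:
  fixes f :: "(nat \<times> nat, nat, 'k::field_char_0) mpoly"
  assumes f: "f \<in> KL n M"
    and central: "\<And>\<eta>. \<eta> \<in> A_set n - M \<Longrightarrow> (\<Sum>\<xi>\<in>A_set n - M. pd \<xi> f * lie_br M \<xi> \<eta>) = 0"
  shows "f \<in> invariants n M"
proof -
  have main: "coad_act n M g h f = f"
    if "lower_unitri n g" "lower_unitri n h" "mat_inverse n g h"
      "\<And>a c. a \<in> {1..n} \<Longrightarrow> c \<in> {1..n} \<Longrightarrow> b < c \<Longrightarrow> g a c = (if a = c then 1 else 0)" for g h b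
    using that
  proof (induction b arbitrary: g h)
    case 0
    have g1: "g a c = (if a = c then 1 else 0)" if "a \<in> {1..n}" "c \<in> {1..n}" for a c
      using 0(4)[of a c] that by auto
    have h1: "h a c = (if a = c then 1 else 0)" if ac: "a \<in> {1..n}" "c \<in> {1..n}" for a c
    proof -
      have "(\<Sum>x=1..n. g a x * h x c) = (\<Sum>x=1..n. if x = a then h x c else 0)"
        using g1 ac by (intro sum.cong) auto
      then show ?thesis using 0(3) ac by (simp add: mat_inverse_def)
    qed
    have "coad_act n M g h f = evalm const var f"
      unfolding coad_act_def subst_eq_evalm
    proof (rule evalm_cong)
      show "vars_in f (A_set n - M)" using f by (simp add: KL_def)
      fix \<xi> assume \<xi>: "\<xi> \<in> A_set n - M"
      obtain i j where ij: "\<xi> = (i, j)" by force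
      have "(\<Sum>(a, b)\<in>A_set n - M. const (g a i * h j b) * var (a, b) :: (nat \<times> nat, nat, 'k) mpoly)
        = (\<Sum>x\<in>A_set n - M. if x = (i, j) then var x else 0)"
      proof (intro sum.cong refl)
        fix x assume "x \<in> A_set n - M"
        then show "(case x of (a, b) \<Rightarrow> const (g a i * h j b) * var (a, b)) = (if x = (i, j) then var x else (0 :: (nat \<times> nat, nat, 'k) mpoly))"
          using \<xi> ij g1 h1 by (cases x) (auto simp: A_set_def)
      qed
      then show "(case \<xi> of (i, j) \<Rightarrow> \<Sum>(a, b)\<in>A_set n - M. const (g a i * h j b) * var (a, b)) = (var \<xi> :: (nat \<times> nat, nat, 'k) mpoly)"
        using \<xi> ij by (simp add: sum.delta)
    qed
    then show ?case by (simp add: evalm_const_var)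
  next
    case (Suc b)
    show ?case
    proof (cases "Suc b \<le> n")
      case False
      then show ?thesis using Suc.prems by (intro Suc.IH) auto
    next
      case True
      define B where "B = Suc b"
      define u where "u = (\<lambda>a. g a B)"
      \<comment> \<open>\<open>g1\<close> is \<open>g\<close> with column \<open>B\<close> reset, so
        that \<open>g\<close> is \<open>g1\<close> times \<open>col_mat B u\<close>; this
        factorization uses that the columns after \<open>B\<close> are already trivial. Accordingly
        \<open>h1\<close> is \<open>col_mat B u\<close> times \<open>h\<close>.\<close>
      define g1 where "g1 = (\<lambda>a c. if B \<le> c then (if a = c then 1 else 0) else g a c)"
      define h1 where "h1 = (\<lambda>a c. h a c + (if B < a then u a * h B c else 0))"
      have B: "B \<in> {1..n}" using True by (simp add: B_def)
      have gB: "g a c = (if a = c then 1 else 0)" if "a \<in> {1..n}" "c \<in> {1..n}" "B < c" for a c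
        using Suc.prems(4) that by (simp add: B_def)
      have tri: "a \<in> {1..n} \<Longrightarrow> g a a = 1 \<and> h a a = 1"
        "a \<in> {1..n} \<Longrightarrow> c \<in> {1..n} \<Longrightarrow> a < c \<Longrightarrow> g a c = 0 \<and> h a c = 0" for a c
        using Suc.prems(1,2) by (auto simp: lower_unitri_def)
      have l1: "lower_unitri n g1" using tri by (auto simp: lower_unitri_def g1_def)
      have l2: "lower_unitri n h1" using tri B by (auto simp: lower_unitri_def h1_def)
      have l3: "lower_unitri n (col_mat B x)" for x :: "nat \<Rightarrow> 'k" by (auto simp: lower_unitri_def col_mat_def)
      have gF: "g a c = (\<Sum>x=1..n. g1 a x * col_mat B u x c)" if ac: "a \<in> {1..n}" "c \<in> {1..n}" for a c
      proof -
        have "(\<Sum>x=1..n. g1 a x * col_mat B u x c) =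
          (\<Sum>x=1..n. (if x = c then g1 a c else 0) + (if x = a then (if c = B \<and> B < a then u a else 0) else 0))"
          by (intro sum.cong refl) (auto simp: col_mat_def g1_def)
        also have "\<dots> = g1 a c + (if c = B \<and> B < a then u a else 0)"
          using ac by (simp add: sum.distrib sum.delta)
        also have "\<dots> = g a c"
          using ac gB[OF ac] tri B by (auto simp: g1_def u_def not_less le_less)
        finally show ?thesis by simp
      qed
      have hF: "h a c = (\<Sum>x=1..n. col_mat B (\<lambda>x. - u x) a x * h1 x c)" if ac: "a \<in> {1..n}" "c \<in> {1..n}" for a c
      proof -
        have "(\<Sum>x=1..n. col_mat B (\<lambda>x. - u x) a x * h1 x c) =
          (\<Sum>x=1..n. (if x = a then h1 a c else 0) + (if x = B then (if B < a then - u a * h1 B c else 0) else 0))"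
          by (intro sum.cong refl) (auto simp: col_mat_def distrib_right)
        also have "\<dots> = h1 a c + (if B < a then - u a * h1 B c else 0)"
          using ac B by (simp add: sum.distrib sum.delta)
        also have "\<dots> = h a c" by (auto simp: h1_def)
        finally show ?thesis by simp
      qed
      have h1F: "h1 a c = (\<Sum>x=1..n. col_mat B u a x * h x c)" if ac: "a \<in> {1..n}" for a c
      proof -
        have "(\<Sum>x=1..n. col_mat B u a x * h x c) =
          (\<Sum>x=1..n. (if x = a then h a c else 0) + (if x = B then (if B < a then u a * h B c else 0) else 0))"
          by (intro sum.cong refl) (auto simp: col_mat_def distrib_right)
        also have "\<dots> = h1 a c" using ac B by (simp add: sum.distrib sum.delta h1_def)
        finally show ?thesis by simp
      qed
      have inv: "mat_inverse n g1 h1"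
        unfolding mat_inverse_def
      proof (intro ballI)
        fix a d assume ad: "a \<in> {1..n}" "d \<in> {1..n}"
        have "(\<Sum>c=1..n. g1 a c * h1 c d) = (\<Sum>c=1..n. \<Sum>x=1..n. g1 a c * col_mat B u c x * h x d)"
          by (intro sum.cong refl) (simp add: h1F sum_distrib_left mult.assoc)
        also have "\<dots> = (\<Sum>x=1..n. g a x * h x d)"
          by (subst sum.swap) (simp add: gF[OF ad(1)] sum_distrib_right)
        finally show "(\<Sum>c=1..n. g1 a c * h1 c d) = (if a = d then 1 else 0)"
          using Suc.prems(3) ad by (simp add: mat_inverse_def)
      qed
      have F: "coad_act n M (col_mat B u) (col_mat B (\<lambda>x. - u x)) f = f"
        by (rule col_act_central[OF f]) (use B central in auto)
      have "coad_act n M g h f = coad_act n M g1 h1 (coad_act n M (col_mat B u) (col_mat B (\<lambda>x. - u x)) f)"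
        by (rule coad_act_mult[OF f l1 l2 l3 l3 gF hF])
      also have "\<dots> = coad_act n M g1 h1 f"
        by (simp only: F)
      also have "\<dots> = f"
        by (rule Suc.IH[OF l1 l2 inv]) (auto simp: g1_def B_def)
      finally show ?thesis .
    qed
  qed
  have "coad_act n M g h f = f" if "lower_unitri n g" "lower_unitri n h" "mat_inverse n g h" for g h
    by (rule main[OF that, of n]) auto
  then show ?thesis using f by (auto simp: invariants_def)
qed

end

section \<open>Choice of the exponents and of the elements \<open>z i\<close>\<close>

context diagram
begin

lemma Ys_cong_upper:
  fixes e e' :: "nat \<Rightarrow> nat \<Rightarrow> nat"
  assumes "\<xi> \<in> Us 0" "\<And>j. j < s \<Longrightarrow> kap j = \<xi> \<or> succA (kap j) \<xi> \<Longrightarrow> e j = e' j"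
  shows "(Ys e 0 \<xi> :: (tvar, int, 'k::field_char_0) mpoly) = Ys e' 0 \<xi>"
proof -
  have "(Ys e 0 \<xi> - lead e \<xi> :: (tvar, int, 'k) mpoly) = Ys e' 0 \<xi> - lead e' \<xi>"
    using assms Ys_cong[of 0 e e'] by blast
  moreover have "(lead e \<xi> :: (tvar, int, 'k) mpoly) = lead e' \<xi>"
    by (rule lead_cong[OF assms])
  ultimately show ?thesis by simp
qed

definition greater_than :: "nat \<times> nat \<Rightarrow> (nat \<times> nat) set" where
  "greater_than \<xi> = {\<eta> \<in> Us 0. succA \<eta> \<xi>}"

lemma up_set_greater: "up_set (greater_than \<xi>)"
  unfolding up_set_def upper_def greater_than_def by (blast intro: succA_trans)

lemma greater_upper: "greater_than \<xi> \<subseteq> upper \<xi>" "upper \<xi> \<subseteq> Us 0"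
  by (auto simp: greater_than_def upper_def)

lemma kap_greater: "i < s \<Longrightarrow> {j. j < s \<and> kap j \<in> greater_than (kap i)} = {..<i}"
proof (intro equalityI subsetI)
  fix j assume i: "i < s" and "j \<in> {j. j < s \<and> kap j \<in> greater_than (kap i)}"
  then have j: "j < s" "succA (kap j) (kap i)" by (auto simp: greater_than_def)
  have "\<not> succA (kap i) (kap j)" "kap i \<noteq> kap j" using j(2) succA_trans succA_irrefl by (blast, metis)
  then show "j \<in> {..<i}" using kap_succ[of i j] j(1) by (cases i j rule: linorder_cases) auto
next
  fix j assume "i < s" "j \<in> {..<i}"
  then show "j \<in> {j. j < s \<and> kap j \<in> greater_than (kap i)}"
    using kap_succ[of j i] kap_in_0[of j] by (auto simp: greater_than_def)
qed

definition z_form :: "(nat \<Rightarrow> (nat \<times> nat, nat, 'k::field_char_0) mpoly) \<Rightarrow> nat \<Rightarrow> bool" where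
  "z_form z j \<longleftrightarrow> (\<exists>\<alpha> P. vars_in P (greater_than (kap j)) \<and> z j = var (kap j) * (\<Prod>l<j. z l ^ \<alpha> l) + P)"

text \<open>The generator at the \<open>i\<close>-th pivot is \<open>ww e i\<close> plus a
  correction \<open>R\<close> in greater places. If the monomial with exponents
  \<open>\<alpha>\<close> clears \<open>R\<close> to \<open>phi e p\<close>, then \<open>y\<close>
  times the matching product of \<open>z j\<close>, minus \<open>p\<close>, is mapped to
  \<open>ww e i\<close> times that monomial, and this is a variable when
  \<open>e i = \<alpha>\<close>.\<close>

lemma ex_good_z:
  assumes "i \<le> s"
  shows "\<exists>e (z :: nat \<Rightarrow> (nat \<times> nat, nat, 'k::field_char_0) mpoly). \<forall>j<i. good_z e z j \<and> z_form z j"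
  using assms
proof (induction i)
  case (Suc i)
  then obtain e and z :: "nat \<Rightarrow> (nat \<times> nat, nat, 'k) mpoly" where
    z: "\<And>j. j < i \<Longrightarrow> good_z e z j" "\<And>j. j < i \<Longrightarrow> z_form z j" by auto
  have i: "i < s" using Suc.prems by simp
  let ?D = "greater_than (kap i)"
  note D = up_set_greater[of "kap i"] and J = kap_greater[OF i]
  define R where "R = (Ys e 0 (kap i) - ww e i :: (tvar, int, 'k) mpoly)"
  have "R \<in> laurent_in (vmap ` ?D)"
    using bspec[OF Ys_triangular[of 0 e] kap_in_0[OF i]] by (simp add: R_def above_def greater_than_def lead_kap[OF i])
  then have "R \<in> cleared e ?D"
    using z(1) J by (intro laurent_in_cleared_up[OF D]) auto
  then obtain \<alpha> p where p: "vars_in p ?D" "R * (\<Prod>j<i. var (Inl j) ^ \<alpha> j) = phi e p"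
    unfolding cleared_def J by blast
  \<comment> \<open>The pivot image now carries as inverse factors exactly the monomial that clears
    \<open>R\<close>, so that the two cancel. By \<open>Ys_cong\<close> the correction
    \<open>R\<close> itself does not change.\<close>
  define e' where "e' = e(i := \<alpha>)"
  define z' where "z' = z(i := var (kap i) * (\<Prod>j<i. z j ^ \<alpha> j) - p)"
  have notkap: "j \<noteq> i" if "\<xi> \<in> ?D" "kap j = \<xi> \<or> succA (kap j) \<xi>" for \<xi> j
    using that succA_trans succA_irrefl unfolding greater_than_def by blast
  \<comment> \<open>The change at \<open>i\<close> does not reach greater places, so
    \<open>p\<close> and the earlier \<open>z j\<close> keep their images.\<close>
  have Yeq: "(Ys e' 0 \<xi> :: (tvar, int, 'k) mpoly) = Ys e 0 \<xi>" if "\<xi> \<in> ?D" for \<xi>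
    using that notkap[OF that] by (intro Ys_cong_upper) (auto simp: e'_def greater_than_def)
  have phi_eq: "phi e' q = phi e q" if "vars_in q ?D" for q :: "(nat \<times> nat, nat, 'k) mpoly"
    unfolding phi_def by (rule evalm_cong[OF that Yeq])
  have zD: "vars_in (z j) ?D" if "j < i" for j
  proof -
    have "kap j \<in> ?D" using J that by blast
    moreover have "vars_in (z j) (upper (kap j))" using z(1)[OF that] by (simp add: good_z_def)
    ultimately show ?thesis using upper_mono[OF D] vars_in_mono by blast
  qed
  have phiz: "phi e' (z j) = var (Inl j)" if "j < i" for j
    using phi_eq[OF zD[OF that]] z(1)[OF that] by (simp add: good_z_def)
  have "good_z e' z' j \<and> z_form z' j" if "j < Suc i" for j
  proof (cases "j = i")
    case False
    then have j: "j < i" using that by simp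
    have "good_z e' z' j" using z(1)[OF j] phiz[OF j] j by (simp add: good_z_def z'_def)
    moreover obtain \<beta> P where P: "vars_in P (greater_than (kap j))" "z j = var (kap j) * (\<Prod>l<j. z l ^ \<beta> l) + P"
      using z(2)[OF j] by (auto simp: z_form_def)
    have "(\<Prod>l<j. z' l ^ \<beta> l) = (\<Prod>l<j. z l ^ \<beta> l)" using j by (intro prod.cong) (auto simp: z'_def)
    then have "z' j = var (kap j) * (\<Prod>l<j. z' l ^ \<beta> l) + P" using P(2) j by (simp add: z'_def)
    then have "z_form z' j" unfolding z_form_def using P(1) by blast
    ultimately show ?thesis by simp
  next
    case True
    have "(\<Prod>l<i. z' l ^ \<alpha> l) = (\<Prod>l<i. z l ^ \<alpha> l)" by (intro prod.cong) (auto simp: z'_def)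
    then have "z' i = var (kap i) * (\<Prod>l<i. z' l ^ \<alpha> l) + (- p)" by (simp add: z'_def)
    moreover have "vars_in (- p) (greater_than (kap i))" using p(1) by simp
    ultimately have form: "z_form z' i" unfolding z_form_def by blast
    have "\<forall>j<s. succA (kap j) (kap i) \<longrightarrow> e' j = e j" using succA_irrefl by (auto simp: e'_def)
    then have "(Ys e' 0 (kap i) - lead e' (kap i) :: (tvar, int, 'k) mpoly) = Ys e 0 (kap i) - lead e (kap i)"
      using Ys_cong[of 0 e' e] kap_in_0[OF i] by blast
    then have Y: "Ys e' 0 (kap i) = ww e' i + R" by (simp add: lead_kap[OF i] R_def algebra_simps)
    have prod: "phi e' (\<Prod>l<i. z l ^ \<alpha> l) = (\<Prod>l<i. var (Inl l) ^ \<alpha> l)"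
      unfolding phi_prod phi_power using phiz by (intro prod.cong) auto
    have "ww e' i * (\<Prod>l<i. var (Inl l) ^ \<alpha> l) = (var (Inl i) * (\<Prod>j<i. (zinv j * var (Inl j)) ^ \<alpha> j) :: (tvar, int, 'k) mpoly)"
      unfolding ww_def e'_def power_mult_distrib prod.distrib by (simp add: mult_ac)
    then have w: "ww e' i * (\<Prod>l<i. var (Inl l) ^ \<alpha> l) = (var (Inl i) :: (tvar, int, 'k) mpoly)" by simp
    have "phi e' (z' i) = (ww e' i + R) * (\<Prod>l<i. var (Inl l) ^ \<alpha> l) - phi e p"
      by (simp add: z'_def phi_diff phi_mult prod Y phi_eq[OF p(1)])
    also have "\<dots> = var (Inl i)" by (simp add: distrib_right w p(2))
    finally have "phi e' (z' i) = var (Inl i)" .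
    moreover have "vars_in (z' i) (upper (kap i))"
    proof -
      have "vars_in (\<Prod>j<i. z j ^ \<alpha> j) (upper (kap i))"
        using zD greater_upper(1)[of "kap i"]
        by (intro vars_in_prod vars_in_power) (auto intro: vars_in_mono)
      moreover have "vars_in p (upper (kap i))" using p(1) greater_upper(1) by (rule vars_in_mono)
      moreover have "kap i \<in> upper (kap i)" using kap_in_0[OF i] by (simp add: upper_def)
      ultimately show ?thesis by (simp add: z'_def vars_in_diff vars_in_mult vars_in_var)
    qed
    ultimately show ?thesis using form True by (simp add: good_z_def)
  qed
  then show ?case by blast
qed auto

text \<open>A \<open>z\<close> variable is central in the target; injectivity of \<open>phi\<close>
  pulls this back to vanishing brackets of \<open>z i\<close> with all generators, and
  Poisson-central elements are invariant.\<close>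

lemma good_z_invariant:
  fixes z :: "nat \<Rightarrow> (nat \<times> nat, nat, 'k::field_char_0) mpoly"
  assumes "good_z e z i"
  shows "z i \<in> invariants n M"
proof -
  interpret ideal_places n M by unfold_locales (rule ideal)
  have zK: "z i \<in> KL n M"
    using assms greater_upper(2)[of "kap i"] unfolding good_z_def KL_def Us_0 by (auto intro: vars_in_mono)
  show ?thesis
  proof (rule central_invariant[OF zK])
    fix \<eta> assume \<eta>: "\<eta> \<in> A_set n - M"
    have vK: "(var \<eta> :: (nat \<times> nat, nat, 'k) mpoly) \<in> KL n M" using \<eta> by (simp add: KL_def vars_in_var)
    have "phi e (pbr n M (z i) (var \<eta>)) = target_br m (var (Inl i)) (phi e (var \<eta>))"
      using assms phi_pbr[OF zK vK] by (simp add: good_z_def)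
    also have "\<dots> = 0" by (rule target_br_Inl) (auto intro: laurent_in_var)
    finally have "phi e (pbr n M (z i) (var \<eta>)) = phi e 0" by simp
    then have "pbr n M (z i) (var \<eta>) = 0"
    proof (rule inj_onD[OF inj_phi])
      show "pbr n M (z i) (var \<eta>) \<in> KL n M" by (rule pbr_KL[OF zK vK])
    qed (simp add: KL_def)
    moreover have "pbr n M (z i) (var \<eta>) = (\<Sum>\<xi>\<in>A_set n - M. pd \<xi> (z i) * lie_br M \<xi> \<eta>)"
      unfolding pbr_def
    proof (intro sum.cong refl)
      fix \<xi>
      have "(\<Sum>\<zeta>\<in>A_set n - M. pd \<xi> (z i) * pd \<zeta> (var \<eta>) * lie_br M \<xi> \<zeta>)
        = (\<Sum>\<zeta>\<in>A_set n - M. if \<zeta> = \<eta> then pd \<xi> (z i) * lie_br M \<xi> \<eta> else 0)"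
        by (intro sum.cong) (auto simp: pd_var)
      then show "(\<Sum>\<zeta>\<in>A_set n - M. pd \<xi> (z i) * pd \<zeta> (var \<eta>) * lie_br M \<xi> \<zeta>) = pd \<xi> (z i) * lie_br M \<xi> \<eta>"
        using \<eta> by (simp add: sum.delta)
    qed
    ultimately show "(\<Sum>\<xi>\<in>A_set n - M. pd \<xi> (z i) * lie_br M \<xi> \<eta>) = 0" by simp
  qed
qed

text \<open>Surjectivity after localization is \<open>laurent_in_cleared_up\<close> for the set of
  all places outside \<open>M\<close>, where every pivot is an admissible denominator.\<close>

lemma phi_localization:
  fixes z :: "nat \<Rightarrow> (nat \<times> nat, nat, 'k::field_char_0) mpoly"
  assumes z: "\<And>i. i < s \<Longrightarrow> good_z e z i"
  shows "localization_poisson_iso n M s z m (phi e)"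
  unfolding localization_poisson_iso_def
proof (intro conjI ballI allI impI)
  fix b :: "(tvar, int, 'k) mpoly" assume "b \<in> target s m"
  then have "b \<in> laurent_in (vmap ` Us 0)" by (simp add: target_eq_laurent_in vmap_image)
  moreover have "up_set (Us 0)" using greater_upper(2) by (auto simp: up_set_def)
  ultimately have "b \<in> cleared e (Us 0)" using z by (intro laurent_in_cleared_up) auto
  moreover have "{j. j < s \<and> kap j \<in> Us 0} = {..<s}" using kap_in_0 by auto
  ultimately obtain \<alpha> p where p: "vars_in p (Us 0)" "b * (\<Prod>j<s. var (Inl j) ^ \<alpha> j) = phi e p"
    unfolding cleared_def by auto
  have "phi e p * (\<Prod>i<s. zinv i ^ \<alpha> i) = b * (\<Prod>j<s. (var (Inl j) * zinv j) ^ \<alpha> j)"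
    unfolding p(2)[symmetric] power_mult_distrib prod.distrib by (simp add: mult.assoc)
  then have "b = phi e p * (\<Prod>i<s. zinv i ^ \<alpha> i)" by simp
  then show "\<exists>p\<in>KL n M. \<exists>\<alpha>. b = phi e p * (\<Prod>i<s. zinv i ^ \<alpha> i)"
    using p(1) unfolding KL_def Us_0 by blast
qed (use z in \<open>auto simp: phi_target phi_add phi_mult inj_phi phi_pbr good_z_def\<close>)

end

theorem theorem1:
  fixes n :: nat and M :: "(nat \<times> nat) set"
  assumes "n \<ge> 2"
    and "is_ideal_set n M"
  shows "\<exists>z :: nat \<Rightarrow> (nat \<times> nat, nat, 'k::field_char_0) mpoly.
     (\<forall>i < diag_s n M. z i \<in> invariants n M) \<and>
     (\<forall>i < diag_s n M. \<exists>e :: nat \<Rightarrow> nat. \<exists>P.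
         vars_in P {\<eta> \<in> A_set n - M. succA \<eta> (diag_xi n M i)} \<and>
         z i = yv M (diag_xi n M i) * (\<Prod>j<i. z j ^ e j) + P) \<and>
     (\<exists>m \<phi>. localization_poisson_iso n M (diag_s n M) z m \<phi>)"
proof -
  interpret diagram n M by unfold_locales (rule assms(2))
  obtain e and z :: "nat \<Rightarrow> (nat \<times> nat, nat, 'k) mpoly" where
    z: "\<And>j. j < s \<Longrightarrow> good_z e z j" "\<And>j. j < s \<Longrightarrow> z_form z j"
    using ex_good_z[of s] by blast
  have "yv M (kap i) = (var (kap i) :: (nat \<times> nat, nat, 'k) mpoly)" if "i < s" for i
    using kap_in_0[OF that] by (simp add: Us_0 yv_def)
  then have "\<exists>e P. vars_in P {\<eta> \<in> A_set n - M. succA \<eta> (kap i)} \<and> z i = yv M (kap i) * (\<Prod>j<i. z j ^ e j) + P"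
    if "i < s" for i
    using z(2)[OF that] that by (simp add: z_form_def greater_than_def Us_0)
  then show ?thesis
    using good_z_invariant[OF z(1)] phi_localization[of e z, OF z(1)] by (intro exI[of _ z] conjI allI impI) auto
qed

end
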